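(* Let $p$ be a prime number, $G$ a transitive group of degree $n\in p\mathbb{Z}\setminus p^{2}\mathbb{Z}$, and $H$ a corresponding subgroup of $G$. Assume that a $p$-Sylow subgroup $S_{p}$ of $G$ is normal in $G$ and $S_{p}\cong(C_{p})^{2}$. (i) The group $\operatorname{Sha}_{\omega}^{2}(G,J_{G/H})[p^{\infty}]$ is trivial or isomorphic to $\mathbb{Z}/p$; it is non-zero if and only if (b) $[S_{p},G]=S_{p}$ and (c) $N_{G}(S_{p}\cap H)=Z_{G}(S_{p}\cap H)$. (ii) Assume (b) and (c). Then for every admissible set $\mathcal{D}$ of subgroups of $G$, $\operatorname{Sha}_{\mathcal{D}}^{2}(G,J_{G/H})[p^{\infty}]$ is $0$ if some $D\in\mathcal{D}$ contains $S_{p}$, and is isomorphic to $\mathbb{Z}/p$ otherwise.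
   Context: A transitive group of degree $n$ is a subgroup of $\mathfrak{S}_n$ acting transitively on $\{1,\dots,n\}$; a corresponding subgroup is a point stabilizer. $J_{G/H}$ is the cokernel of $\mathbb{Z}\to\operatorname{Ind}_H^G\mathbb{Z}=\mathrm{Hom}_{\mathbb{Z}[H]}(\mathbb{Z}[G],\mathbb{Z})$, $1\mapsto$ constant function $1$. $\operatorname{Sha}^2_{\mathcal{D}}(G,M):=\ker\big(H^2(G,M)\to\bigoplus_{D\in\mathcal{D}}H^2(D,M)\big)$, and $\operatorname{Sha}^2_\omega$ is the case $\mathcal{D}=$ all cyclic subgroups. A finite set of subgroups is admissible if it contains all cyclic subgroups and is stable under conjugation. $[A,B]$ is generated by commutators $aba^{-1}b^{-1}$; $N_G$, $Z_G$ denote normalizer and centralizer; $A[p^\infty]$ is the $p$-primary torsion part. *)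

theory Defs
  imports "HOL-Algebra.Sym_Groups" "HOL-Algebra.Group_Action" "HOL-Algebra.Product_Groups"
    "HOL-Computational_Algebra.Primes"
begin

text \<open>
  A module over a group \<open>G\<close> is given by an abelian group \<open>M\<close>, written
  multiplicatively, together with an action \<open>act\<close> of \<open>G\<close> on the carrier of \<open>M\<close>.
  Its second cohomology is that of the complex of inhomogeneous cochains.
  For a subgroup \<open>D\<close> of \<open>G\<close>, the same \<open>act\<close> makes \<open>M\<close> a module over
  \<open>G\<lparr>carrier := D\<rparr>\<close>.
\<close>

definition cochains1 ::
  "('g, 'x) monoid_scheme \<Rightarrow> ('m, 'y) monoid_scheme \<Rightarrow> ('g \<Rightarrow> 'm) monoid"
  where "cochains1 G M = product_group (carrier G) (\<lambda>_. M)"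

definition cochains2 ::
  "('g, 'x) monoid_scheme \<Rightarrow> ('m, 'y) monoid_scheme \<Rightarrow> ('g \<times> 'g \<Rightarrow> 'm) monoid"
  where "cochains2 G M = product_group (carrier G \<times> carrier G) (\<lambda>_. M)"

definition cochains3 ::
  "('g, 'x) monoid_scheme \<Rightarrow> ('m, 'y) monoid_scheme \<Rightarrow> ('g \<times> 'g \<times> 'g \<Rightarrow> 'm) monoid"
  where "cochains3 G M = product_group (carrier G \<times> carrier G \<times> carrier G) (\<lambda>_. M)"

definition coboundary1 ::
  "('g, 'x) monoid_scheme \<Rightarrow> ('m, 'y) monoid_scheme \<Rightarrow> ('g \<Rightarrow> 'm \<Rightarrow> 'm) \<Rightarrow>
    ('g \<Rightarrow> 'm) \<Rightarrow> 'g \<times> 'g \<Rightarrow> 'm"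
  where "coboundary1 G M act b =
    (\<lambda>(g, h) \<in> carrier G \<times> carrier G.
      act g (b h) \<otimes>\<^bsub>M\<^esub> inv\<^bsub>M\<^esub> b (g \<otimes>\<^bsub>G\<^esub> h) \<otimes>\<^bsub>M\<^esub> b g)"

definition coboundary2 ::
  "('g, 'x) monoid_scheme \<Rightarrow> ('m, 'y) monoid_scheme \<Rightarrow> ('g \<Rightarrow> 'm \<Rightarrow> 'm) \<Rightarrow>
    ('g \<times> 'g \<Rightarrow> 'm) \<Rightarrow> 'g \<times> 'g \<times> 'g \<Rightarrow> 'm"
  where "coboundary2 G M act c =
    (\<lambda>(g, h, k) \<in> carrier G \<times> carrier G \<times> carrier G.
      act g (c (h, k)) \<otimes>\<^bsub>M\<^esub> inv\<^bsub>M\<^esub> c (g \<otimes>\<^bsub>G\<^esub> h, k)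
        \<otimes>\<^bsub>M\<^esub> c (g, h \<otimes>\<^bsub>G\<^esub> k) \<otimes>\<^bsub>M\<^esub> inv\<^bsub>M\<^esub> c (g, h))"

definition cocycles2 ::
  "('g, 'x) monoid_scheme \<Rightarrow> ('m, 'y) monoid_scheme \<Rightarrow> ('g \<Rightarrow> 'm \<Rightarrow> 'm) \<Rightarrow>
    ('g \<times> 'g \<Rightarrow> 'm) monoid"
  where "cocycles2 G M act =
    (cochains2 G M)\<lparr>carrier := kernel (cochains2 G M) (cochains3 G M) (coboundary2 G M act)\<rparr>"

definition coboundaries2 ::
  "('g, 'x) monoid_scheme \<Rightarrow> ('m, 'y) monoid_scheme \<Rightarrow> ('g \<Rightarrow> 'm \<Rightarrow> 'm) \<Rightarrow>
    ('g \<times> 'g \<Rightarrow> 'm) set"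
  where "coboundaries2 G M act = coboundary1 G M act ` carrier (cochains1 G M)"

definition H2 ::
  "('g, 'x) monoid_scheme \<Rightarrow> ('m, 'y) monoid_scheme \<Rightarrow> ('g \<Rightarrow> 'm \<Rightarrow> 'm) \<Rightarrow>
    ('g \<times> 'g \<Rightarrow> 'm) set monoid"
  where "H2 G M act = cocycles2 G M act Mod coboundaries2 G M act"

text \<open>
  A class is a coset of cocycles; all its representatives restrict to the same class over \<open>D\<close>.
\<close>

definition res2 ::
  "('g, 'x) monoid_scheme \<Rightarrow> ('m, 'y) monoid_scheme \<Rightarrow> ('g \<Rightarrow> 'm \<Rightarrow> 'm) \<Rightarrow> 'g set \<Rightarrow>
    ('g \<times> 'g \<Rightarrow> 'm) set \<Rightarrow> ('g \<times> 'g \<Rightarrow> 'm) set"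
  where "res2 G M act D \<xi> =
    the_elem ((\<lambda>c. r_coset (cocycles2 (G\<lparr>carrier := D\<rparr>) M act)
                        (coboundaries2 (G\<lparr>carrier := D\<rparr>) M act) (restrict c (D \<times> D))) ` \<xi>)"

definition Sha2 ::
  "'g set set \<Rightarrow> ('g, 'x) monoid_scheme \<Rightarrow> ('m, 'y) monoid_scheme \<Rightarrow> ('g \<Rightarrow> 'm \<Rightarrow> 'm) \<Rightarrow>
    ('g \<times> 'g \<Rightarrow> 'm) set monoid"
  where "Sha2 \<D> G M act = (H2 G M act)\<lparr>carrier :=
    kernel (H2 G M act) (sum_group \<D> (\<lambda>D. H2 (G\<lparr>carrier := D\<rparr>) M act))
      (\<lambda>\<xi>. \<lambda>D\<in>\<D>. res2 G M act D \<xi>)\<rparr>"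

definition cyclic_subgroups :: "('g, 'x) monoid_scheme \<Rightarrow> 'g set set"
  where "cyclic_subgroups G = {generate G {x} | x. x \<in> carrier G}"

definition Sha2_omega ::
  "('g, 'x) monoid_scheme \<Rightarrow> ('m, 'y) monoid_scheme \<Rightarrow> ('g \<Rightarrow> 'm \<Rightarrow> 'm) \<Rightarrow>
    ('g \<times> 'g \<Rightarrow> 'm) set monoid"
  where "Sha2_omega G M act = Sha2 (cyclic_subgroups G) G M act"

definition admissible_set :: "('g, 'x) monoid_scheme \<Rightarrow> 'g set set \<Rightarrow> bool"
  where "admissible_set G \<D> \<longleftrightarrow>
    finite \<D> \<and> (\<forall>D\<in>\<D>. subgroup D G) \<and> cyclic_subgroups G \<subseteq> \<D> \<and>
    (\<forall>D\<in>\<D>. \<forall>g\<in>carrier G. g <#\<^bsub>G\<^esub> D #>\<^bsub>G\<^esub> inv\<^bsub>G\<^esub> g \<in> \<D>)"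

text \<open>
  An element of \<open>Hom\<^bsub>\<int>[H]\<^esub>(\<int>[G], \<int>)\<close> is determined by its values on \<open>G\<close>, which form an
  arbitrary function that is invariant under left multiplication by \<open>H\<close>;
  \<open>G\<close> acts by right translation of the argument.
\<close>

definition Ind :: "('g, 'x) monoid_scheme \<Rightarrow> 'g set \<Rightarrow> ('g \<Rightarrow> int) monoid"
  where "Ind G H = (product_group (carrier G) (\<lambda>_. integer_group))\<lparr>carrier :=
    {f \<in> carrier G \<rightarrow>\<^sub>E UNIV. \<forall>h\<in>H. \<forall>g\<in>carrier G. f (h \<otimes>\<^bsub>G\<^esub> g) = f g}\<rparr>"

definition Ind_act :: "('g, 'x) monoid_scheme \<Rightarrow> 'g \<Rightarrow> ('g \<Rightarrow> int) \<Rightarrow> 'g \<Rightarrow> int"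
  where "Ind_act G g f = (\<lambda>x\<in>carrier G. f (x \<otimes>\<^bsub>G\<^esub> g))"

definition J_module :: "('g, 'x) monoid_scheme \<Rightarrow> 'g set \<Rightarrow> ('g \<Rightarrow> int) set monoid"
  where "J_module G H = Ind G H Mod range (\<lambda>m. \<lambda>x\<in>carrier G. m)"

definition J_act :: "('g, 'x) monoid_scheme \<Rightarrow> 'g \<Rightarrow> ('g \<Rightarrow> int) set \<Rightarrow> ('g \<Rightarrow> int) set"
  where "J_act G g \<xi> = Ind_act G g ` \<xi>"

definition p_primary :: "nat \<Rightarrow> ('a, 'x) monoid_scheme \<Rightarrow> ('a, 'x) monoid_scheme"
  where "p_primary p A = A\<lparr>carrier := {x \<in> carrier A. \<exists>k::nat. x [^]\<^bsub>A\<^esub> (p ^ k) = \<one>\<^bsub>A\<^esub>}\<rparr>"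

definition commutator_subgroup :: "('g, 'x) monoid_scheme \<Rightarrow> 'g set \<Rightarrow> 'g set \<Rightarrow> 'g set"
  where "commutator_subgroup G A B =
    generate G {a \<otimes>\<^bsub>G\<^esub> b \<otimes>\<^bsub>G\<^esub> inv\<^bsub>G\<^esub> a \<otimes>\<^bsub>G\<^esub> inv\<^bsub>G\<^esub> b | a b. a \<in> A \<and> b \<in> B}"

definition centralizer :: "('g, 'x) monoid_scheme \<Rightarrow> 'g set \<Rightarrow> 'g set"
  where "centralizer G A = {g \<in> carrier G. \<forall>a\<in>A. g \<otimes>\<^bsub>G\<^esub> a = a \<otimes>\<^bsub>G\<^esub> g}"

definition sylow_subgroup :: "nat \<Rightarrow> ('g, 'x) monoid_scheme \<Rightarrow> 'g set \<Rightarrow> bool"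
  where "sylow_subgroup p G S \<longleftrightarrow> subgroup S G \<and> card S = p ^ multiplicity p (order G)"

definition transitive_group :: "nat \<Rightarrow> (nat \<Rightarrow> nat) monoid \<Rightarrow> bool"
  where "transitive_group n G \<longleftrightarrow>
    (\<exists>K. subgroup K (sym_group n) \<and> G = (sym_group n)\<lparr>carrier := K\<rparr>) \<and>
    (\<forall>i\<in>{1..n}. \<forall>j\<in>{1..n}. \<exists>g\<in>carrier G. g i = j)"

definition corresponding_subgroup :: "nat \<Rightarrow> (nat \<Rightarrow> nat) monoid \<Rightarrow> (nat \<Rightarrow> nat) set \<Rightarrow> bool"
  where "corresponding_subgroup n G H \<longleftrightarrow> (\<exists>i\<in>{1..n}. H = stabilizer G (\<lambda>g. g) i)"

end

theory Submission
  imports Defs Complex_Main "HOL-Algebra.Multiplicative_Group" "HOL-Algebra.SndIsomorphismGrp"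
begin

text \<open>
  By dimension shifting along \<open>0 \<rightarrow> \<int> \<rightarrow> \<real> \<rightarrow> \<real>/\<int> \<rightarrow> 0\<close>, a class in \<open>H\<^sup>2(G, J)\<close> is a function
  \<open>f : G \<rightarrow> Map(H\G, \<real>/\<int>)\<close> satisfying \<open>f(gh)(x) = f(g)(x) + f(h)(xg)\<close> up to a constant independent
  of \<open>x\<close>. Averaging over cosets of \<open>S\<close> shows that the \<open>p\<close>-primary part is detected on \<open>S\<close>. Put
  \<open>P = S \<inter> H\<close>, a group of order \<open>p\<close>. Triviality on cyclic subgroups forces the restriction of \<open>f\<close> to
  \<open>S\<close> to be, up to constants, a genuine crossed homomorphism, and by Shapiro's lemma it is
  determined by its values on the point stabilizers \<open>x\<inverse>Px\<close>. After multiplication by the index of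
  \<open>S\<close>, these are the conjugates of a single \<open>N\<^sub>G(P)\<close>-invariant character of \<open>P\<close>, taken modulo the
  restrictions of \<open>G\<close>-invariant characters of \<open>S\<close>. Hence there are at most \<open>p\<close> classes. If
  \<open>N\<^sub>G(P) \<noteq> Z\<^sub>G(P)\<close>, the character of \<open>P\<close> vanishes; if \<open>[S, G] \<noteq> S\<close>, then \<open>S = P \<times> [S, G]\<close> and
  the character extends \<open>G\<close>-invariantly to \<open>S\<close>. If both equalities hold, a nontrivial character of
  \<open>P\<close> gives a nonzero class that vanishes on every subgroup not containing \<open>S\<close>.
\<close>

section \<open>The circle group\<close>

\<comment> \<open>The dimension shift needs only averaging over a finite group, which kills the
  cohomology of real-valued functions modulo constants. Since \<open>J\<close> is a quotient by
  constants, every identity between circle-valued functions holds only up to a constant, and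
  controlling these constants is the main difficulty. On \<open>S\<close> they are removed by
  writing \<open>S = P B\<close> with \<open>B\<close> cyclic and not contained in \<open>H\<close>:
  the class is trivial on \<open>B\<close>, and \<open>P\<close> fixes every point of the
  \<open>S\<close>-orbit of the base point. On \<open>G\<close> the remaining constants measure how
  far the resulting crossed homomorphism on \<open>S\<close> is from being compatible with
  conjugation; summing over a transversal of \<open>S\<close> absorbs them at the price of a factor
  \<open>index_S\<close>. Passing from \<open>S\<close> back to \<open>G\<close> costs the same
  factor once more, so it occurs twice in the triviality criteria; being prime to \<open>p\<close>,
  it can be cancelled on the \<open>p\<close>-primary part. A cyclic subgroup never contains
  \<open>S\<close>, because \<open>P\<close> has a conjugate different from itself, so the
  constructed class is trivial on all cyclic subgroups.\<close>
quotient_type circle = real / "\<lambda>x y :: real. x - y \<in> \<int>"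
  morphisms rep_circle to_circle
proof (rule equivpI)
  show "reflp (\<lambda>x y :: real. x - y \<in> \<int>)"
    by (simp add: reflp_def)
  show "symp (\<lambda>x y :: real. x - y \<in> \<int>)"
  proof (rule sympI)
    fix x y :: real
    assume "x - y \<in> \<int>"
    from Ints_minus[OF this] show "y - x \<in> \<int>" by simp
  qed
  show "transp (\<lambda>x y :: real. x - y \<in> \<int>)"
  proof (rule transpI)
    fix x y z :: real
    assume "x - y \<in> \<int>" "y - z \<in> \<int>"
    from Ints_add[OF this] show "x - z \<in> \<int>" by simp
  qed
qed

instantiation circle :: ab_group_add
begin

lift_definition zero_circle :: circle is 0 .

lift_definition plus_circle :: "circle \<Rightarrow> circle \<Rightarrow> circle" is "(+)"
proof -
  fix a b c d :: real
  assume "a - b \<in> \<int>" "c - d \<in> \<int>"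
  from Ints_add[OF this] show "a + c - (b + d) \<in> \<int>" by (simp add: algebra_simps)
qed

lift_definition uminus_circle :: "circle \<Rightarrow> circle" is uminus
proof -
  fix a b :: real
  assume "a - b \<in> \<int>"
  from Ints_minus[OF this] show "- a - - b \<in> \<int>" by simp
qed

definition minus_circle :: "circle \<Rightarrow> circle \<Rightarrow> circle" where
  "minus_circle a b = a + - b"

instance
proof
  fix a b c :: circle
  show "a + b + c = a + (b + c)" by transfer simp
  show "a + b = b + a" by transfer simp
  show "0 + a = a" by transfer simp
  show "- a + a = 0" by transfer simp
  show "a - b = a + - b" by (rule minus_circle_def)
qed

end

lemma to_circle_rep [simp]: "to_circle (rep_circle a) = a"
  by (rule Quotient3_abs_rep[OF Quotient3_circle])

lemma to_circle_add: "to_circle (a + b) = to_circle a + to_circle b"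
  by (simp add: plus_circle.abs_eq)

lemma to_circle_minus: "to_circle (- a) = - to_circle a"
  by (simp add: uminus_circle.abs_eq)

lemma to_circle_diff: "to_circle (a - b) = to_circle a - to_circle b"
  using to_circle_add[of a "- b"] by (simp add: to_circle_minus)

lemma to_circle_eq_0_iff: "to_circle a = 0 \<longleftrightarrow> a \<in> \<int>"
  by (simp add: zero_circle_def circle.abs_eq_iff)

primrec nmul :: "nat \<Rightarrow> 'a::ab_group_add \<Rightarrow> 'a" where
  "nmul 0 a = 0"
| "nmul (Suc n) a = a + nmul n a"

lemma nmul_zero [simp]: "nmul n 0 = 0"
  by (induction n) auto

lemma nmul_add: "nmul n (a + b) = nmul n a + nmul n b"
  by (induction n) (auto simp: algebra_simps)

lemma nmul_minus: "nmul n (- a) = - nmul n a"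
  by (induction n) (auto simp: algebra_simps)

lemma nmul_diff: "nmul n (a - b) = nmul n a - nmul n b"
  using nmul_add[of n a "- b"] by (simp add: nmul_minus)

lemma nmul_add_left: "nmul (m + n) a = nmul m a + nmul n a"
  by (induction m) (auto simp: algebra_simps)

lemma nmul_mult: "nmul (m * n) a = nmul m (nmul n a)"
  by (induction m) (auto simp: nmul_add_left)

lemma sum_const_nmul: "finite T \<Longrightarrow> (\<Sum>t\<in>T. a) = nmul (card T) a"
  by (induction rule: finite_induct) auto

lemma to_circle_nmul: "to_circle (real n * a) = nmul n (to_circle a)"
proof (induction n)
  case 0
  then show ?case by (simp add: to_circle_eq_0_iff)
next
  case (Suc n)
  then show ?case by (simp add: distrib_right to_circle_add)
qed

text \<open>The \<open>p\<close>-torsion of the circle consists of the classes of i/p and has prime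
  order, so any nonzero element generates it. This is what bounds the number of classes by
  \<open>p\<close>.\<close>

lemma circle_torsion_multiple:
  fixes a b :: circle
  assumes p: "prime p" and a: "nmul p a = 0" and b: "nmul p b = 0" and nz: "a \<noteq> 0"
  obtains m where "b = nmul m a"
proof -
  have p0: "p > 0" using p prime_gt_0_nat by blast
  have "\<exists>i::int. to_circle (real_of_int i / real p) = c" if "nmul p c = 0" for c
  proof -
    have "to_circle (real p * rep_circle c) = 0"
      using that by (simp add: to_circle_nmul)
    then obtain i where "real p * rep_circle c = of_int i"
      unfolding to_circle_eq_0_iff by (elim Ints_cases)
    then have "rep_circle c = of_int i / real p"
      using p0 by (simp add: field_simps)
    then show ?thesis by (metis to_circle_rep)
  qed
  then obtain i j where i: "to_circle (real_of_int i / real p) = a"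
      and j: "to_circle (real_of_int j / real p) = b"
    using a b by metis
  have "\<not> int p dvd i"
  proof
    assume "int p dvd i"
    then obtain k where "i = int p * k" by auto
    then have "real_of_int i / real p = of_int k" using p0 by simp
    then have "to_circle (real_of_int i / real p) = 0" by (simp add: to_circle_eq_0_iff)
    with i nz show False by simp
  qed
  then have "coprime i (int p)"
    using p by (metis coprime_commute prime_imp_coprime prime_nat_int_transfer)
  then obtain k v where k: "k * i + v * int p = 1"
    using bezout_int[of i "int p"] by auto
  \<comment> \<open>\<open>k\<close> inverts \<open>i\<close> modulo \<open>p\<close>, so
    \<open>m * i\<close> is congruent to \<open>j\<close>; the reduction makes the multiplier a
    natural number.\<close>
  define m where "m = nat ((j * k) mod int p)"
  have "int m = j * k - int p * ((j * k) div int p)"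
    using p0 by (simp add: m_def minus_mult_div_eq_mod)
  then have "int m * i - j = (j * k - int p * ((j * k) div int p)) * i - j" by simp
  also have "\<dots> = j * (k * i - 1) - int p * ((j * k) div int p * i)"
    by (simp add: algebra_simps)
  also have "k * i - 1 = - (v * int p)" using k by simp
  finally have "int p dvd int m * i - j" by simp
  then obtain l where l: "int m * i - j = int p * l" by auto
  have "real m * (real_of_int i / real p) - real_of_int j / real p = of_int l"
  proof -
    have "real m * real_of_int i - real_of_int j = real p * of_int l"
      using l by (metis of_int_diff of_int_mult of_int_of_nat_eq)
    then show ?thesis using p0 by (simp add: field_simps)
  qed
  then have "to_circle (real m * (real_of_int i / real p)) - to_circle (real_of_int j / real p) = 0"
    by (simp flip: to_circle_diff add: to_circle_eq_0_iff)
  then have "b = nmul m a" unfolding to_circle_nmul i j by simp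
  then show thesis by (rule that)
qed

section \<open>Group-theoretic preliminaries\<close>

context group
begin

lemma inv_mult_cancel: "x \<in> carrier G \<Longrightarrow> y \<in> carrier G \<Longrightarrow> inv x \<otimes> (x \<otimes> y) = y"
  by (simp flip: m_assoc)

lemma mult_inv_cancel: "x \<in> carrier G \<Longrightarrow> y \<in> carrier G \<Longrightarrow> x \<otimes> (inv x \<otimes> y) = y"
  by (simp flip: m_assoc)

text \<open>A function invariant under left translation by \<open>C\<close> lives on the right
  cosets of \<open>C\<close>, and right translation by \<open>g\<close> only permutes these cosets.
  One transversal serves all \<open>\<phi>\<close> and \<open>g\<close>; this invariance drives the
  averaging over cosets.\<close>

lemma ex_transversal_sum_invariant:
  assumes fin: "finite (carrier G)" and C: "subgroup C G"
  obtains T where "T \<subseteq> carrier G" "card T * card C = card (carrier G)"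
    "\<And>(\<phi> :: 'a \<Rightarrow> 'c::ab_group_add) g.
       (\<And>c d. c \<in> C \<Longrightarrow> d \<in> carrier G \<Longrightarrow> \<phi> (c \<otimes> d) = \<phi> d) \<Longrightarrow> g \<in> carrier G \<Longrightarrow>
       (\<Sum>t\<in>T. \<phi> (t \<otimes> g)) = (\<Sum>t\<in>T. \<phi> t)"
proof -
  interpret C: subgroup C G by (rule C)
  define r where "r K = (SOME k. k \<in> K)" for K :: "'a set"
  have r: "r K \<in> K" if K: "K \<in> rcosets C" for K
  proof -
    obtain a where a: "a \<in> carrier G" "K = C #> a"
      using K by (auto simp: RCOSETS_def)
    then have "a \<in> K" using rcos_self[OF a(1) C] by simp
    then show ?thesis unfolding r_def by (rule someI)
  qed
  have sub: "K \<subseteq> carrier G" if "K \<in> rcosets C" for K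
    using C.rcosets_carrier[OF is_group that] .
  have inj: "inj_on r (rcosets C)"
  proof (rule inj_onI)
    fix K L assume K: "K \<in> rcosets C" and L: "L \<in> rcosets C" and eq: "r K = r L"
    with r[OF K] r[OF L] rcos_disjoint[OF C] show "K = L"
      by (metis disjnt_iff pairwiseD)
  qed
  define T where "T = r ` (rcosets C)"
  show thesis
  proof (rule that)
    show "T \<subseteq> carrier G" using r sub by (auto simp: T_def)
    show "card T * card C = card (carrier G)"
      using lagrange[OF C] by (simp add: T_def card_image[OF inj] order_def mult.commute)
    fix \<phi> :: "'a \<Rightarrow> 'c" and g
    assume inv: "\<And>c d. c \<in> C \<Longrightarrow> d \<in> carrier G \<Longrightarrow> \<phi> (c \<otimes> d) = \<phi> d" and g: "g \<in> carrier G"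
    have const: "\<phi> k = \<phi> l" if K: "K \<in> rcosets C" "k \<in> K" "l \<in> K" for K k l
    proof -
      obtain a where a: "a \<in> carrier G" "K = C #> a"
        using K(1) by (auto simp: RCOSETS_def)
      then have "\<phi> k = \<phi> a" "\<phi> l = \<phi> a"
        using K(2,3) inv by (auto simp: r_coset_def)
      then show ?thesis by simp
    qed
    have mem: "K #> g \<in> rcosets C" if K: "K \<in> rcosets C" for K
    proof -
      obtain a where a: "a \<in> carrier G" "K = C #> a"
        using K by (auto simp: RCOSETS_def)
      then show ?thesis
        using g by (auto simp: RCOSETS_def coset_mult_assoc[OF C.subset])
    qed
    have bij: "bij_betw (\<lambda>K. K #> g) (rcosets C) (rcosets C)"
    proof (rule bij_betw_byWitness[where f' = "\<lambda>K. K #> inv g"])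
      show "\<forall>K\<in>rcosets C. K #> g #> inv g = K" "\<forall>K\<in>rcosets C. K #> inv g #> g = K"
        using sub g by (auto simp: coset_mult_assoc)
      show "(\<lambda>K. K #> g) ` (rcosets C) \<subseteq> rcosets C" using mem by auto
      show "(\<lambda>K. K #> inv g) ` (rcosets C) \<subseteq> rcosets C"
      proof safe
        fix K assume "K \<in> rcosets C"
        then obtain a where a: "a \<in> carrier G" "K = C #> a"
          by (auto simp: RCOSETS_def)
        then show "K #> inv g \<in> rcosets C"
          using g by (auto simp: RCOSETS_def coset_mult_assoc[OF C.subset])
      qed
    qed
    have "(\<Sum>t\<in>T. \<phi> (t \<otimes> g)) = (\<Sum>K\<in>rcosets C. \<phi> (r K \<otimes> g))"
      by (simp add: T_def sum.reindex[OF inj])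
    also have "\<dots> = (\<Sum>K\<in>rcosets C. \<phi> (r (K #> g)))"
    proof (rule sum.cong[OF refl])
      fix K assume K: "K \<in> rcosets C"
      have "r K \<otimes> g \<in> K #> g" using r[OF K] by (auto simp: r_coset_def)
      then show "\<phi> (r K \<otimes> g) = \<phi> (r (K #> g))"
        using const[OF mem[OF K] _ r[OF mem[OF K]]] by blast
    qed
    also have "\<dots> = (\<Sum>K\<in>rcosets C. \<phi> (r K))"
      by (rule sum.reindex_bij_betw[OF bij])
    also have "\<dots> = (\<Sum>t\<in>T. \<phi> t)"
      by (simp add: T_def sum.reindex[OF inj])
    finally show "(\<Sum>t\<in>T. \<phi> (t \<otimes> g)) = (\<Sum>t\<in>T. \<phi> t)" .
  qed
qed

end

section \<open>Crossed homomorphisms modulo constants\<close>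

locale coset_module = group G for G (structure) +
  fixes H
  assumes finite_carrier: "finite (carrier G)" and subgroup_H: "subgroup H G"
begin

text \<open>This encodes a function on the right cosets of \<open>H\<close> as a function on
  \<open>G\<close>; values outside the carrier are unconstrained. The group acts by right
  multiplication of the argument.\<close>

definition inv_fun :: "('a \<Rightarrow> 'c) \<Rightarrow> bool" where
  "inv_fun u \<longleftrightarrow> (\<forall>h\<in>H. \<forall>x\<in>carrier G. u (h \<otimes> x) = u x)"

text \<open>These are the 1-cocycles of \<open>D\<close> with values in functions on the cosets of
  \<open>H\<close> modulo constants, given by lifts to actual functions. The constant
  \<open>z\<close> depends on \<open>g\<close> and \<open>h\<close> and measures the failure to be a
  genuine crossed homomorphism.\<close>

definition jcoc :: "'a set \<Rightarrow> ('a \<Rightarrow> 'a \<Rightarrow> 'c::ab_group_add) \<Rightarrow> bool" where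
  "jcoc D f \<longleftrightarrow> (\<forall>g\<in>D. inv_fun (f g)) \<and>
     (\<forall>g\<in>D. \<forall>h\<in>D. \<exists>z. \<forall>x\<in>carrier G. f g x + f h (x \<otimes> g) - f (g \<otimes> h) x = z)"

text \<open>These are the coboundaries modulo constants: \<open>y\<close> is subject to no relation,
  since each value of a lift matters only up to a constant.\<close>

definition jtriv :: "'a set \<Rightarrow> ('a \<Rightarrow> 'a \<Rightarrow> 'c::ab_group_add) \<Rightarrow> bool" where
  "jtriv D f \<longleftrightarrow> (\<exists>u y. inv_fun u \<and> (\<forall>g\<in>D. \<forall>x\<in>carrier G. f g x = u (x \<otimes> g) - u x + y g))"

definition crossed :: "'a set \<Rightarrow> ('a \<Rightarrow> 'a \<Rightarrow> 'c::ab_group_add) \<Rightarrow> bool" where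
  "crossed D F \<longleftrightarrow> (\<forall>g\<in>D. inv_fun (F g)) \<and>
     (\<forall>g\<in>D. \<forall>h\<in>D. \<forall>x\<in>carrier G. F (g \<otimes> h) x = F g x + F h (x \<otimes> g))"

abbreviation gcoc where "gcoc \<equiv> jcoc (carrier G)"
abbreviation gtriv where "gtriv \<equiv> jtriv (carrier G)"

lemma inv_funD: "inv_fun u \<Longrightarrow> h \<in> H \<Longrightarrow> x \<in> carrier G \<Longrightarrow> u (h \<otimes> x) = u x"
  by (simp add: inv_fun_def)

lemma H_carrier: "h \<in> H \<Longrightarrow> h \<in> carrier G"
  using subgroup.mem_carrier[OF subgroup_H] .

lemma jcocD:
  assumes "jcoc D f" "g \<in> D" "h \<in> D" "x \<in> carrier G" "x' \<in> carrier G"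
  shows "f g x + f h (x \<otimes> g) - f (g \<otimes> h) x = f g x' + f h (x' \<otimes> g) - f (g \<otimes> h) x'"
proof -
  obtain z where "\<forall>x\<in>carrier G. f g x + f h (x \<otimes> g) - f (g \<otimes> h) x = z"
    using assms(1-3) unfolding jcoc_def by blast
  with assms(4,5) show ?thesis by simp
qed

lemma jcoc_inv: "jcoc D f \<Longrightarrow> g \<in> D \<Longrightarrow> inv_fun (f g)"
  by (simp add: jcoc_def)

lemma jcocI:
  assumes "\<And>g. g \<in> D \<Longrightarrow> inv_fun (f g)"
    and "\<And>g h x. g \<in> D \<Longrightarrow> h \<in> D \<Longrightarrow> x \<in> carrier G \<Longrightarrow>
      f g x + f h (x \<otimes> g) - f (g \<otimes> h) x = f g \<one> + f h (\<one> \<otimes> g) - f (g \<otimes> h) \<one>"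
  shows "jcoc D f"
  unfolding jcoc_def using assms by blast

lemma jcoc_subset: "jcoc D f \<Longrightarrow> C \<subseteq> D \<Longrightarrow> jcoc C f"
  unfolding jcoc_def by blast

lemma jtriv_subset: "jtriv D f \<Longrightarrow> C \<subseteq> D \<Longrightarrow> jtriv C f"
  unfolding jtriv_def by blast

lemma jcoc_add:
  assumes f: "jcoc D f" and f': "jcoc D f'"
  shows "jcoc D (\<lambda>g x. f g x + f' g x)"
proof (rule jcocI)
  show "inv_fun (\<lambda>x. f g x + f' g x)" if "g \<in> D" for g
    using jcoc_inv[OF f that] jcoc_inv[OF f' that] by (simp add: inv_fun_def)
  fix g h x assume *: "g \<in> D" "h \<in> D" "x \<in> carrier G"
  show "f g x + f' g x + (f h (x \<otimes> g) + f' h (x \<otimes> g)) - (f (g \<otimes> h) x + f' (g \<otimes> h) x) =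
      f g \<one> + f' g \<one> + (f h (\<one> \<otimes> g) + f' h (\<one> \<otimes> g)) - (f (g \<otimes> h) \<one> + f' (g \<otimes> h) \<one>)"
    using arg_cong2[OF jcocD[OF f * one_closed] jcocD[OF f' * one_closed], of "(+)"]
    by (simp add: algebra_simps)
qed

lemma jtriv_add:
  assumes f: "jtriv D f" and f': "jtriv D f'"
  shows "jtriv D (\<lambda>g x. f g x + f' g x)"
proof -
  obtain u y where u: "inv_fun u" "\<forall>g\<in>D. \<forall>x\<in>carrier G. f g x = u (x \<otimes> g) - u x + y g"
    using f unfolding jtriv_def by blast
  obtain u' y' where u': "inv_fun u'" "\<forall>g\<in>D. \<forall>x\<in>carrier G. f' g x = u' (x \<otimes> g) - u' x + y' g"
    using f' unfolding jtriv_def by blast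
  show ?thesis
    unfolding jtriv_def
    by (rule exI[of _ "\<lambda>x. u x + u' x"], rule exI[of _ "\<lambda>g. y g + y' g"])
       (simp add: inv_fun_def inv_funD[OF u(1)] inv_funD[OF u'(1)] u(2) u'(2) algebra_simps)
qed

lemma jtriv_zero: "jtriv D (\<lambda>g x. 0)"
  unfolding jtriv_def by (rule exI[of _ "\<lambda>x. 0"], rule exI[of _ "\<lambda>g. 0"]) (simp add: inv_fun_def)

lemma jcoc_zero: "jcoc D (\<lambda>g x. 0)"
  by (rule jcocI) (simp_all add: inv_fun_def)

lemma jtriv_nmul: "jtriv D f \<Longrightarrow> jtriv D (\<lambda>g x. nmul n (f g x))"
  by (induction n) (auto intro: jtriv_add jtriv_zero)

lemma jcoc_nmul: "jcoc D f \<Longrightarrow> jcoc D (\<lambda>g x. nmul n (f g x))"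
  by (induction n) (auto intro: jcoc_add jcoc_zero)

lemma jtriv_minus:
  assumes f: "jtriv D f"
  shows "jtriv D (\<lambda>g x. - f g x)"
proof -
  obtain u y where u: "inv_fun u" "\<forall>g\<in>D. \<forall>x\<in>carrier G. f g x = u (x \<otimes> g) - u x + y g"
    using f unfolding jtriv_def by blast
  show ?thesis
    unfolding jtriv_def
    by (rule exI[of _ "\<lambda>x. - u x"], rule exI[of _ "\<lambda>g. - y g"])
       (simp add: inv_fun_def inv_funD[OF u(1)] u(2) algebra_simps)
qed

text \<open>By Bezout, \<open>f\<close> is an integer combination of its multiples by
  \<open>m\<close> and \<open>n\<close>. This is how factors prime to \<open>p\<close> are cancelled
  against powers of \<open>p\<close>.\<close>

lemma jtriv_coprime:
  assumes "jtriv D (\<lambda>g x. nmul m (f g x))" "jtriv D (\<lambda>g x. nmul n (f g x))" "coprime m n"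
  shows "jtriv D f"
proof (cases "m = 0")
  case True
  then have "n = 1" using assms(3) by simp
  with assms(2) show ?thesis by simp
next
  case False
  then obtain a b where ab: "a * m = b * n + 1"
    using bezout_nat[of m n] assms(3) by (auto simp: coprime_iff_gcd_eq_1 mult.commute)
  have "jtriv D (\<lambda>g x. nmul a (nmul m (f g x)) + - nmul b (nmul n (f g x)))"
    by (intro jtriv_add jtriv_minus jtriv_nmul assms)
  moreover have "nmul a (nmul m z) + - nmul b (nmul n z) = z" for z :: 'c
    by (simp flip: nmul_mult add: ab nmul_add_left)
  ultimately show ?thesis by simp
qed

lemma crossed_inv: "crossed D F \<Longrightarrow> g \<in> D \<Longrightarrow> inv_fun (F g)"
  by (simp add: crossed_def)

lemma crossedD: "crossed D F \<Longrightarrow> g \<in> D \<Longrightarrow> h \<in> D \<Longrightarrow> x \<in> carrier G \<Longrightarrow>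
    F (g \<otimes> h) x = F g x + F h (x \<otimes> g)"
  by (simp add: crossed_def)

lemma crossed_imp_jcoc: "crossed D F \<Longrightarrow> jcoc D F"
  by (rule jcocI) (simp_all add: crossed_inv crossedD)

text \<open>
  Modulo constants, the values of a cocycle that is trivial on \<open>C\<close> only depend on the left coset
  of \<open>C\<close>; summing the cocycle identity over these cosets exhibits the multiple by the index as a
  coboundary.
\<close>

lemma jtriv_transfer:
  assumes D: "subgroup D G" and C: "subgroup C G" "C \<subseteq> D"
    and f: "jcoc D f" and triv: "jtriv C f"
  shows "jtriv D (\<lambda>g x. nmul (card D div card C) (f g x))"
proof -
  interpret D: group "G\<lparr>carrier := D\<rparr>" by (rule subgroup_imp_group[OF D])
  have Dc: "\<And>d. d \<in> D \<Longrightarrow> d \<in> carrier G" using subgroup.mem_carrier[OF D] .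
  have finD: "finite D" using finite_subset[OF subgroup.subset[OF D] finite_carrier] .
  have CD: "subgroup C (G\<lparr>carrier := D\<rparr>)" using subgroup_incl[OF C(1) D C(2)] .
  obtain T where T: "T \<subseteq> D" "card T * card C = card D"
    "\<And>(\<phi> :: 'a \<Rightarrow> 'c) g. (\<And>c d. c \<in> C \<Longrightarrow> d \<in> D \<Longrightarrow> \<phi> (c \<otimes> d) = \<phi> d) \<Longrightarrow> g \<in> D \<Longrightarrow>
       (\<Sum>t\<in>T. \<phi> (t \<otimes> g)) = (\<Sum>t\<in>T. \<phi> t)"
    using D.ex_transversal_sum_invariant[OF _ CD, where 'c = 'c] finD by auto
  have finT: "finite T" using finite_subset[OF T(1) finD] .
  have "card C > 0"
    using finite_subset[OF C(2) finD] subgroup.one_closed[OF C(1)] by (auto simp: card_gt_0_iff)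
  then have q: "card D div card C = card T" using T(2) by (metis nonzero_mult_div_cancel_right not_gr0)
  obtain u y where u: "inv_fun u" "\<And>g x. g \<in> C \<Longrightarrow> x \<in> carrier G \<Longrightarrow> f g x = u (x \<otimes> g) - u x + y g"
    using triv unfolding jtriv_def by blast
  \<comment> \<open>Subtracting the coboundary of \<open>u\<close> leaves a function whose values on
    \<open>C\<close> are constant in \<open>x\<close>.\<close>
  define E where "E g x = f g x - u (x \<otimes> g) + u x" for g x
  \<comment> \<open>Normalizing at \<open>\<one>\<close> turns the identity modulo constants into an
    exact one, with a correction term \<open>\<Delta> h g\<close> that does not depend on
    \<open>x\<close>.\<close>
  define \<Delta> where "\<Delta> g x = E g x - E g \<one>" for g x
  have \<Delta>: "\<Delta> (g \<otimes> h) x = \<Delta> g x + \<Delta> h (x \<otimes> g) - \<Delta> h g"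
    if g: "g \<in> D" and h: "h \<in> D" and x: "x \<in> carrier G" for g h x
  proof -
    have "f g x + f h (x \<otimes> g) - f (g \<otimes> h) x = f g \<one> + f h (\<one> \<otimes> g) - f (g \<otimes> h) \<one>"
      using jcocD[OF f g h x one_closed] .
    then show ?thesis
      using g h x Dc by (simp add: \<Delta>_def E_def m_assoc algebra_simps)
  qed
  have \<Delta>C: "\<Delta> c x = 0" if "c \<in> C" "x \<in> carrier G" for c x
    using that u(2) by (simp add: \<Delta>_def E_def)
  have \<Delta>coset: "\<Delta> (g \<otimes> c) x = \<Delta> g x" if "g \<in> D" "c \<in> C" "x \<in> carrier G" for g c x
    using \<Delta>[of g c x] \<Delta>C that C(2) Dc by auto
  \<comment> \<open>Inverses of representatives of right cosets represent the left cosets of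
    \<open>C\<close>, and on those \<open>\<Delta>\<close> is well defined by
    \<open>\<Delta>coset\<close>.\<close>
  define U where "U x = (\<Sum>t\<in>T. \<Delta> (inv t) x)" for x
  have "nmul (card T) (\<Delta> g x) = U x - U (x \<otimes> g) + U g"
    if g: "g \<in> D" and x: "x \<in> carrier G" for g x
  proof -
    have gi: "inv g \<in> D" using subgroup.m_inv_closed[OF D g] .
    have "(\<Sum>t\<in>T. \<Delta> (inv (t \<otimes> inv g)) x) = (\<Sum>t\<in>T. \<Delta> (inv t) x)"
    proof (rule T(3)[OF _ gi])
      fix c d assume cd: "c \<in> C" "d \<in> D"
      then have "inv (c \<otimes> d) = inv d \<otimes> inv c" using C(2) Dc by (simp add: inv_mult_group subset_iff)
      then show "\<Delta> (inv (c \<otimes> d)) x = \<Delta> (inv d) x"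
        using cd x \<Delta>coset subgroup.m_inv_closed[OF D] subgroup.m_inv_closed[OF C(1)] by simp
    qed
    then have "U x = (\<Sum>t\<in>T. \<Delta> (g \<otimes> inv t) x)"
      using T(1) g Dc by (simp add: U_def inv_mult_group subset_iff)
    also have "\<dots> = (\<Sum>t\<in>T. \<Delta> g x + \<Delta> (inv t) (x \<otimes> g) - \<Delta> (inv t) g)"
      by (rule sum.cong[OF refl]) (use \<Delta> g x T(1) subgroup.m_inv_closed[OF D] in auto)
    also have "\<dots> = nmul (card T) (\<Delta> g x) + U (x \<otimes> g) - U g"
      by (simp add: sum.distrib sum_subtractf U_def sum_const_nmul[OF finT])
    finally show ?thesis by (simp add: algebra_simps)
  qed
  then have eq: "nmul (card T) (f g x) = (nmul (card T) (u (x \<otimes> g)) - U (x \<otimes> g)) -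
      (nmul (card T) (u x) - U x) + (U g + nmul (card T) (E g \<one>))"
    if "g \<in> D" "x \<in> carrier G" for g x
    using that by (auto simp: \<Delta>_def E_def nmul_add nmul_diff algebra_simps)
  have "inv_fun (\<lambda>x. nmul (card T) (u x) - U x)"
  proof -
    have "U (h \<otimes> x) = U x" if "h \<in> H" "x \<in> carrier G" for h x
      unfolding U_def
    proof (rule sum.cong[OF refl])
      fix t assume "t \<in> T"
      then have t: "inv t \<in> D" using T(1) subgroup.m_inv_closed[OF D] by auto
      show "\<Delta> (inv t) (h \<otimes> x) = \<Delta> (inv t) x"
        using that Dc[OF t] inv_funD[OF jcoc_inv[OF f t]] inv_funD[OF u(1)]
        by (simp add: \<Delta>_def E_def m_assoc H_carrier)
    qed
    then show ?thesis using inv_funD[OF u(1)] by (simp add: inv_fun_def)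
  qed
  then show ?thesis
    unfolding jtriv_def q
    by (intro exI[of _ "\<lambda>x. nmul (card T) (u x) - U x"] exI[of _ "\<lambda>g. U g + nmul (card T) (E g \<one>)"]
        conjI ballI eq)
qed

text \<open>Shapiro's lemma for the permutation module of \<open>C\<close> on \<open>H \ G\<close>, orbit by orbit.\<close>

lemma crossed_zero_on_stabilizers:
  assumes C: "subgroup C G" and F: "crossed C F"
    and zero: "\<And>s x. s \<in> C \<Longrightarrow> x \<in> carrier G \<Longrightarrow> x \<otimes> s \<otimes> inv x \<in> H \<Longrightarrow> F s x = 0"
  shows "\<exists>u. inv_fun u \<and> (\<forall>s\<in>C. \<forall>x\<in>carrier G. F s x = u (x \<otimes> s) - u x)"
proof -
  interpret H: subgroup H G by (rule subgroup_H)
  interpret C: subgroup C G by (rule C)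
  \<comment> \<open>The double coset of \<open>x\<close> is the \<open>C\<close>-orbit of its point
    in the coset space of \<open>H\<close>.\<close>
  define dc where "dc x = {h \<otimes> x \<otimes> s |h s. h \<in> H \<and> s \<in> C}" for x
  have dc_sub: "dc (h \<otimes> x \<otimes> s) \<subseteq> dc x" if "h \<in> H" "s \<in> C" "x \<in> carrier G" for h x s
  proof
    fix y assume "y \<in> dc (h \<otimes> x \<otimes> s)"
    then obtain h' s' where "y = h' \<otimes> (h \<otimes> x \<otimes> s) \<otimes> s'" "h' \<in> H" "s' \<in> C"
      by (auto simp: dc_def)
    moreover from this have "y = (h' \<otimes> h) \<otimes> x \<otimes> (s \<otimes> s')"
      using that by (simp add: m_assoc)
    ultimately show "y \<in> dc x"
      using that H.m_closed C.m_closed unfolding dc_def by blast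
  qed
  have dc_eq: "dc (h \<otimes> x \<otimes> s) = dc x" if *: "h \<in> H" "s \<in> C" "x \<in> carrier G" for h x s
  proof
    show "dc (h \<otimes> x \<otimes> s) \<subseteq> dc x" using dc_sub * by blast
    have "dc (inv h \<otimes> (h \<otimes> x \<otimes> s) \<otimes> inv s) \<subseteq> dc (h \<otimes> x \<otimes> s)"
      using dc_sub[of "inv h" "inv s" "h \<otimes> x \<otimes> s"] * by simp
    moreover have "inv h \<otimes> (h \<otimes> x \<otimes> s) \<otimes> inv s = x"
      using * by (simp add: m_assoc inv_mult_cancel)
    ultimately show "dc x \<subseteq> dc (h \<otimes> x \<otimes> s)" by simp
  qed
  define \<rho> where "\<rho> x = (SOME z. z \<in> dc x)" for x
  have self: "x \<in> dc x" if "x \<in> carrier G" for x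
    unfolding dc_def using that H.one_closed C.one_closed by (auto intro!: exI[of _ \<one>])
  have \<rho>: "\<rho> x \<in> dc x" if "x \<in> carrier G" for x
    unfolding \<rho>_def using someI[of "\<lambda>z. z \<in> dc x", OF self[OF that]] .
  have rc: "\<rho> x \<in> carrier G" if "x \<in> carrier G" for x
    using \<rho>[OF that] that by (auto simp: dc_def)
  have rep: "\<exists>h s. h \<in> H \<and> s \<in> C \<and> x = h \<otimes> \<rho> x \<otimes> s" if x: "x \<in> carrier G" for x
  proof -
    obtain h s where hs: "\<rho> x = h \<otimes> x \<otimes> s" "h \<in> H" "s \<in> C"
      using \<rho>[OF x] by (auto simp: dc_def)
    then have "inv h \<otimes> \<rho> x \<otimes> inv s = x"
      using x by (simp add: m_assoc inv_mult_cancel)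
    then show ?thesis using hs by (metis H.m_inv_closed C.m_inv_closed)
  qed
  define \<sigma> where "\<sigma> x = (SOME s. s \<in> C \<and> (\<exists>h\<in>H. x = h \<otimes> \<rho> x \<otimes> s))" for x
  have \<sigma>: "\<sigma> x \<in> C \<and> (\<exists>h\<in>H. x = h \<otimes> \<rho> x \<otimes> \<sigma> x)" if "x \<in> carrier G" for x
    unfolding \<sigma>_def by (rule someI_ex) (use rep[OF that] in blast)
  \<comment> \<open>Requiring \<open>u\<close> to vanish at the chosen representative
    \<open>\<rho> x\<close> of each orbit forces this formula; it remains to see that the choice of
    \<open>\<sigma> x\<close> does not matter.\<close>
  define u where "u x = F (\<sigma> x) (\<rho> x)" for x
  have u: "u x = F s (\<rho> x)"
    if x: "x \<in> carrier G" and h: "h \<in> H" and s: "s \<in> C" and eq: "x = h \<otimes> \<rho> x \<otimes> s" for x h s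
  proof -
    obtain h' where h': "h' \<in> H" "x = h' \<otimes> \<rho> x \<otimes> \<sigma> x" and s': "\<sigma> x \<in> C"
      using \<sigma>[OF x] by blast
    note r = rc[OF x]
    \<comment> \<open>Two elements of \<open>C\<close> carrying the point of \<open>\<rho> x\<close>
      to that of \<open>x\<close> differ by an element of the stabilizer of \<open>\<rho> x\<close>,
      where \<open>F\<close> vanishes by hypothesis.\<close>
    define t where "t = s \<otimes> inv (\<sigma> x)"
    have t: "t \<in> C" using s s' by (simp add: t_def)
    have "h \<otimes> (\<rho> x \<otimes> t) = (h \<otimes> \<rho> x \<otimes> s) \<otimes> inv (\<sigma> x)"
      using h r s s' by (simp add: t_def m_assoc)
    also have "\<dots> = (h' \<otimes> \<rho> x \<otimes> \<sigma> x) \<otimes> inv (\<sigma> x)"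
      unfolding eq[symmetric] h'(2)[symmetric] ..
    also have "\<dots> = h' \<otimes> \<rho> x" using h'(1) r s' by (simp add: m_assoc)
    finally have "inv h \<otimes> (h \<otimes> (\<rho> x \<otimes> t)) = inv h \<otimes> (h' \<otimes> \<rho> x)" by simp
    then have *: "\<rho> x \<otimes> t = (inv h \<otimes> h') \<otimes> \<rho> x"
      using h h'(1) r t by (simp add: inv_mult_cancel m_assoc)
    have hh: "inv h \<otimes> h' \<in> H" using h h'(1) by simp
    have "\<rho> x \<otimes> t \<otimes> inv (\<rho> x) = inv h \<otimes> h'"
      unfolding * using h h'(1) r by (simp add: m_assoc)
    then have "F t (\<rho> x) = 0" using zero[OF t r] hh by simp
    moreover have "s = t \<otimes> \<sigma> x" using s s' by (simp add: t_def m_assoc)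
    ultimately have "F s (\<rho> x) = F (\<sigma> x) (\<rho> x \<otimes> t)"
      using crossedD[OF F t s' r] by simp
    also have "\<dots> = F (\<sigma> x) (\<rho> x)"
      unfolding * using inv_funD[OF crossed_inv[OF F s'] hh r] .
    finally show ?thesis by (simp add: u_def)
  qed
  have \<rho>_eq: "\<rho> (h \<otimes> x \<otimes> s) = \<rho> x" if "h \<in> H" "s \<in> C" "x \<in> carrier G" for h x s
    using dc_eq[OF that] by (simp add: \<rho>_def)
  have "inv_fun u"
    unfolding inv_fun_def
  proof (intro ballI)
    fix h x assume h: "h \<in> H" and x: "x \<in> carrier G"
    obtain h' s where h': "h' \<in> H" "s \<in> C" "x = h' \<otimes> \<rho> x \<otimes> s" using rep[OF x] by blast
    have r: "\<rho> (h \<otimes> x) = \<rho> x" using \<rho>_eq[OF h C.one_closed x] h x by simp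
    have "h \<otimes> x = h \<otimes> (h' \<otimes> \<rho> x \<otimes> s)" unfolding h'(3)[symmetric] ..
    also have "\<dots> = (h \<otimes> h') \<otimes> \<rho> (h \<otimes> x) \<otimes> s"
      unfolding r using h h'(1,2) rc[OF x] by (simp add: m_assoc)
    finally have "h \<otimes> x = (h \<otimes> h') \<otimes> \<rho> (h \<otimes> x) \<otimes> s" .
    from u[OF m_closed[OF H.mem_carrier[OF h] x] H.m_closed[OF h h'(1)] h'(2) this]
    have "u (h \<otimes> x) = F s (\<rho> x)" unfolding r .
    also have "\<dots> = u x" using u[OF x h'] by simp
    finally show "u (h \<otimes> x) = u x" .
  qed
  moreover have "F s' x = u (x \<otimes> s') - u x" if s': "s' \<in> C" and x: "x \<in> carrier G" for s' x
  proof -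
    obtain h s where h: "h \<in> H" "s \<in> C" "x = h \<otimes> \<rho> x \<otimes> s" using rep[OF x] by blast
    note rx = rc[OF x]
    have r: "\<rho> (x \<otimes> s') = \<rho> x" using \<rho>_eq[OF H.one_closed s' x] s' x by simp
    have "x \<otimes> s' = (h \<otimes> \<rho> x \<otimes> s) \<otimes> s'" unfolding h(3)[symmetric] ..
    also have "\<dots> = h \<otimes> \<rho> (x \<otimes> s') \<otimes> (s \<otimes> s')"
      unfolding r using h(1,2) s' rx by (simp add: m_assoc)
    finally have "x \<otimes> s' = h \<otimes> \<rho> (x \<otimes> s') \<otimes> (s \<otimes> s')" .
    from u[OF m_closed[OF x C.mem_carrier[OF s']] h(1) C.m_closed[OF h(2) s'] this]
    have "u (x \<otimes> s') = F (s \<otimes> s') (\<rho> x)" unfolding r .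
    also have "\<dots> = F s (\<rho> x) + F s' (\<rho> x \<otimes> s)" using crossedD[OF F h(2) s' rx] .
    also have "F s (\<rho> x) = u x" using u[OF x h] by simp
    also have "F s' (\<rho> x \<otimes> s) = F s' (h \<otimes> (\<rho> x \<otimes> s))"
      using inv_funD[OF crossed_inv[OF F s'] h(1)] rx h(2) by simp
    also have "h \<otimes> (\<rho> x \<otimes> s) = x" unfolding m_assoc[OF H.mem_carrier[OF h(1)] rx C.mem_carrier[OF h(2)], symmetric] h(3)[symmetric] ..
    finally show ?thesis by simp
  qed
  ultimately show ?thesis by blast
qed

end

section \<open>Locally trivial classes\<close>

text \<open>\<open>card_P\<close> records that \<open>p\<close> divides the degree exactly once, and
  \<open>not_normal_P\<close> that the permutation action is faithful: a subgroup of a point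
  stabilizer that is normal in a transitive group fixes every point.\<close>

locale sylow_module = coset_module +
  fixes S p
  assumes prime_p: "prime p" and normal_S: "S \<lhd> G"
    and comm_S: "\<And>s t. s \<in> S \<Longrightarrow> t \<in> S \<Longrightarrow> s \<otimes> t = t \<otimes> s"
    and card_S: "card S = p\<^sup>2"
    and coprime_index: "coprime p (card (carrier G) div card S)"
    and card_P: "card (S \<inter> H) = p"
    and not_normal_P: "\<exists>g\<in>carrier G. \<exists>a\<in>S \<inter> H. g \<otimes> a \<otimes> inv g \<notin> H"
begin

sublocale S: normal S G by (rule normal_S)

abbreviation P where "P \<equiv> S \<inter> H"

lemma subgroup_S: "subgroup S G"
  by (rule S.subgroup_axioms)

lemma subgroup_P: "subgroup P G"
  using subgroups_Inter_pair[OF subgroup_S subgroup_H] .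

lemma finite_S: "finite S"
  using finite_subset[OF S.subset finite_carrier] .

lemma conj_S: "g \<in> carrier G \<Longrightarrow> s \<in> S \<Longrightarrow> g \<otimes> s \<otimes> inv g \<in> S"
  using S.inv_op_closed2 by simp

lemma conj_S': "g \<in> carrier G \<Longrightarrow> s \<in> S \<Longrightarrow> inv g \<otimes> s \<otimes> g \<in> S"
  using S.inv_op_closed1 by simp

section \<open>Subgroups of \<open>S\<close> and of \<open>P\<close>\<close>

lemma card_subgroup_S:
  assumes "subgroup K G" "K \<subseteq> S"
  shows "card K = 1 \<or> card K = p \<or> K = S"
proof -
  interpret GS: group "G\<lparr>carrier := S\<rparr>" by (rule subgroup_imp_group[OF subgroup_S])
  have "subgroup K (G\<lparr>carrier := S\<rparr>)"
    using subgroup_incl[OF assms(1) subgroup_S assms(2)] .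
  from GS.lagrange[OF this] have "card K dvd p ^ 2"
    by (metis card_S dvd_triv_right order_def partial_object.select_convs(1)
        partial_object.update_convs(1) partial_object.surjective)
  then obtain i where i: "i \<le> 2" "card K = p ^ i"
    using divides_primepow_nat[OF prime_p] by blast
  then consider "i = 0" | "i = 1" | "i = 2" by linarith
  then show ?thesis
  proof cases
    case 3
    then show ?thesis using i card_S card_subset_eq[OF finite_S assms(2)] by simp
  qed (use i in auto)
qed

lemma card_subgroup_P:
  assumes "subgroup K G" "K \<subseteq> P"
  shows "K = {\<one>} \<or> K = P"
proof -
  have fin: "finite P" using finite_S by simp
  have "p < p\<^sup>2" using prime_gt_1_nat[OF prime_p] by (simp add: power2_eq_square)
  then have "card S \<noteq> card P" unfolding card_S card_P by simp
  then have "S \<noteq> P" by metis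
  then have "K \<noteq> S" using assms(2) by blast
  then consider "card K = 1" | "card K = p" using card_subgroup_S[OF assms(1)] assms(2) by blast
  then show ?thesis
  proof cases
    case 1
    then obtain z where "K = {z}" by (auto simp: card_1_singleton_iff)
    then show ?thesis using subgroup.one_closed[OF assms(1)] by simp
  next
    case 2
    then show ?thesis using card_subset_eq[OF fin assms(2)] card_P by simp
  qed
qed

text \<open>The product set is a subgroup because \<open>S\<close> is abelian. It properly contains
  \<open>P\<close>, which has order \<open>p\<close>, and so its order is the square of
  \<open>p\<close>.\<close>

lemma P_mult_eq_S:
  assumes B: "subgroup B G" "B \<subseteq> S" "\<not> B \<subseteq> H" and s: "s \<in> S"
  obtains a b where "a \<in> P" "b \<in> B" "s = a \<otimes> b"
proof -
  define K where "K = {a \<otimes> b |a b. a \<in> P \<and> b \<in> B}"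
  have KS: "K \<subseteq> S" using B(2) by (auto simp: K_def)
  have sub: "subgroup K G"
  proof (rule subgroupI)
    show "K \<subseteq> carrier G" using KS S.subset by auto
    show "K \<noteq> {}" using subgroup.one_closed[OF subgroup_P] subgroup.one_closed[OF B(1)]
      unfolding K_def by blast
  next
    fix x assume "x \<in> K"
    then obtain a b where ab: "a \<in> P" "b \<in> B" "x = a \<otimes> b" by (auto simp: K_def)
    have "inv x = inv a \<otimes> inv b"
      using ab B(2) comm_S[of "inv a" "inv b"] by (auto simp: inv_mult_group)
    then show "inv x \<in> K"
      unfolding K_def using subgroup.m_inv_closed[OF subgroup_P ab(1)] subgroup.m_inv_closed[OF B(1) ab(2)]
      by blast
  next
    fix x y assume "x \<in> K" "y \<in> K"
    then obtain a b a' b' where ab: "a \<in> P" "b \<in> B" "x = a \<otimes> b"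
      "a' \<in> P" "b' \<in> B" "y = a' \<otimes> b'" by (auto simp: K_def)
    have S: "a \<in> S" "b \<in> S" "a' \<in> S" "b' \<in> S" using ab B(2) by auto
    have "x \<otimes> y = a \<otimes> (b \<otimes> a') \<otimes> b'" using S ab by (simp add: m_assoc)
    also have "b \<otimes> a' = a' \<otimes> b" using comm_S S by simp
    also have "a \<otimes> (a' \<otimes> b) \<otimes> b' = (a \<otimes> a') \<otimes> (b \<otimes> b')" using S by (simp add: m_assoc)
    finally show "x \<otimes> y \<in> K"
      unfolding K_def using subgroup.m_closed[OF subgroup_P ab(1,4)] subgroup.m_closed[OF B(1) ab(2,5)]
      by blast
  qed
  have PK: "P \<subseteq> K"
  proof
    fix a assume a: "a \<in> P"
    then have "a = a \<otimes> \<one>" by simp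
    then show "a \<in> K" unfolding K_def using a subgroup.one_closed[OF B(1)] by blast
  qed
  obtain b where b: "b \<in> B" "b \<notin> H" using B(3) by blast
  have "b = \<one> \<otimes> b" using b B(2) by auto
  then have "b \<in> K" unfolding K_def using b subgroup.one_closed[OF subgroup_P] by blast
  with PK b have "P \<subset> K" by blast
  from psubset_card_mono[OF finite_subset[OF KS finite_S] this] have "p < card K"
    unfolding card_P .
  then have "K = S" using card_subgroup_S[OF sub KS] prime_gt_1_nat[OF prime_p] by auto
  with s that show thesis unfolding K_def by blast
qed

lemma generate_P:
  assumes a0: "a0 \<in> P" "a0 \<noteq> \<one>"
  shows "generate G {a0} = P"
proof -
  have sub: "subgroup (generate G {a0}) G" using generate_is_subgroup[of "{a0}"] a0(1) by simp
  have "generate G {a0} \<subseteq> P"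
    using generate_subgroup_incl[OF _ subgroup_P] a0(1) by simp
  moreover have "a0 \<in> generate G {a0}" by (simp add: generate.incl)
  ultimately show ?thesis using card_subgroup_P[OF sub] a0(2) by blast
qed

lemma P_powers:
  assumes a0: "a0 \<in> P" "a0 \<noteq> \<one>" and a: "a \<in> P"
  obtains k :: nat where "a = a0 [^] k"
  using that a generate_P[OF a0] generate_pow_on_finite_carrier[OF finite_carrier, of a0] a0(1) by auto

section \<open>Classes trivial on the cyclic subgroups of \<open>S\<close>\<close>

definition sha :: "('a \<Rightarrow> 'a \<Rightarrow> 'c::ab_group_add) \<Rightarrow> bool" where
  "sha f \<longleftrightarrow> (\<forall>s\<in>S. jtriv (generate G {s}) f)"

text \<open>Membership of \<open>x \<otimes> s \<otimes> inv x\<close> in \<open>H\<close> means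
  that right multiplication by \<open>s\<close> fixes the coset of \<open>x\<close>.\<close>

lemma fixed_point:
  assumes "inv_fun u" "x \<in> carrier G" "s \<in> carrier G" "x \<otimes> s \<otimes> inv x \<in> H"
  shows "u (x \<otimes> s) = u x"
proof -
  have "x \<otimes> s = (x \<otimes> s \<otimes> inv x) \<otimes> x" using assms(2,3) by (simp add: m_assoc)
  then show ?thesis using inv_funD[OF assms(1) assms(4,2)] by simp
qed

text \<open>At a point fixed by \<open>s\<close> the coboundary of \<open>u\<close> vanishes,
  leaving only the constant attached to \<open>s\<close>.\<close>

lemma sha_fixed:
  assumes "sha f" and s: "s \<in> S"
    and x: "x \<in> carrier G" "x \<otimes> s \<otimes> inv x \<in> H"
    and x': "x' \<in> carrier G" "x' \<otimes> s \<otimes> inv x' \<in> H"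
  shows "f s x = f s x'"
proof -
  obtain u y where u: "inv_fun u"
      "\<forall>g\<in>generate G {s}. \<forall>x\<in>carrier G. f g x = u (x \<otimes> g) - u x + y g"
    using assms(1) s unfolding sha_def jtriv_def by blast
  have "s \<in> generate G {s}" by (simp add: generate.incl)
  then show ?thesis
    using u fixed_point[OF u(1) x(1) _ x(2)] fixed_point[OF u(1) x'(1) _ x'(2)] s x(1) x'(1) by simp
qed

text \<open>The constants in the cocycle identity have to be split as a coboundary, and the values
  at the base point suffice for that. Every element of \<open>P\<close> fixes all points of the
  \<open>S\<close>-orbit of the base point, since \<open>S\<close> is abelian; as
  \<open>S = P B\<close>, the function \<open>u\<close> that trivializes \<open>f\<close> on the
  cyclic group \<open>B\<close> describes the variation of all \<open>f t\<close> along this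
  orbit.\<close>

lemma sha_crossed:
  assumes f: "gcoc f" and sha: "sha f"
  obtains \<kappa> where "crossed S (\<lambda>s x. f s x + \<kappa> s)"
proof -
  have "p < p\<^sup>2" using prime_gt_1_nat[OF prime_p] by (simp add: power2_eq_square)
  then have "card S \<noteq> card P" unfolding card_S card_P by simp
  then have "\<not> S \<subseteq> H" by (metis Int_absorb2)
  then obtain b where b: "b \<in> S" "b \<notin> H" by blast
  define B where "B = generate G {b}"
  have B: "subgroup B G" "B \<subseteq> S" "\<not> B \<subseteq> H" "b \<in> B"
    using generate_is_subgroup[of "{b}"] generate_subgroup_incl[OF _ subgroup_S, of "{b}"] b
      generate.incl[of b "{b}" G] by (auto simp: B_def)
  obtain u y where u: "inv_fun u"
      "\<And>g x. g \<in> B \<Longrightarrow> x \<in> carrier G \<Longrightarrow> f g x = u (x \<otimes> g) - u x + y g"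
    using sha b(1) unfolding sha_def jtriv_def B_def by blast
  \<comment> \<open>Write \<open>t = a \<otimes> b'\<close> with \<open>a\<close> in
    \<open>P\<close> and \<open>b'\<close> in \<open>B\<close>: the factor \<open>a\<close>
    contributes a value independent of the point, and \<open>b'\<close> contributes a difference of
    \<open>u\<close>.\<close>
  have key: "f t s - f t \<one> = u (s \<otimes> t) - u s - u t + u \<one>" if s: "s \<in> S" and t: "t \<in> S" for s t
  proof -
    obtain a b' where a: "a \<in> P" and b': "b' \<in> B" and t_eq: "t = a \<otimes> b'"
      using P_mult_eq_S[OF B(1-3) t] by blast
    have c: "a \<in> carrier G" "b' \<in> carrier G" "s \<in> carrier G" "b' \<in> S"
      using a b' s B(2) by auto
    have inv_b': "inv_fun (f b')" using jcoc_inv[OF f] c by simp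
    have sa: "s \<otimes> a = a \<otimes> s" using comm_S a s by simp
    have "f a s + f b' (s \<otimes> a) - f (a \<otimes> b') s = f a \<one> + f b' (\<one> \<otimes> a) - f (a \<otimes> b') \<one>"
      using jcocD[OF f] c by blast
    moreover have "f a s = f a \<one>"
      using a c by (intro sha_fixed[OF sha]) (simp_all add: sa m_assoc)
    moreover have "f b' (s \<otimes> a) = f b' s"
      unfolding sa using inv_funD[OF inv_b'] a c by simp
    moreover have "f b' (\<one> \<otimes> a) = f b' \<one>"
      using inv_funD[OF inv_b', of a \<one>] a c by simp
    ultimately have "f t s - f t \<one> = f b' s - f b' \<one>"
      by (simp add: t_eq algebra_simps)
    also have "\<dots> = u (s \<otimes> b') - u s - (u b' - u \<one>)"
      using u(2)[OF b'] c by simp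
    also have "u (s \<otimes> b') = u (s \<otimes> t)"
    proof -
      have "s \<otimes> t = a \<otimes> (s \<otimes> b')" 
        unfolding t_eq using c m_assoc[of s a b'] m_assoc[of a s b'] sa by simp
      then show ?thesis using inv_funD[OF u(1)] a c by simp
    qed
    also have "u b' = u t" using inv_funD[OF u(1)] a c by (simp add: t_eq)
    finally show ?thesis by (simp add: algebra_simps)
  qed
  \<comment> \<open>With this choice the corrected value at the base point is
    \<open>u s - u \<one>\<close>, so that \<open>key\<close> cancels the constants.\<close>
  define \<kappa> where "\<kappa> s = u s - u \<one> - f s \<one>" for s
  have "crossed S (\<lambda>s x. f s x + \<kappa> s)"
    unfolding crossed_def
  proof (intro conjI ballI)
    fix s assume "s \<in> S"
    then show "inv_fun (\<lambda>x. f s x + \<kappa> s)" using jcoc_inv[OF f, of s] by (simp add: inv_fun_def)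
  next
    fix s t x assume s: "s \<in> S" and t: "t \<in> S" and x: "x \<in> carrier G"
    have "f s x + f t (x \<otimes> s) - f (s \<otimes> t) x = f s \<one> + f t (\<one> \<otimes> s) - f (s \<otimes> t) \<one>"
      using jcocD[OF f S.mem_carrier[OF s] S.mem_carrier[OF t] x one_closed] .
    then have "f s x + f t (x \<otimes> s) - f (s \<otimes> t) x = f s \<one> + f t s - f (s \<otimes> t) \<one>"
      using s by simp
    moreover note key[OF s t]
    ultimately show "f (s \<otimes> t) x + \<kappa> (s \<otimes> t) = f s x + \<kappa> s + (f t (x \<otimes> s) + \<kappa> t)"
      unfolding \<kappa>_def by (simp add: algebra_simps)
  qed
  then show thesis by (rule that)
qed

section \<open>Averaging over cosets of \<open>S\<close> and the character of
  \<open>P\<close>\<close>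

definition index_S :: nat where "index_S = card (carrier G) div card S"

text \<open>
  After multiplication by the index of \<open>S\<close>, the restriction of \<open>f\<close> to \<open>S\<close> is, up to constants, a
  crossed homomorphism whose values on the point stabilizers \<open>x\<inverse> P x\<close> are the transports
  of a single function \<open>Y\<close> on \<open>P\<close>.
\<close>

definition restricts_via ::
    "('a \<Rightarrow> 'a \<Rightarrow> 'c::ab_group_add) \<Rightarrow> ('a \<Rightarrow> 'c) \<Rightarrow> ('a \<Rightarrow> 'a \<Rightarrow> 'c) \<Rightarrow> ('a \<Rightarrow> 'c) \<Rightarrow> bool"
  where "restricts_via F \<kappa> f Y \<longleftrightarrow> crossed S F \<and>
     (\<forall>s\<in>S. \<forall>x\<in>carrier G. F s x = nmul index_S (f s x) + \<kappa> s) \<and>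
     (\<forall>a\<in>P. \<forall>x\<in>carrier G. F (inv x \<otimes> a \<otimes> x) x = Y a)"

definition restricts_to :: "('a \<Rightarrow> 'a \<Rightarrow> 'c::ab_group_add) \<Rightarrow> ('a \<Rightarrow> 'c) \<Rightarrow> bool" where
  "restricts_to f Y \<longleftrightarrow> (\<exists>F \<kappa>. restricts_via F \<kappa> f Y)"

lemma restricts_viaD:
  assumes "restricts_via F \<kappa> f Y"
  shows "crossed S F"
    "\<And>s x. s \<in> S \<Longrightarrow> x \<in> carrier G \<Longrightarrow> F s x = nmul index_S (f s x) + \<kappa> s"
    "\<And>a x. a \<in> P \<Longrightarrow> x \<in> carrier G \<Longrightarrow> F (inv x \<otimes> a \<otimes> x) x = Y a"
  using assms unfolding restricts_via_def by simp_all

text \<open>Conjugating the crossed homomorphism \<open>f'\<close> by \<open>g\<close> changes it by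
  the coboundary of \<open>f g\<close> and a character \<open>k g\<close> of \<open>S\<close>.
  Adding the sum of these characters over a transversal to the multiple of \<open>f'\<close> by the
  index makes the values at fixed points compatible with conjugation by all of
  \<open>G\<close>.\<close>

lemma sha_restricts_to:
  fixes f :: "'a \<Rightarrow> 'a \<Rightarrow> 'c::ab_group_add"
  assumes f: "gcoc f" and sha: "sha f"
  shows "\<exists>Y. restricts_to f Y"
proof -
  obtain \<kappa> where cr: "crossed S (\<lambda>s x. f s x + \<kappa> s)" by (rule sha_crossed[OF f sha])
  define f' where "f' s x = f s x + \<kappa> s" for s x
  have cr': "crossed S f'" using cr by (simp add: f'_def[abs_def])
  note Sc = S.mem_carrier
  \<comment> \<open>This is the discrepancy between \<open>f'\<close> and its conjugate by
    \<open>g\<close>, corrected by the coboundary of \<open>f g\<close> and evaluated at the base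
    point.\<close>
  define k where "k g s = f' (g \<otimes> s \<otimes> inv g) \<one> - f' s g - f g \<one> + f g (g \<otimes> s \<otimes> inv g)" for g s
  \<comment> \<open>The discrepancy is the same at every point: expand the value at
    \<open>g \<otimes> s = s' \<otimes> g\<close> in both ways, whereupon the unknown term
    cancels.\<close>
  have k_eq: "k g s = f' (g \<otimes> s \<otimes> inv g) x - f' s (x \<otimes> g) - f g x + f g (x \<otimes> (g \<otimes> s \<otimes> inv g))"
    if g: "g \<in> carrier G" and s: "s \<in> S" and x: "x \<in> carrier G" for g s x
  proof -
    define s' where "s' = g \<otimes> s \<otimes> inv g"
    have s': "s' \<in> S" using conj_S[OF g s] by (simp add: s'_def)
    have comm: "s' \<otimes> g = g \<otimes> s" using g s by (simp add: s'_def m_assoc)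
    have 1: "f g x + f s (x \<otimes> g) - f (g \<otimes> s) x = f g \<one> + f s (\<one> \<otimes> g) - f (g \<otimes> s) \<one>"
      using jcocD[OF f g Sc[OF s] x one_closed] .
    have 2: "f s' x + f g (x \<otimes> s') - f (g \<otimes> s) x = f s' \<one> + f g (\<one> \<otimes> s') - f (g \<otimes> s) \<one>"
      using jcocD[OF f Sc[OF s'] g x one_closed] unfolding comm .
    have "f s' x + f g (x \<otimes> s') - (f g x + f s (x \<otimes> g)) =
        (f s' x + f g (x \<otimes> s') - f (g \<otimes> s) x) - (f g x + f s (x \<otimes> g) - f (g \<otimes> s) x)"
      by simp
    also have "\<dots> = f s' \<one> + f g s' - (f g \<one> + f s g)"
      unfolding 1 2 using g Sc[OF s'] by simp
    finally show ?thesis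
      unfolding k_def f'_def s'_def[symmetric] by (simp add: algebra_simps)
  qed
  \<comment> \<open>Reading off \<open>k g t\<close> at the point \<open>s'\<close> instead of
    \<open>\<one>\<close> makes the mixed terms cancel.\<close>
  have k_hom: "k g (s \<otimes> t) = k g s + k g t"
    if g: "g \<in> carrier G" and s: "s \<in> S" and t: "t \<in> S" for g s t
  proof -
    define s' where "s' = g \<otimes> s \<otimes> inv g"
    define t' where "t' = g \<otimes> t \<otimes> inv g"
    have s': "s' \<in> S" using conj_S[OF g s] by (simp add: s'_def)
    have t': "t' \<in> S" using conj_S[OF g t] by (simp add: t'_def)
    have comm: "s' \<otimes> g = g \<otimes> s" using g s by (simp add: s'_def m_assoc)
    have st': "g \<otimes> (s \<otimes> t) \<otimes> inv g = s' \<otimes> t'"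
      using g s t by (simp add: s'_def t'_def m_assoc inv_mult_cancel)
    have "k g (s \<otimes> t) = f' (s' \<otimes> t') \<one> - f' (s \<otimes> t) g - f g \<one> + f g (s' \<otimes> t')"
      by (simp add: k_def st')
    also have "f' (s' \<otimes> t') \<one> = f' s' \<one> + f' t' s'"
      using crossedD[OF cr' s' t' one_closed] Sc[OF s'] by simp
    also have "f' (s \<otimes> t) g = f' s g + f' t (g \<otimes> s)"
      using crossedD[OF cr' s t g] .
    finally have "k g (s \<otimes> t) = (f' s' \<one> - f' s g - f g \<one> + f g s') +
        (f' t' s' - f' t (s' \<otimes> g) - f g s' + f g (s' \<otimes> t'))"
      by (simp add: comm algebra_simps)
    also have "f' t' s' - f' t (s' \<otimes> g) - f g s' + f g (s' \<otimes> t') = k g t"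
      using k_eq[OF g t Sc[OF s']] by (simp add: t'_def)
    also have "f' s' \<one> - f' s g - f g \<one> + f g s' = k g s" by (simp add: k_def s'_def)
    finally show ?thesis .
  qed
  obtain T where T: "T \<subseteq> carrier G" "card T * card S = card (carrier G)"
    "\<And>(\<phi> :: 'a \<Rightarrow> 'c) g. (\<And>c d. c \<in> S \<Longrightarrow> d \<in> carrier G \<Longrightarrow> \<phi> (c \<otimes> d) = \<phi> d) \<Longrightarrow> g \<in> carrier G \<Longrightarrow>
       (\<Sum>t\<in>T. \<phi> (t \<otimes> g)) = (\<Sum>t\<in>T. \<phi> t)"
    using ex_transversal_sum_invariant[OF finite_carrier subgroup_S, where 'c = 'c] by metis
  have finT: "finite T" using finite_subset[OF T(1) finite_carrier] .
  have "card S > 0" using card_S prime_gt_0_nat[OF prime_p] by simp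
  then have q: "index_S = card T" unfolding index_S_def using T(2)
    by (metis nonzero_mult_div_cancel_right not_gr0)
  define K where "K s = (\<Sum>t\<in>T. k t s)" for s
  have K_hom: "K (s \<otimes> t) = K s + K t" if "s \<in> S" "t \<in> S" for s t
    unfolding K_def sum.distrib[symmetric] by (rule sum.cong[OF refl]) (use k_hom that T(1) in auto)
  define F where "F s x = nmul index_S (f' s x) + K s" for s x
  \<comment> \<open>The summand for \<open>t\<close> is the value of \<open>f'\<close> at the
    conjugate of \<open>a\<close> by \<open>t\<close>, taken at the point of \<open>inv t\<close>,
    which that conjugate fixes.\<close>
  define Y where "Y a = (\<Sum>t\<in>T. f' (t \<otimes> a \<otimes> inv t) (inv t))" for a
  have "crossed S F"
    unfolding crossed_def
  proof (intro conjI ballI)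
    fix s assume "s \<in> S"
    then show "inv_fun (F s)" using crossed_inv[OF cr', of s] by (simp add: inv_fun_def F_def)
  next
    fix s t x assume "s \<in> S" "t \<in> S" "x \<in> carrier G"
    then show "F (s \<otimes> t) x = F s x + F t (x \<otimes> s)"
      by (simp add: F_def crossedD[OF cr'] K_hom nmul_add algebra_simps)
  qed
  moreover have "F s x = nmul index_S (f s x) + (nmul index_S (\<kappa> s) + K s)" for s x
    by (simp add: F_def f'_def nmul_add algebra_simps)
  moreover have "F (inv x \<otimes> a \<otimes> x) x = Y a" if a: "a \<in> P" and x: "x \<in> carrier G" for a x
  proof -
    define s where "s = inv x \<otimes> a \<otimes> x"
    have s: "s \<in> S" using conj_S'[OF x] a by (simp add: s_def)
    have ac: "a \<in> carrier G" using a by simp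
    have sc: "s \<in> carrier G" using s by simp
    have xs: "x \<otimes> s = a \<otimes> x" using x ac by (simp add: s_def m_assoc mult_inv_cancel)
    define \<phi> where "\<phi> t = f' (t \<otimes> a \<otimes> inv t) (inv t)" for t
    \<comment> \<open>Evaluating \<open>k t s\<close> at the point of
      \<open>x \<otimes> inv t\<close> removes the coboundary of \<open>f t\<close>, because
      \<open>a\<close> lies in \<open>H\<close>. What remains is a translate of
      \<open>\<phi>\<close> and the term \<open>f' s x\<close>, whose \<open>card T\<close> copies
      cancel against the multiple in \<open>F\<close>.\<close>
    have summand: "k t s = \<phi> (t \<otimes> inv x) - f' s x" if t: "t \<in> T" for t
    proof -
      have tc: "t \<in> carrier G" using t T(1) by auto
      define r where "r = x \<otimes> inv t"
      have rc: "r \<in> carrier G" using x tc by (simp add: r_def)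
      have rt: "r \<otimes> t = x" using x tc by (simp add: r_def m_assoc)
      have "r \<otimes> (t \<otimes> s \<otimes> inv t) = x \<otimes> s \<otimes> inv t"
        using x tc sc by (simp add: r_def m_assoc inv_mult_cancel)
      also have "\<dots> = a \<otimes> r" unfolding xs r_def using x ac tc by (simp add: m_assoc)
      finally have r2: "r \<otimes> (t \<otimes> s \<otimes> inv t) = a \<otimes> r" .
      have "k t s = f' (t \<otimes> s \<otimes> inv t) r - f' s x - f t r + f t (a \<otimes> r)"
        using k_eq[OF tc s rc] unfolding rt r2 .
      also have "f t (a \<otimes> r) = f t r" using inv_funD[OF jcoc_inv[OF f tc]] a rc by simp
      finally have "k t s = f' (t \<otimes> s \<otimes> inv t) r - f' s x" by simp
      moreover have "t \<otimes> s \<otimes> inv t = (t \<otimes> inv x) \<otimes> a \<otimes> inv (t \<otimes> inv x)"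
        using tc x ac by (simp add: s_def m_assoc inv_mult_group)
      moreover have "r = inv (t \<otimes> inv x)" using tc x by (simp add: r_def inv_mult_group)
      ultimately show ?thesis by (simp add: \<phi>_def)
    qed
    have "F s x = nmul (card T) (f' s x) + (\<Sum>t\<in>T. \<phi> (t \<otimes> inv x) - f' s x)"
      unfolding F_def K_def q using summand by simp
    also have "\<dots> = (\<Sum>t\<in>T. \<phi> (t \<otimes> inv x))"
      by (simp add: sum_subtractf sum_const_nmul[OF finT])
    also have "\<dots> = (\<Sum>t\<in>T. \<phi> t)"
    proof (rule T(3)[OF _ inv_closed[OF x]])
      \<comment> \<open>Conjugation by \<open>c\<close> does not change \<open>b\<close>, as
        \<open>S\<close> is abelian; the points of \<open>inv d\<close> and
        \<open>inv (c \<otimes> d)\<close> are both fixed by \<open>b\<close>, so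
        \<open>sha_fixed\<close> identifies the values there.\<close>
      fix c d assume c: "c \<in> S" and d: "d \<in> carrier G"
      have cc: "c \<in> carrier G" using c by simp
      define b where "b = d \<otimes> a \<otimes> inv d"
      have b: "b \<in> S" using conj_S[OF d] a by (simp add: b_def)
      have bc: "b \<in> carrier G" using b by simp
      have "(c \<otimes> d) \<otimes> a \<otimes> inv (c \<otimes> d) = c \<otimes> b \<otimes> inv c"
        using cc d ac by (simp add: b_def m_assoc inv_mult_group)
      also have "c \<otimes> b = b \<otimes> c" using comm_S c b by simp
      also have "b \<otimes> c \<otimes> inv c = b" using bc cc by (simp add: m_assoc)
      finally have e: "(c \<otimes> d) \<otimes> a \<otimes> inv (c \<otimes> d) = b" .
      have fix1: "inv d \<otimes> b \<otimes> inv (inv d) = a"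
        using d ac by (simp add: b_def m_assoc inv_mult_cancel)
      have cb: "inv c \<otimes> b \<otimes> c = b"
      proof -
        have "inv c \<otimes> b = b \<otimes> inv c" using comm_S c b by simp
        then show ?thesis using bc cc by (simp add: m_assoc)
      qed
      have "inv (c \<otimes> d) \<otimes> b \<otimes> inv (inv (c \<otimes> d)) = inv d \<otimes> (inv c \<otimes> b \<otimes> c) \<otimes> d"
        using cc d bc by (simp add: m_assoc inv_mult_group)
      also have "\<dots> = a" unfolding cb using fix1 d by simp
      finally have fix2: "inv (c \<otimes> d) \<otimes> b \<otimes> inv (inv (c \<otimes> d)) = a" .
      have "f b (inv (c \<otimes> d)) = f b (inv d)"
        by (rule sha_fixed[OF sha b]) (use a cc d fix1 fix2 in auto)
      then show "\<phi> (c \<otimes> d) = \<phi> d"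
        unfolding \<phi>_def e f'_def by (simp add: b_def)
    qed
    finally show ?thesis by (simp add: s_def Y_def \<phi>_def)
  qed
  ultimately show ?thesis
    unfolding restricts_to_def restricts_via_def
    by (intro exI[of _ Y] exI[of _ F] exI[of _ "\<lambda>s. nmul index_S (\<kappa> s) + K s"] conjI ballI)
qed

lemma restricts_to_add:
  assumes "restricts_to f Y" "restricts_to f' Y'"
  shows "restricts_to (\<lambda>g x. f g x + f' g x) (\<lambda>a. Y a + Y' a)"
proof -
  obtain F \<kappa> where via: "restricts_via F \<kappa> f Y"
    using assms(1) unfolding restricts_to_def by (elim exE)
  note F = restricts_viaD[OF via]
  obtain F' \<kappa>' where via': "restricts_via F' \<kappa>' f' Y'"
    using assms(2) unfolding restricts_to_def by (elim exE)
  note F' = restricts_viaD[OF via']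
  have "crossed S (\<lambda>s x. F s x + F' s x)"
    using F(1) F'(1) unfolding crossed_def inv_fun_def by (simp add: algebra_simps)
  then show ?thesis
    unfolding restricts_to_def restricts_via_def
    by (intro exI[of _ "\<lambda>s x. F s x + F' s x"] exI[of _ "\<lambda>s. \<kappa> s + \<kappa>' s"] conjI ballI)
       (simp_all add: F(2) F'(2) F(3) F'(3) nmul_add algebra_simps)
qed

lemma restricts_to_zero: "restricts_to (\<lambda>g x. 0) (\<lambda>a. 0)"
  unfolding restricts_to_def restricts_via_def
  by (intro exI[of _ "\<lambda>s x. 0"] exI[of _ "\<lambda>s. 0"]) (simp add: crossed_def inv_fun_def)

lemma restricts_to_nmul:
  "restricts_to f Y \<Longrightarrow> restricts_to (\<lambda>g x. nmul n (f g x)) (\<lambda>a. nmul n (Y a))"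
proof (induction n)
  case 0
  then show ?case using restricts_to_zero by simp
next
  case (Suc n)
  from restricts_to_add[OF Suc.prems Suc.IH[OF Suc.prems]] show ?case by simp
qed

text \<open>A character of \<open>S\<close> is constant in the point \<open>x\<close>, so it can be
  moved into \<open>\<kappa>\<close>. This is the ambiguity in \<open>Y\<close>; invariance on the
  conjugates of \<open>P\<close> keeps the result a single function on \<open>P\<close>.\<close>

lemma restricts_to_diff_char:
  assumes "restricts_to f Y"
    and \<chi>: "\<And>s t. s \<in> S \<Longrightarrow> t \<in> S \<Longrightarrow> \<chi> (s \<otimes> t) = \<chi> s + \<chi> t"
    and \<chi>_inv: "\<And>a x. a \<in> P \<Longrightarrow> x \<in> carrier G \<Longrightarrow> \<chi> (inv x \<otimes> a \<otimes> x) = \<chi> a"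
  shows "restricts_to f (\<lambda>a. Y a - \<chi> a)"
proof -
  obtain F \<kappa> where via: "restricts_via F \<kappa> f Y"
    using assms(1) unfolding restricts_to_def by (elim exE)
  note F = restricts_viaD[OF via]
  have "crossed S (\<lambda>s x. F s x - \<chi> s)"
    using F(1) \<chi> unfolding crossed_def inv_fun_def by (simp add: algebra_simps)
  then show ?thesis
    unfolding restricts_to_def restricts_via_def
    by (intro exI[of _ "\<lambda>s x. F s x - \<chi> s"] exI[of _ "\<lambda>s. \<kappa> s - \<chi> s"] conjI ballI)
       (simp_all add: F(2) F(3) \<chi>_inv)
qed

text \<open>At the base point, which \<open>P\<close> fixes, the crossed identity becomes
  additivity.\<close>

lemma restricts_to_hom:
  assumes "restricts_to f Y" and a: "a \<in> P" and b: "b \<in> P"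
  shows "Y (a \<otimes> b) = Y a + Y b"
proof -
  obtain F \<kappa> where via: "restricts_via F \<kappa> f Y"
    using assms(1) unfolding restricts_to_def by (elim exE)
  note F = restricts_viaD(1,3)[OF via]
  have Y: "F c \<one> = Y c" if "c \<in> P" for c
    using F(2)[OF that one_closed] that by simp
  have "F (a \<otimes> b) \<one> = F a \<one> + F b (\<one> \<otimes> a)" using crossedD[OF F(1) _ _ one_closed] a b by blast
  also have "F b (\<one> \<otimes> a) = F b \<one>"
    using inv_funD[OF crossed_inv[OF F(1)], of b a \<one>] a b by simp
  finally show ?thesis using Y a b subgroup.m_closed[OF subgroup_P a b] by simp
qed

lemma restricts_to_pow:
  assumes "restricts_to f Y" and a: "a \<in> P"
  shows "Y (a [^] (k::nat)) = nmul k (Y a)"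
proof (induction k)
  case 0
  have "Y (\<one> \<otimes> \<one>) = Y \<one> + Y \<one>"
    using restricts_to_hom[OF assms(1)] subgroup.one_closed[OF subgroup_P] by blast
  then show ?case by simp
next
  case (Suc k)
  have "a [^] k \<in> P"
  proof (induction k)
    case 0
    show ?case using subgroup.one_closed[OF subgroup_P] by simp
  next
    case (Suc k)
    then show ?case using subgroup.m_closed[OF subgroup_P _ a] by simp
  qed
  then show ?case using restricts_to_hom[OF assms(1) _ a] Suc by (simp add: add.commute)
qed

lemma restricts_to_eq_zero:
  assumes "restricts_to f Y" and a0: "a0 \<in> P" "a0 \<noteq> \<one>" "Y a0 = 0" and a: "a \<in> P"
  shows "Y a = 0"
proof -
  obtain k :: nat where "a = a0 [^] k" by (rule P_powers[OF a0(1,2) a])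
  then show ?thesis using restricts_to_pow[OF assms(1) a0(1)] a0(3) by simp
qed

lemma restricts_to_torsion:
  assumes "restricts_to f Y" and a: "a \<in> P"
  shows "nmul p (Y a) = 0"
proof -
  interpret GP: group "G\<lparr>carrier := P\<rparr>" by (rule subgroup_imp_group[OF subgroup_P])
  have "a [^]\<^bsub>G\<lparr>carrier := P\<rparr>\<^esub> order (G\<lparr>carrier := P\<rparr>) = \<one>"
    using GP.pow_order_eq_1[of a] a by simp
  then have "a [^] p = \<one>" by (simp add: order_def card_P nat_pow_consistent[symmetric])
  then have "nmul p (Y a) = Y (a [^] (0::nat))"
    using restricts_to_pow[OF assms, of p] by simp
  then show ?thesis using restricts_to_pow[OF assms, of 0] by simp
qed

text \<open>\<open>F\<close> vanishes on all point stabilizers in \<open>S\<close>, hence is a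
  coboundary there. The first factor \<open>index_S\<close> is the one built into \<open>F\<close>,
  the second comes from the passage from \<open>S\<close> to \<open>G\<close>.\<close>

lemma restricts_to_zero_imp_jtriv:
  assumes f: "gcoc f" and "restricts_to f Y" and Y: "\<And>a. a \<in> P \<Longrightarrow> Y a = 0"
  shows "gtriv (\<lambda>g x. nmul index_S (nmul index_S (f g x)))"
proof -
  obtain F \<kappa> where via: "restricts_via F \<kappa> f Y"
    using assms(2) unfolding restricts_to_def by (elim exE)
  note F = restricts_viaD[OF via]
  have "F s x = 0" if "s \<in> S" "x \<in> carrier G" "x \<otimes> s \<otimes> inv x \<in> H" for s x
  proof -
    have "x \<otimes> s \<otimes> inv x \<in> P" using conj_S that by simp
    from F(3)[OF this that(2)] Y[OF this] show ?thesis
      using that(1,2) by (simp add: m_assoc inv_mult_cancel)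
  qed
  from crossed_zero_on_stabilizers[OF subgroup_S F(1) this]
  obtain u where u: "inv_fun u" "\<And>s x. s \<in> S \<Longrightarrow> x \<in> carrier G \<Longrightarrow> F s x = u (x \<otimes> s) - u x"
    by blast
  have eq: "nmul index_S (f s x) = u (x \<otimes> s) - u x + - \<kappa> s" if "s \<in> S" "x \<in> carrier G" for s x
    using u(2)[OF that] F(2)[OF that] by (simp add: algebra_simps)
  have "jtriv S (\<lambda>g x. nmul index_S (f g x))"
    unfolding jtriv_def by (intro exI[of _ u] exI[of _ "\<lambda>s. - \<kappa> s"] conjI ballI eq u(1))
  from jtriv_transfer[OF subgroup_self subgroup_S S.subset jcoc_nmul[OF f] this]
  show ?thesis by (simp add: index_S_def)
qed

section \<open>The normalizer and commutator conditions\<close>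

lemma mem_normalizer_P:
  "g \<in> normalizer G P \<longleftrightarrow>
    g \<in> carrier G \<and> g <# P #> inv g = P"
  using subgroup.subset[OF subgroup_P] by (auto simp: normalizer_def stabilizer_def)

lemma conj_set_eq: "g <# A #> inv g = {g \<otimes> a \<otimes> inv g |a. a \<in> A}"
  by (auto simp: l_coset_def r_coset_def)

text \<open>Normality of \<open>S\<close> puts the conjugate into \<open>S\<close>, hence into
  \<open>P\<close>; an injective self-map of a finite set is onto.\<close>

lemma conj_in_P_imp_normalizer:
  assumes g: "g \<in> carrier G" and "\<And>a. a \<in> P \<Longrightarrow> g \<otimes> a \<otimes> inv g \<in> H"
  shows "g \<in> normalizer G P"
proof -
  let ?c = "\<lambda>a. g \<otimes> a \<otimes> inv g"
  have sub: "?c ` P \<subseteq> P" using assms conj_S by auto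
  have "inj_on ?c P"
    using g by (auto intro!: inj_onI)
  then have "?c ` P = P"
    using sub finite_S by (intro endo_inj_surj) auto
  then have "g <# P #> inv g = P"
    unfolding conj_set_eq by blast
  with g show ?thesis by (simp add: mem_normalizer_P)
qed

lemma centralizer_subset_normalizer: "centralizer G P \<subseteq> normalizer G P"
proof
  fix g assume g: "g \<in> centralizer G P"
  then have gc: "g \<in> carrier G" by (simp add: centralizer_def)
  have "g \<otimes> a \<otimes> inv g = a" if "a \<in> P" for a
  proof -
    have "g \<otimes> a = a \<otimes> g" using g that by (simp add: centralizer_def)
    then show ?thesis using gc that by (simp add: m_assoc)
  qed
  then show "g \<in> normalizer G P" using conj_in_P_imp_normalizer[OF gc] by simp
qed

lemma ex_P_nontrivial: obtains a where "a \<in> P" "a \<noteq> \<one>"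
proof -
  have "P \<noteq> {\<one>}"
  proof
    assume "P = {\<one>}"
    then have "card P = 1" by simp
    then show False using card_P prime_gt_1_nat[OF prime_p] by simp
  qed
  with subgroup.one_closed[OF subgroup_P] that show thesis by blast
qed

text \<open>The conjugate \<open>b\<close> fixes both the base point and the point of
  \<open>inv g\<close>. There \<open>F b\<close> takes the values \<open>Y b\<close> and
  \<open>Y a\<close>, and \<open>sha_fixed\<close> makes them equal.\<close>

lemma restricts_to_conj:
  assumes "restricts_to f Y" "sha f" and a: "a \<in> P" and g: "g \<in> carrier G"
    and a': "g \<otimes> a \<otimes> inv g \<in> P"
  shows "Y (g \<otimes> a \<otimes> inv g) = Y a"
proof -
  obtain F \<kappa> where via: "restricts_via F \<kappa> f Y"
    using assms(1) unfolding restricts_to_def by (elim exE)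
  note F = restricts_viaD(2,3)[OF via]
  define b where "b = g \<otimes> a \<otimes> inv g"
  have b: "b \<in> S" "b \<in> H" "b \<in> carrier G" using a' by (auto simp: b_def)
  have ac: "a \<in> carrier G" using a by simp
  have "F b \<one> = Y b" using F(2)[of b \<one>] b by simp
  moreover have "F b (inv g) = Y a" using F(2)[OF a, of "inv g"] g by (simp add: b_def)
  moreover have "f b \<one> = f b (inv g)"
  proof (rule sha_fixed[OF assms(2) b(1)])
    have "inv g \<otimes> b \<otimes> inv (inv g) = a" using g ac by (simp add: b_def m_assoc inv_mult_cancel)
    then show "inv g \<otimes> b \<otimes> inv (inv g) \<in> H" using a by simp
  qed (use b g in auto)
  ultimately show ?thesis using F(1) b g by (simp add: b_def)
qed

text \<open>Some \<open>g\<close> normalizing \<open>P\<close> moves an element \<open>a\<close> to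
  \<open>a' \<noteq> a\<close>. By invariance under the normalizer \<open>Y\<close> kills
  \<open>a' \<otimes> inv a\<close>, which generates \<open>P\<close>.\<close>

lemma restricts_to_zero_if_not_centralizing:
  assumes "restricts_to f Y" "sha f" "normalizer G P \<noteq> centralizer G P"
    and b: "b \<in> P"
  shows "Y b = 0"
proof -
  obtain g where g: "g \<in> normalizer G P" "g \<notin> centralizer G P"
    using assms(3) centralizer_subset_normalizer by blast
  then have gc: "g \<in> carrier G" "g <# P #> inv g = P"
    by (simp_all add: mem_normalizer_P)
  obtain a where a: "a \<in> P" "g \<otimes> a \<noteq> a \<otimes> g" using g(2) gc(1) by (auto simp: centralizer_def)
  have ac: "a \<in> carrier G" using a by simp
  define a' where "a' = g \<otimes> a \<otimes> inv g"
  have a': "a' \<in> P" using gc(2) a(1) unfolding conj_set_eq a'_def by blast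
  have "a' \<noteq> a"
  proof
    assume "a' = a"
    then have "g \<otimes> a \<otimes> inv g \<otimes> g = a \<otimes> g" by (simp add: a'_def)
    then show False using a(2) gc(1) ac by (simp add: m_assoc)
  qed
  define a0 where "a0 = a' \<otimes> inv a"
  have a0: "a0 \<in> P"
    unfolding a0_def
    using subgroup.m_closed[OF subgroup_P a' subgroup.m_inv_closed[OF subgroup_P a(1)]] .
  have aa: "a' = a0 \<otimes> a" using a' ac by (simp add: a0_def m_assoc)
  have "a0 \<noteq> \<one>" using \<open>a' \<noteq> a\<close> aa ac by auto
  moreover have "Y a0 = 0"
    using restricts_to_hom[OF assms(1) a0 a(1)] restricts_to_conj[OF assms(1,2) a(1) gc(1)] a'
    by (simp add: aa[symmetric] a'_def[symmetric])
  ultimately show ?thesis using restricts_to_eq_zero[OF assms(1) a0 _ _ b] by simp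
qed

text \<open>The commutator subgroup \<open>T\<close> is not contained in \<open>H\<close>, because
  \<open>P\<close> is not normal, and as a proper subgroup of \<open>S\<close> it then meets
  \<open>P\<close> trivially. Projection of \<open>S\<close> to \<open>P\<close> along
  \<open>T\<close> is invariant under conjugation, since \<open>G\<close> acts trivially on
  \<open>S\<close> modulo \<open>T\<close>; composing \<open>Y\<close> with it gives the character
  to subtract.\<close>

lemma restricts_to_zero_if_not_perfect:
  assumes Y: "restricts_to f Y" and "commutator_subgroup G S (carrier G) \<noteq> S"
  shows "\<exists>Y'. restricts_to f Y' \<and> (\<forall>a\<in>P. Y' a = 0)"
proof -
  define C where "C = {a \<otimes> b \<otimes> inv a \<otimes> inv b |a b. a \<in> S \<and> b \<in> carrier G}"
  define T where "T = generate G C"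
  have CS: "C \<subseteq> S"
  proof
    fix c assume "c \<in> C"
    then obtain a b where ab: "a \<in> S" "b \<in> carrier G" "c = a \<otimes> b \<otimes> inv a \<otimes> inv b"
      by (auto simp: C_def)
    have "c = a \<otimes> (b \<otimes> inv a \<otimes> inv b)" using ab by (simp add: m_assoc)
    then show "c \<in> S" using ab conj_S[of b "inv a"] by simp
  qed
  have T: "subgroup T G" unfolding T_def using CS S.subset by (intro generate_is_subgroup) blast
  have TS: "T \<subseteq> S" unfolding T_def using generate_subgroup_incl[OF CS subgroup_S] .
  have TneS: "T \<noteq> S" using assms(2) by (simp add: T_def C_def commutator_subgroup_def)
  \<comment> \<open>This element is the commutator of \<open>inv s\<close> and
    \<open>x\<close>.\<close>
  have comm_T: "inv s \<otimes> (x \<otimes> s \<otimes> inv x) \<in> T" if "s \<in> S" "x \<in> carrier G" for s x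
  proof -
    have "inv s \<otimes> x \<otimes> inv (inv s) \<otimes> inv x \<in> C"
      unfolding C_def using that by (blast intro: S.m_inv_closed)
    then have "inv s \<otimes> x \<otimes> inv (inv s) \<otimes> inv x \<in> T" unfolding T_def by (rule generate.incl)
    then show ?thesis using that by (simp add: m_assoc)
  qed
  obtain g a0 where g: "g \<in> carrier G" "a0 \<in> P" "g \<otimes> a0 \<otimes> inv g \<notin> H"
    using not_normal_P by blast
  have a0c: "a0 \<in> carrier G" using g by simp
  have TnH: "\<not> T \<subseteq> H"
  proof
    assume "T \<subseteq> H"
    then have "inv a0 \<otimes> (g \<otimes> a0 \<otimes> inv g) \<in> H" using comm_T g by blast
    then have "a0 \<otimes> (inv a0 \<otimes> (g \<otimes> a0 \<otimes> inv g)) \<in> H"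
      using g(2) subgroup.m_closed[OF subgroup_H] by blast
    then show False using g a0c by (simp add: mult_inv_cancel)
  qed
  have PT: "T \<inter> P = {\<one>}"
  proof -
    have "subgroup (T \<inter> P) G" using subgroups_Inter_pair[OF T subgroup_P] .
    then consider "T \<inter> P = {\<one>}" | "T \<inter> P = P"
      using card_subgroup_P by blast
    then show ?thesis
    proof cases
      case 2
      have "S \<subseteq> T"
      proof
        fix s assume "s \<in> S"
        then obtain a b where "a \<in> P" "b \<in> T" "s = a \<otimes> b"
          using P_mult_eq_S[OF T TS TnH] by blast
        then show "s \<in> T" using 2 subgroup.m_closed[OF T] by blast
      qed
      with TS TneS show ?thesis by blast
    qed
  qed
  \<comment> \<open>The projection of \<open>S\<close> to \<open>P\<close> along \<open>T\<close>,
    well defined because \<open>T \<inter> P\<close> is trivial.\<close>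
  define \<pi> where "\<pi> s = (SOME a. a \<in> P \<and> (\<exists>t\<in>T. s = a \<otimes> t))" for s
  have \<pi>: "\<pi> (a \<otimes> t) = a" if a: "a \<in> P" and t: "t \<in> T" for a t
  proof -
    have "\<pi> (a \<otimes> t) \<in> P \<and> (\<exists>t'\<in>T. a \<otimes> t = \<pi> (a \<otimes> t) \<otimes> t')"
      unfolding \<pi>_def by (rule someI[of _ a]) (use a t in blast)
    then obtain a' t' where a': "\<pi> (a \<otimes> t) = a'" "a' \<in> P" "t' \<in> T" "a \<otimes> t = a' \<otimes> t'"
      by blast
    have c: "a \<in> carrier G" "t \<in> carrier G" "a' \<in> carrier G" "t' \<in> carrier G"
      using a t a' TS by auto
    have "inv a' \<otimes> a = inv a' \<otimes> (a \<otimes> t) \<otimes> inv t" using c by (simp add: m_assoc)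
    also have "\<dots> = t' \<otimes> inv t" unfolding a'(4) using c by (simp add: inv_mult_cancel)
    finally have e: "inv a' \<otimes> a = t' \<otimes> inv t" .
    have "t' \<otimes> inv t \<in> T"
      using subgroup.m_closed[OF T a'(3) subgroup.m_inv_closed[OF T t]] .
    moreover have "inv a' \<otimes> a \<in> P"
      using subgroup.m_closed[OF subgroup_P subgroup.m_inv_closed[OF subgroup_P a'(2)] a] .
    ultimately have "inv a' \<otimes> a = \<one>" using e PT by auto
    then have "a' \<otimes> (inv a' \<otimes> a) = a'" using c by simp
    then have "a = a'" using c by (simp add: mult_inv_cancel)
    with a'(1) show ?thesis by simp
  qed
  define \<chi> where "\<chi> s = Y (\<pi> s)" for s
  have \<chi>P: "\<chi> a = Y a" if a: "a \<in> P" for a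
    using \<pi>[OF a subgroup.one_closed[OF T]] a by (simp add: \<chi>_def)
  have "restricts_to f (\<lambda>a. Y a - \<chi> a)"
  proof (rule restricts_to_diff_char[OF Y])
    fix s t assume s: "s \<in> S" and t: "t \<in> S"
    obtain a b where ab: "a \<in> P" "b \<in> T" "s = a \<otimes> b" by (rule P_mult_eq_S[OF T TS TnH s])
    obtain a' b' where ab': "a' \<in> P" "b' \<in> T" "t = a' \<otimes> b'" by (rule P_mult_eq_S[OF T TS TnH t])
    have S: "a \<in> S" "b \<in> S" "a' \<in> S" "b' \<in> S" using ab ab' TS by auto
    have "s \<otimes> t = a \<otimes> (b \<otimes> a') \<otimes> b'" using S ab ab' by (simp add: m_assoc)
    also have "b \<otimes> a' = a' \<otimes> b" using comm_S S by simp
    also have "a \<otimes> (a' \<otimes> b) \<otimes> b' = (a \<otimes> a') \<otimes> (b \<otimes> b')" using S by (simp add: m_assoc)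
    finally have "\<pi> (s \<otimes> t) = a \<otimes> a'"
      using \<pi>[OF subgroup.m_closed[OF subgroup_P ab(1) ab'(1)] subgroup.m_closed[OF T ab(2) ab'(2)]]
      by simp
    then show "\<chi> (s \<otimes> t) = \<chi> s + \<chi> t"
      using \<pi>[OF ab(1,2)] \<pi>[OF ab'(1,2)] restricts_to_hom[OF Y ab(1) ab'(1)]
      by (simp add: \<chi>_def ab(3) ab'(3))
  next
    fix a x assume a: "a \<in> P" and x: "x \<in> carrier G"
    have ac: "a \<in> carrier G" using a by simp
    have t: "inv a \<otimes> (inv x \<otimes> a \<otimes> x) \<in> T" using comm_T[of a "inv x"] a x by simp
    have "inv x \<otimes> a \<otimes> x = a \<otimes> (inv a \<otimes> (inv x \<otimes> a \<otimes> x))"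
      using ac x by (simp add: mult_inv_cancel)
    then have "\<pi> (inv x \<otimes> a \<otimes> x) = a" using \<pi>[OF a t] by simp
    then show "\<chi> (inv x \<otimes> a \<otimes> x) = \<chi> a" using \<chi>P[OF a] by (simp add: \<chi>_def)
  qed
  with \<chi>P show ?thesis by (intro exI[of _ "\<lambda>a. Y a - \<chi> a"]) simp
qed

abbreviation perfect_cond :: bool where
  "perfect_cond \<equiv> commutator_subgroup G S (carrier G) = S"

abbreviation central_cond :: bool where
  "central_cond \<equiv> normalizer G P = centralizer G P"

lemma sha_jtriv_unless_conds:
  assumes f: "gcoc f" and sha: "sha f" and "\<not> (perfect_cond \<and> central_cond)"
  shows "gtriv (\<lambda>g x. nmul index_S (nmul index_S (f g x)))"
proof -
  obtain Y where Y: "restricts_to f Y" using sha_restricts_to[OF f sha] by (elim exE)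
  show ?thesis
  proof (cases perfect_cond)
    case True
    then have "\<not> central_cond" using assms(3) by blast
    from restricts_to_zero_if_not_centralizing[OF Y sha this]
    show ?thesis by (rule restricts_to_zero_imp_jtriv[OF f Y])
  next
    case False
    from restricts_to_zero_if_not_perfect[OF Y this]
    show ?thesis using restricts_to_zero_imp_jtriv[OF f] by blast
  qed
qed

text \<open>At a generator \<open>a0\<close> of \<open>P\<close> both characters take
  \<open>p\<close>-torsion values, and that of \<open>f\<close> is nonzero by
  \<open>nontriv\<close>. Hence some multiple of it cancels that of \<open>f'\<close>.\<close>

lemma sha_jtriv_combination:
  fixes f f' :: "'a \<Rightarrow> 'a \<Rightarrow> circle"
  assumes f: "gcoc f" "sha f" and f': "gcoc f'" "sha f'"
    and nontriv: "\<not> gtriv (\<lambda>g x. nmul index_S (nmul index_S (f g x)))"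
  shows "\<exists>m. gtriv (\<lambda>g x. nmul index_S (nmul index_S (f' g x + nmul m (f g x))))"
proof -
  obtain Y where Y: "restricts_to f Y" using sha_restricts_to[OF f] by (elim exE)
  obtain Y' where Y': "restricts_to f' Y'" using sha_restricts_to[OF f'] by (elim exE)
  obtain a0 where a0: "a0 \<in> P" "a0 \<noteq> \<one>" by (rule ex_P_nontrivial)
  have "Y a0 \<noteq> 0"
  proof
    assume "Y a0 = 0"
    from restricts_to_eq_zero[OF Y a0 this] have "\<And>a. a \<in> P \<Longrightarrow> Y a = 0" .
    from restricts_to_zero_imp_jtriv[OF f(1) Y this] nontriv show False by simp
  qed
  moreover have "nmul p (- Y' a0) = 0" using restricts_to_torsion[OF Y' a0(1)] by (simp add: nmul_minus)
  ultimately obtain m where m: "- Y' a0 = nmul m (Y a0)"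
    using circle_torsion_multiple[OF prime_p restricts_to_torsion[OF Y a0(1)]] by blast
  have R: "restricts_to (\<lambda>g x. f' g x + nmul m (f g x)) (\<lambda>a. Y' a + nmul m (Y a))"
    by (intro restricts_to_add restricts_to_nmul Y Y')
  have "Y' a0 + nmul m (Y a0) = 0" by (simp add: m[symmetric])
  from restricts_to_eq_zero[OF R a0 this]
  have "\<And>a. a \<in> P \<Longrightarrow> Y' a + nmul m (Y a) = 0" .
  from restricts_to_zero_imp_jtriv[OF jcoc_add[OF f'(1) jcoc_nmul[OF f(1)]] R this]
  show ?thesis by (rule exI)
qed

lemma jtriv_of_jtriv_S:
  assumes f: "gcoc f" and "S \<subseteq> D" "jtriv D f"
  shows "gtriv (\<lambda>g x. nmul index_S (f g x))"
  using jtriv_transfer[OF subgroup_self subgroup_S S.subset f jtriv_subset[OF assms(3,2)]]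
  by (simp add: index_S_def)

end

section \<open>A nonzero class that is trivial on every subgroup not containing
  \<open>S\<close>\<close>

lemma (in group) index_inter_dvd:
  assumes fin: "finite (carrier G)" and S: "S \<lhd> G" and D: "subgroup D G"
  shows "card D div card (D \<inter> S) dvd card (carrier G) div card S"
proof -
  interpret second_isomorphism_grp S G D
    by (intro second_isomorphism_grp.intro second_isomorphism_grp_axioms.intro S D)
  have S: "subgroup S G" by (rule subgroup_axioms)
  define M where "M = S <#> D"
  have M: "subgroup M G" unfolding M_def by (rule normal_set_mult_subgroup)
  have SM: "S \<subseteq> M" unfolding M_def by (rule H_contained_in_set_mult)
  interpret GD: group "G\<lparr>carrier := D\<rparr>" by (rule subgroup_imp_group[OF D])
  interpret GM: group "G\<lparr>carrier := M\<rparr>" by (rule subgroup_imp_group[OF M])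
  have pos: "card A > 0" if "subgroup A G" for A
    using that fin by (metis card_gt_0_iff empty_iff finite_subset subgroup.one_closed subgroup.subset)
  have SD: "subgroup (S \<inter> D) G" using subgroups_Inter_pair[OF S D] .
  \<comment> \<open>By the second isomorphism theorem the index of \<open>S \<inter> D\<close> in
    \<open>D\<close> is the index of \<open>S\<close> in the product \<open>M\<close>, and this
    divides the index of \<open>S\<close> in \<open>G\<close>.\<close>
  have "card (carrier (G\<lparr>carrier := D\<rparr> Mod (S \<inter> D))) = card (carrier (G\<lparr>carrier := M\<rparr> Mod S))"
    using normal_intersection_quotient_isom unfolding M_def[symmetric] iso_def
    by (auto intro: bij_betw_same_card)
  then have eq: "card (rcosets\<^bsub>G\<lparr>carrier := D\<rparr>\<^esub> (S \<inter> D)) = card (rcosets\<^bsub>G\<lparr>carrier := M\<rparr>\<^esub> S)"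
    by (simp add: FactGroup_def)
  have "card (rcosets\<^bsub>G\<lparr>carrier := D\<rparr>\<^esub> (S \<inter> D)) * card (S \<inter> D) = card D"
    using GD.lagrange[OF subgroup_incl[OF SD D]] by (simp add: order_def mult.commute)
  then have 1: "card D div card (S \<inter> D) = card (rcosets\<^bsub>G\<lparr>carrier := M\<rparr>\<^esub> S)"
    using pos[OF SD] eq by (metis nonzero_mult_div_cancel_right not_gr0)
  have 2: "card (rcosets\<^bsub>G\<lparr>carrier := M\<rparr>\<^esub> S) * card S = card M"
    using GM.lagrange[OF subgroup_incl[OF S M SM]] by (simp add: order_def mult.commute)
  have "card M dvd card (carrier G)" using lagrange[OF M] unfolding order_def by (metis dvd_triv_right)
  then have "card (rcosets\<^bsub>G\<lparr>carrier := M\<rparr>\<^esub> S) * card S dvd card (carrier G)" using 2 by simp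
  then obtain k where k: "card (carrier G) = card (rcosets\<^bsub>G\<lparr>carrier := M\<rparr>\<^esub> S) * card S * k" ..
  have "card (carrier G) div card S = card (rcosets\<^bsub>G\<lparr>carrier := M\<rparr>\<^esub> S) * k"
    unfolding k using pos[OF S] by simp
  then have "card (rcosets\<^bsub>G\<lparr>carrier := M\<rparr>\<^esub> S) dvd card (carrier G) div card S" by simp
  then show ?thesis unfolding 1[symmetric] Int_commute[of S D] .
qed

context sylow_module
begin

lemma coprime_index_inter: "subgroup D G \<Longrightarrow> coprime p (card D div card (D \<inter> S))"
  using coprime_divisors[OF dvd_refl index_inter_dvd[OF finite_carrier normal_S] coprime_index] .

lemma ex_char_P:
  obtains \<psi> :: "'a \<Rightarrow> circle" and a0 where
    "\<And>a b. a \<in> P \<Longrightarrow> b \<in> P \<Longrightarrow> \<psi> (a \<otimes> b) = \<psi> a + \<psi> b"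
    "\<And>a. a \<in> P \<Longrightarrow> nmul p (\<psi> a) = 0"
    "a0 \<in> P" "\<psi> a0 \<noteq> 0"
proof -
  have p0: "p > 0" and p1: "p > 1" using prime_gt_0_nat prime_gt_1_nat prime_p by auto
  obtain a0 where a0: "a0 \<in> P" "a0 \<noteq> \<one>" by (rule ex_P_nontrivial)
  have a0c: "a0 \<in> carrier G" using a0 by simp
  have ord: "ord a0 = p" using generate_pow_card[OF a0c] generate_P[OF a0] card_P by simp
  \<comment> \<open>The character sends \<open>a0\<close> to the class of 1/p; any two exponents for
    the same element are congruent modulo \<open>p\<close>, so the chosen one is immaterial.\<close>
  define \<psi> where "\<psi> a = to_circle (real (SOME k. a = a0 [^] k) / real p)" for a
  have \<psi>: "\<psi> (a0 [^] k) = to_circle (real k / real p)" for k :: nat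
  proof -
    define k' where "k' = (SOME k'::nat. a0 [^] k = a0 [^] k')"
    have "a0 [^] k = a0 [^] k'" unfolding k'_def by (rule someI[of _ k]) simp
    then have "a0 [^] int k = a0 [^] int k'" by (simp add: int_pow_int)
    then have "int p dvd int k' - int k" using int_pow_eq[OF a0c] ord by simp
    then obtain l where "int k' - int k = int p * l" ..
    then have "real k' - real k = real p * of_int l"
      by (metis of_int_diff of_int_mult of_int_of_nat_eq)
    then have "real k' / real p - real k / real p = of_int l"
      using p0 by (simp add: field_simps)
    then have "to_circle (real k' / real p) - to_circle (real k / real p) = 0"
      by (simp flip: to_circle_diff add: to_circle_eq_0_iff)
    then show ?thesis by (simp add: \<psi>_def k'_def)
  qed
  show thesis
  proof (rule that)
    fix a b assume a: "a \<in> P" and b: "b \<in> P"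
    obtain k :: nat where k: "a = a0 [^] k" by (rule P_powers[OF a0 a])
    obtain l :: nat where l: "b = a0 [^] l" by (rule P_powers[OF a0 b])
    have "a \<otimes> b = a0 [^] (k + l)" using a0c by (simp add: k l nat_pow_mult)
    then show "\<psi> (a \<otimes> b) = \<psi> a + \<psi> b"
      by (simp add: k l \<psi> add_divide_distrib to_circle_add)
  next
    fix a assume a: "a \<in> P"
    obtain k :: nat where k: "a = a0 [^] k" by (rule P_powers[OF a0 a])
    have "nmul p (\<psi> a) = to_circle (real p * (real k / real p))"
      unfolding to_circle_nmul by (simp add: k \<psi>)
    then show "nmul p (\<psi> a) = 0" using p0 by (simp add: to_circle_eq_0_iff)
  next
    show "a0 \<in> P" by (rule a0)
    have "1 / real p \<notin> \<int>"
    proof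
      assume "1 / real p \<in> \<int>"
      then obtain i where i: "1 / real p = of_int i" by (elim Ints_cases)
      have "0 < 1 / real p" "1 / real p < 1" using p1 by auto
      then have "0 < i" "i < 1" unfolding i by simp_all
      then show False by simp
    qed
    then show "\<psi> a0 \<noteq> 0" using \<psi>[of 1] a0c by (simp add: to_circle_eq_0_iff)
  qed
qed

lemma jtriv_cong:
  assumes "\<And>g x. g \<in> D \<Longrightarrow> x \<in> carrier G \<Longrightarrow> f g x = f' g x"
  shows "jtriv D f \<longleftrightarrow> jtriv D f'"
  unfolding jtriv_def using assms by simp

text \<open>
  The class comes from the corestriction to \<open>H\<close> of a nontrivial character of \<open>P\<close>, via
  Shapiro's lemma: \<open>lam\<close> is a cochain on \<open>G\<close> that transforms under \<open>P\<close> by the character \<open>\<psi>\<close>.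
\<close>

lemma ex_locally_trivial:
  assumes perfect: perfect_cond and central: central_cond
  obtains f :: "'a \<Rightarrow> 'a \<Rightarrow> circle" where
    "gcoc f" "\<not> gtriv f"
    "\<And>g x. g \<in> carrier G \<Longrightarrow> x \<in> carrier G \<Longrightarrow> nmul p (f g x) = 0"
    "\<And>D. subgroup D G \<Longrightarrow> \<not> S \<subseteq> D \<Longrightarrow> jtriv D f"
proof -
  obtain \<psi> :: "'a \<Rightarrow> circle" and a0 where \<psi>:
    "\<And>a b. a \<in> P \<Longrightarrow> b \<in> P \<Longrightarrow> \<psi> (a \<otimes> b) = \<psi> a + \<psi> b"
    "\<And>a. a \<in> P \<Longrightarrow> nmul p (\<psi> a) = 0"
    and a0: "a0 \<in> P" "\<psi> a0 \<noteq> 0"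
    by (rule ex_char_P) blast
  interpret P: subgroup "P" G by (rule subgroup_P)
  interpret H: subgroup H G by (rule subgroup_H)
  interpret GH: group "G\<lparr>carrier := H\<rparr>" by (rule subgroup_imp_group[OF subgroup_H])
  define r where "r x = (SOME z. z \<in> P #> x)" for x
  have r: "\<exists>c\<in>P. r x = c \<otimes> x" if x: "x \<in> carrier G" for x
  proof -
    have "r x \<in> P #> x"
      unfolding r_def using someI[of "\<lambda>z. z \<in> P #> x", OF rcos_self[OF x subgroup_P]] .
    then show ?thesis by (auto simp: r_coset_def)
  qed
  have r_eq: "r (c \<otimes> x) = r x" if c: "c \<in> P" and x: "x \<in> carrier G" for c x
  proof -
    have "P #> (c \<otimes> x) = P #> x"
      using coset_mult_assoc[OF P.subset P.mem_carrier[OF c] x] coset_join2[OF P.mem_carrier[OF c] subgroup_P c]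
      by simp
    then show ?thesis by (simp add: r_def)
  qed
  have rP: "x \<otimes> inv (r x) \<in> P" if x: "x \<in> carrier G" for x
  proof -
    obtain c where c: "c \<in> P" "r x = c \<otimes> x" using r[OF x] by blast
    have "x \<otimes> inv (r x) = inv c" using c x P.mem_carrier[OF c(1)] by (simp add: inv_mult_group mult_inv_cancel)
    then show ?thesis using P.m_inv_closed[OF c(1)] by simp
  qed
  have rc: "r x \<in> carrier G" if "x \<in> carrier G" for x
    using r[OF that] that P.mem_carrier by force
  \<comment> \<open>Each \<open>x\<close> is a product of an element of \<open>P\<close> and the
    representative \<open>r x\<close> of its right coset; \<open>lam\<close> applies
    \<open>\<psi>\<close> to the first factor.\<close>
  define lam where "lam x = \<psi> (x \<otimes> inv (r x))" for x
  have lam_P: "lam (c \<otimes> x) = \<psi> c + lam x" if c: "c \<in> P" and x: "x \<in> carrier G" for c x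
  proof -
    have "(c \<otimes> x) \<otimes> inv (r (c \<otimes> x)) = c \<otimes> (x \<otimes> inv (r x))"
      unfolding r_eq[OF c x] using P.mem_carrier[OF c] x rc[OF x] by (simp add: m_assoc)
    then show ?thesis unfolding lam_def using \<psi>(1)[OF c rP[OF x]] by simp
  qed
  have finH: "finite H" using finite_subset[OF H.subset finite_carrier] .
  have PH: "subgroup P (G\<lparr>carrier := H\<rparr>)"
    using subgroup_incl[OF subgroup_P subgroup_H] by simp
  obtain T where T: "T \<subseteq> H" "card T * card P = card H"
    "\<And>(\<phi> :: 'a \<Rightarrow> circle) g. (\<And>c d. c \<in> P \<Longrightarrow> d \<in> H \<Longrightarrow> \<phi> (c \<otimes> d) = \<phi> d) \<Longrightarrow> g \<in> H \<Longrightarrow>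
       (\<Sum>t\<in>T. \<phi> (t \<otimes> g)) = (\<Sum>t\<in>T. \<phi> t)"
    using GH.ex_transversal_sum_invariant[OF _ PH, where 'c = circle] finH by auto
  have finT: "finite T" using finite_subset[OF T(1) finH] .
  have Tc: "t \<in> carrier G" if "t \<in> T" for t using that T(1) by auto
  have "card T = card H div card (H \<inter> S)"
    using T(2) card_P prime_gt_0_nat[OF prime_p] by (metis Int_commute nonzero_mult_div_cancel_right not_gr0)
  then have cop_T: "coprime p (card T)" using coprime_index_inter[OF subgroup_H] by simp
  \<comment> \<open>Formally this is the coboundary of the sum of \<open>lam (t \<otimes> x)\<close>
    over a transversal of \<open>P\<close> in \<open>H\<close>. That sum need not be
    \<open>H\<close>-invariant, but the character cancels in the differences, so \<open>f\<close>
    is.\<close>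
  define f where "f g x = (\<Sum>t\<in>T. lam (t \<otimes> x \<otimes> g) - lam (t \<otimes> x))" for g x
  have f_inv: "inv_fun (f g)" if g: "g \<in> carrier G" for g
    unfolding inv_fun_def
  proof (intro ballI)
    fix h x assume h: "h \<in> H" and x: "x \<in> carrier G"
    define \<phi> where "\<phi> t = lam (t \<otimes> x \<otimes> g) - lam (t \<otimes> x)" for t
    have "(\<Sum>t\<in>T. \<phi> (t \<otimes> h)) = (\<Sum>t\<in>T. \<phi> t)"
    proof (rule T(3)[OF _ h])
      fix c d assume c: "c \<in> P" and d: "d \<in> H"
      have "c \<otimes> d \<otimes> x \<otimes> g = c \<otimes> (d \<otimes> x \<otimes> g)" "c \<otimes> d \<otimes> x = c \<otimes> (d \<otimes> x)"
        using c d x g by (simp_all add: m_assoc)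
      then show "\<phi> (c \<otimes> d) = \<phi> d"
        unfolding \<phi>_def using lam_P[OF c] d x g by simp
    qed
    moreover have "f g (h \<otimes> x) = (\<Sum>t\<in>T. \<phi> (t \<otimes> h))"
      unfolding f_def \<phi>_def by (rule sum.cong[OF refl]) (use Tc h x g in \<open>simp add: m_assoc\<close>)
    ultimately show "f g (h \<otimes> x) = f g x" by (simp add: f_def \<phi>_def)
  qed
  have f_crossed: "crossed (carrier G) f"
    unfolding crossed_def
  proof (intro conjI ballI)
    fix g h x assume c: "g \<in> carrier G" "h \<in> carrier G" "x \<in> carrier G"
    show "f (g \<otimes> h) x = f g x + f h (x \<otimes> g)"
      unfolding f_def sum.distrib[symmetric]
      by (rule sum.cong[OF refl]) (use c Tc in \<open>simp add: m_assoc\<close>)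
  qed (rule f_inv)
  \<comment> \<open>\<open>H\<close> normalizes \<open>P\<close> because \<open>S\<close> is normal,
    and the second condition turns this into centralizing.\<close>
  have cent: "t \<otimes> a = a \<otimes> t" if t: "t \<in> H" and a: "a \<in> P" for t a
  proof -
    have "t \<in> normalizer G P"
      by (rule conj_in_P_imp_normalizer) (use t in auto)
    then show ?thesis using central a by (simp add: centralizer_def)
  qed
  \<comment> \<open>Since each \<open>t\<close> commutes with \<open>a\<close>, every summand at the
    fixed point of \<open>x\<close> equals \<open>\<psi> a\<close>. The number of summands is prime
    to \<open>p\<close>, so no information is lost.\<close>
  have f_val: "f (inv x \<otimes> a \<otimes> x) x = nmul (card T) (\<psi> a)"
    if a: "a \<in> P" and x: "x \<in> carrier G" for a x
  proof -
    have ac: "a \<in> carrier G" using P.mem_carrier[OF a] .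
    have "lam (t \<otimes> x \<otimes> (inv x \<otimes> a \<otimes> x)) - lam (t \<otimes> x) = \<psi> a" if t: "t \<in> T" for t
    proof -
      have "t \<otimes> x \<otimes> (inv x \<otimes> a \<otimes> x) = (t \<otimes> a) \<otimes> x"
        using Tc[OF t] x ac by (simp add: m_assoc mult_inv_cancel)
      also have "t \<otimes> a = a \<otimes> t" using cent a t T(1) by blast
      also have "a \<otimes> t \<otimes> x = a \<otimes> (t \<otimes> x)" using Tc[OF t] x ac by (simp add: m_assoc)
      finally show ?thesis using lam_P[OF a] Tc[OF t] x by simp
    qed
    then show ?thesis by (simp add: f_def sum_const_nmul[OF finT])
  qed
  have f_tors: "nmul p (f g x) = 0" if g: "g \<in> carrier G" and x: "x \<in> carrier G" for g x
  proof -
    have l0: "nmul p (lam z) = 0" if "z \<in> carrier G" for z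
      unfolding lam_def by (rule \<psi>(2)[OF rP[OF that]])
    have "nmul p (\<Sum>t\<in>A. \<phi> t) = (\<Sum>t\<in>A. nmul p (\<phi> t))" if "finite A" for A and \<phi> :: "'a \<Rightarrow> circle"
      using that by (induction A rule: finite_induct) (auto simp: nmul_add)
    then have "nmul p (f g x) = (\<Sum>t\<in>T. nmul p (lam (t \<otimes> x \<otimes> g) - lam (t \<otimes> x)))"
      unfolding f_def using finT by blast
    also have "\<dots> = 0" using l0 Tc g x by (simp add: nmul_diff)
    finally show ?thesis .
  qed
  have nontriv: "\<not> gtriv f"
  proof
    assume "gtriv f"
    then obtain u y where u: "inv_fun u"
        "\<And>g x. g \<in> carrier G \<Longrightarrow> x \<in> carrier G \<Longrightarrow> f g x = u (x \<otimes> g) - u x + y g"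
      unfolding jtriv_def by blast
    \<comment> \<open>\<open>f\<close> is a genuine crossed homomorphism, so in any trivialization
      the constants form a character of \<open>G\<close>; it vanishes on commutators, hence on
      \<open>S\<close>, contradicting the value of \<open>f\<close> at \<open>a0\<close>.\<close>
    have y_hom: "y (g \<otimes> h) = y g + y h" if g: "g \<in> carrier G" and h: "h \<in> carrier G" for g h
    proof -
      have "f (g \<otimes> h) \<one> = f g \<one> + f h (\<one> \<otimes> g)" using crossedD[OF f_crossed g h one_closed] .
      then show ?thesis using u(2) g h by (simp add: algebra_simps)
    qed
    have y1: "y \<one> = 0" using y_hom[OF one_closed one_closed] by simp
    have y_inv: "y (inv g) = - y g" if "g \<in> carrier G" for g
      using y_hom[OF inv_closed[OF that] that] that y1 by (simp add: eq_neg_iff_add_eq_0)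
    have "y s = 0" if "s \<in> S" for s
    proof -
      have "s \<in> generate G {a \<otimes> b \<otimes> inv a \<otimes> inv b |a b. a \<in> S \<and> b \<in> carrier G}"
        using perfect that by (simp add: commutator_subgroup_def)
      then have "s \<in> carrier G \<and> y s = 0"
      proof (induction rule: generate.induct)
        case one
        show ?case using y1 by simp
      next
        case (incl h)
        then obtain a b where ab: "h = a \<otimes> b \<otimes> inv a \<otimes> inv b" "a \<in> S" "b \<in> carrier G" by blast
        then show ?case by (simp add: y_hom y_inv)
      next
        case (inv h)
        then obtain a b where ab: "h = a \<otimes> b \<otimes> inv a \<otimes> inv b" "a \<in> S" "b \<in> carrier G" by blast
        then show ?case by (simp add: y_hom y_inv)
      next
        case (eng h1 h2)
        then show ?case by (simp add: y_hom)
      qed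
      then show ?thesis by simp
    qed
    then have "y a0 = 0" using a0 by simp
    moreover have "f a0 \<one> = y a0"
      using u(2)[of a0 \<one>] inv_funD[OF u(1), of a0 \<one>] a0 by simp
    moreover have "f a0 \<one> = nmul (card T) (\<psi> a0)" using f_val[OF a0(1) one_closed] a0 by simp
    ultimately have z: "nmul (card T) (\<psi> a0) = 0" by simp
    obtain i j where "i * p = j * card T + 1"
      using bezout_nat[of p "card T"] cop_T prime_gt_0_nat[OF prime_p]
      by (auto simp: coprime_iff_gcd_eq_1 mult.commute)
    then have "nmul (i * p) (\<psi> a0) = nmul (j * card T + 1) (\<psi> a0)" by simp
    then have "\<psi> a0 = 0" using z \<psi>(2)[OF a0(1)] by (simp add: nmul_mult nmul_add_left)
    with a0(2) show False by simp
  qed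
  have triv: "jtriv D f" if D: "subgroup D G" and nS: "\<not> S \<subseteq> D" for D
  proof -
    define C where "C = D \<inter> S"
    have C: "subgroup C G" unfolding C_def using subgroups_Inter_pair[OF D subgroup_S] .
    have CS: "C \<subseteq> S" and CD: "C \<subseteq> D" by (auto simp: C_def)
    have Cc: "c \<in> carrier G" if "c \<in> C" for c using that CS by auto
    have "C \<noteq> S" using nS by (auto simp: C_def)
    then have cardC: "card C = 1 \<or> card C = p" using card_subgroup_S[OF C CS] by blast
    \<comment> \<open>It suffices that each \<open>f s\<close> takes a single value at all fixed
      points of \<open>s\<close>, additively in \<open>s\<close>: subtracting it leaves a crossed
      homomorphism on \<open>C\<close> that vanishes on stabilizers.\<close>
    have "\<exists>y. (\<forall>s\<in>C. \<forall>t\<in>C. y (s \<otimes> t) = y s + y t) \<and>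
        (\<forall>s\<in>C. \<forall>x\<in>carrier G. x \<otimes> s \<otimes> inv x \<in> H \<longrightarrow> f s x = y s)"
    proof (cases "\<exists>x\<in>carrier G. \<exists>s\<in>C. s \<noteq> \<one> \<and> x \<otimes> s \<otimes> inv x \<in> H")
      case True
      then obtain x0 s0 where x0: "x0 \<in> carrier G" "s0 \<in> C" "s0 \<noteq> \<one>" "x0 \<otimes> s0 \<otimes> inv x0 \<in> H" by blast
      have conj_eq: "z \<otimes> s \<otimes> inv z \<in> P"
        \<comment> \<open>As \<open>C\<close> has prime order here, a point fixed by one nontrivial
          element of \<open>C\<close> is fixed by all of \<open>C\<close>.\<close>
        if z: "z \<in> carrier G" "s1 \<in> C" "s1 \<noteq> \<one>" "z \<otimes> s1 \<otimes> inv z \<in> H" and s: "s \<in> C" for z s1 s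
      proof -
        define K where "K = {c \<in> C. z \<otimes> c \<otimes> inv z \<in> H}"
        have "subgroup K G"
        proof (rule subgroupI)
          show "K \<subseteq> carrier G" using Cc by (auto simp: K_def)
          show "K \<noteq> {}" using z by (auto simp: K_def)
        next
          fix a assume a: "a \<in> K"
          have "z \<otimes> inv a \<otimes> inv z = inv (z \<otimes> a \<otimes> inv z)"
            using a z Cc by (simp add: K_def inv_mult_group m_assoc)
          then show "inv a \<in> K" using a subgroup.m_inv_closed[OF C] by (simp add: K_def)
        next
          fix a b assume a: "a \<in> K" and b: "b \<in> K"
          have "z \<otimes> (a \<otimes> b) \<otimes> inv z = (z \<otimes> a \<otimes> inv z) \<otimes> (z \<otimes> b \<otimes> inv z)"
            using a b z Cc by (simp add: K_def m_assoc inv_mult_cancel)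
          then show "a \<otimes> b \<in> K" using a b subgroup.m_closed[OF C] by (simp add: K_def)
        qed
        moreover have KC: "K \<subseteq> C" by (auto simp: K_def)
        ultimately have "card K = 1 \<or> card K = p \<or> K = S" using card_subgroup_S CS by blast
        moreover have finC: "finite C" using finite_subset[OF CS finite_S] .
        have sub: "{\<one>, s1} \<subseteq> K"
          using z subgroup.one_closed[OF \<open>subgroup K G\<close>] by (auto simp: K_def)
        have "2 \<le> card K"
          using card_mono[OF finite_subset[OF KC finC] sub] z(3) by simp
        moreover have "card C = 1 \<or> card C = p" by (rule cardC)
        moreover have "card K \<le> card C" using card_mono[OF finC KC] .
        moreover have "K \<noteq> S" using KC CS \<open>C \<noteq> S\<close> by blast
        ultimately have "card K = card C" by auto
        then have "K = C" using card_subset_eq[OF finC KC] by simp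
        then have "z \<otimes> s \<otimes> inv z \<in> H" using s by (auto simp: K_def)
        then show ?thesis using conj_S z(1) s CS by blast
      qed
      define y where "y s = f s x0" for s
      have x0C: "x0 \<otimes> s \<otimes> inv x0 \<in> P" if "s \<in> C" for s
        by (rule conj_eq[OF x0 that])
      have "y (s \<otimes> t) = y s + y t" if s: "s \<in> C" and t: "t \<in> C" for s t
        using crossedD[OF f_crossed Cc[OF s] Cc[OF t] x0(1)]
          fixed_point[OF f_inv[OF Cc[OF t]] x0(1) Cc[OF s]] x0C[OF s] by (simp add: y_def)
      moreover have "f s x = y s"
        if s: "s \<in> C" and x: "x \<in> carrier G" and sx: "x \<otimes> s \<otimes> inv x \<in> H" for s x
      proof (cases "s = \<one>")
        case True
        have "f \<one> z = 0" if "z \<in> carrier G" for z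
          using crossedD[OF f_crossed one_closed one_closed that] that by simp
        then show ?thesis using x x0(1) True by (simp add: y_def)
      next
        case False
        note sc = Cc[OF s]
        \<comment> \<open>Conjugation by \<open>x\<close> and by \<open>x0\<close> both carry
          \<open>C\<close> onto \<open>P\<close>, so \<open>w\<close> normalizes \<open>P\<close>.
          By the second condition it centralizes \<open>P\<close>, so both conjugations send
          \<open>s\<close> to the same \<open>a\<close>, and \<open>f s\<close> has the same value
          at both points.\<close>
        define w where "w = x0 \<otimes> inv x"
        have wc: "w \<in> carrier G" using x x0(1) by (simp add: w_def)
        define a where "a = x \<otimes> s \<otimes> inv x"
        have aP: "a \<in> P" unfolding a_def by (rule conj_eq[OF x s False sx s])
        have xC: "x \<otimes> t \<otimes> inv x \<in> P" if "t \<in> C" for t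
          by (rule conj_eq[OF x s False sx that])
        have "w \<in> normalizer G P"
        proof (rule conj_in_P_imp_normalizer[OF wc])
          fix b assume b: "b \<in> P"
          have inj: "inj_on (\<lambda>t. x \<otimes> t \<otimes> inv x) C"
            using x Cc by (auto intro!: inj_onI)
          have "card C = p" using cardC s False subgroup.one_closed[OF C]
            by (auto simp: card_1_singleton_iff)
          then have "card ((\<lambda>t. x \<otimes> t \<otimes> inv x) ` C) = card P"
            using card_image[OF inj] card_P by simp
          moreover have "(\<lambda>t. x \<otimes> t \<otimes> inv x) ` C \<subseteq> P" using xC by blast
          ultimately have "(\<lambda>t. x \<otimes> t \<otimes> inv x) ` C = P"
            using card_subset_eq[of "P"] finite_S by simp
          then obtain t where t: "t \<in> C" "b = x \<otimes> t \<otimes> inv x" using b by blast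
          have "w \<otimes> b \<otimes> inv w = x0 \<otimes> t \<otimes> inv x0"
            using t x x0(1) Cc[OF t(1)] by (simp add: w_def m_assoc inv_mult_group inv_mult_cancel)
          then show "w \<otimes> b \<otimes> inv w \<in> H" using x0C[OF t(1)] by simp
        qed
        then have "w \<otimes> a = a \<otimes> w" using central aP by (simp add: centralizer_def)
        then have "w \<otimes> a \<otimes> inv w = a" using wc P.mem_carrier[OF aP] by (simp add: m_assoc)
        moreover have "w \<otimes> a \<otimes> inv w = x0 \<otimes> s \<otimes> inv x0"
          using x x0(1) sc by (simp add: w_def a_def m_assoc inv_mult_group inv_mult_cancel)
        ultimately have e: "x0 \<otimes> s \<otimes> inv x0 = a" by simp
        have "s = inv x \<otimes> a \<otimes> x" using x sc by (simp add: a_def m_assoc inv_mult_cancel)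
        then have "f s x = nmul (card T) (\<psi> a)" using f_val[OF aP x] by simp
        moreover have "s = inv x0 \<otimes> a \<otimes> x0"
          using x0(1) sc by (simp add: e[symmetric] m_assoc inv_mult_cancel)
        then have "f s x0 = nmul (card T) (\<psi> a)" using f_val[OF aP x0(1)] by simp
        ultimately show ?thesis by (simp add: y_def)
      qed
      ultimately show ?thesis by (intro exI[of _ y]) simp
    next
      case False
      have f1: "f \<one> z = 0" if "z \<in> carrier G" for z
        using crossedD[OF f_crossed one_closed one_closed that] that by simp
      have "f s x = 0" if "s \<in> C" "x \<in> carrier G" "x \<otimes> s \<otimes> inv x \<in> H" for s x
        using False that f1 by metis
      then show ?thesis by (intro exI[of _ "\<lambda>s. 0"]) simp
    qed
    then obtain y where y: "\<And>s t. s \<in> C \<Longrightarrow> t \<in> C \<Longrightarrow> y (s \<otimes> t) = y s + y t"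
        "\<And>s x. s \<in> C \<Longrightarrow> x \<in> carrier G \<Longrightarrow> x \<otimes> s \<otimes> inv x \<in> H \<Longrightarrow> f s x = y s" by blast
    have "crossed C (\<lambda>s x. f s x - y s)"
      unfolding crossed_def
    proof (intro conjI ballI)
      fix s assume "s \<in> C"
      then show "inv_fun (\<lambda>x. f s x - y s)" using f_inv[OF Cc] by (simp add: inv_fun_def)
    next
      fix s t x assume s: "s \<in> C" and t: "t \<in> C" and x: "x \<in> carrier G"
      show "f (s \<otimes> t) x - y (s \<otimes> t) = f s x - y s + (f t (x \<otimes> s) - y t)"
        using crossedD[OF f_crossed Cc[OF s] Cc[OF t] x] y(1)[OF s t] by (simp add: algebra_simps)
    qed
    from crossed_zero_on_stabilizers[OF C this] y(2)
    obtain u where u: "inv_fun u" "\<And>s x. s \<in> C \<Longrightarrow> x \<in> carrier G \<Longrightarrow> f s x - y s = u (x \<otimes> s) - u x"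
      by auto
    have eq: "f s x = u (x \<otimes> s) - u x + y s" if "s \<in> C" "x \<in> carrier G" for s x
      using u(2)[OF that] by (simp add: algebra_simps)
    have "jtriv C f"
      unfolding jtriv_def by (intro exI[of _ u] exI[of _ y] conjI ballI eq u(1))
    moreover have "jcoc D f"
      using jcoc_subset[OF crossed_imp_jcoc[OF f_crossed] subgroup.subset[OF D]] .
    ultimately have "jtriv D (\<lambda>g x. nmul (card D div card C) (f g x))"
      using jtriv_transfer[OF D C CD] by blast
    moreover have "jtriv D (\<lambda>g x. nmul p (f g x))"
      using jtriv_cong[of D "\<lambda>g x. nmul p (f g x)" "\<lambda>g x. 0"] jtriv_zero f_tors
        subgroup.mem_carrier[OF D] by blast
    moreover have "coprime (card D div card C) p"
      using coprime_index_inter[OF D] by (simp add: C_def coprime_commute)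
    ultimately show ?thesis by (rule jtriv_coprime)
  qed
  show thesis
    using that[OF crossed_imp_jcoc[OF f_crossed] nontriv f_tors triv] .
qed

end

section \<open>Cochains with values in the module J\<close>

context coset_module
begin

text \<open>The element of \<open>J\<close> represented by \<open>m\<close>: its coset modulo
  constants written out. Only the values of \<open>m\<close> on the carrier matter.\<close>

definition cls :: "('a \<Rightarrow> int) \<Rightarrow> ('a \<Rightarrow> int) set" where
  "cls m = range (\<lambda>c. \<lambda>x\<in>carrier G. m x + c)"

abbreviation J where "J \<equiv> J_module G H"

lemma cls_cong: "(\<And>x. x \<in> carrier G \<Longrightarrow> m x = m' x) \<Longrightarrow> cls m = cls m'"
  unfolding cls_def by (intro image_cong refl restrict_ext) simp

lemma coset_eq_cls:
  "range (\<lambda>m. \<lambda>x\<in>carrier G. m) #>\<^bsub>Ind G H\<^esub> f = cls f"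
proof -
  have "(\<lambda>x\<in>carrier G. (\<lambda>x\<in>carrier G. c) x + f x) = (\<lambda>x\<in>carrier G. f x + c)" for c
    by (intro restrict_ext) simp
  then show ?thesis
    unfolding r_coset_def Ind_def cls_def by auto
qed

lemma carrier_J: "carrier J = {cls m |m. inv_fun m}"
proof -
  have J: "carrier J = cls ` carrier (Ind G H)"
    unfolding J_module_def FactGroup_def RCOSETS_def coset_eq_cls by auto
  show ?thesis
  proof (intro equalityI subsetI)
    fix z assume "z \<in> carrier J"
    then obtain m where "m \<in> carrier (Ind G H)" "z = cls m" unfolding J by (elim imageE)
    moreover from this(1) have "inv_fun m" by (simp add: Ind_def inv_fun_def)
    ultimately show "z \<in> {cls m |m. inv_fun m}" by (intro CollectI exI[of _ m] conjI)
  next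
    fix z assume "z \<in> {cls m |m. inv_fun m}"
    then obtain m where m: "z = cls m" "inv_fun m" by (elim CollectE exE conjE)
    have "restrict m (carrier G) \<in> carrier (Ind G H)"
      using m(2) H_carrier by (simp add: Ind_def inv_fun_def)
    moreover have "z = cls (restrict m (carrier G))" unfolding m(1) by (rule cls_cong) simp
    ultimately show "z \<in> carrier J" unfolding J by (intro image_eqI)
  qed
qed

lemma cls_closed: "inv_fun m \<Longrightarrow> cls m \<in> carrier J"
  unfolding carrier_J by (intro CollectI exI[of _ m] conjI refl)

lemma cls_eq_iff: "cls m = cls m' \<longleftrightarrow> (\<exists>c. \<forall>x\<in>carrier G. m x = m' x + c)"
proof
  assume "cls m = cls m'"
  moreover have "(\<lambda>x\<in>carrier G. m x + 0) \<in> cls m" unfolding cls_def by (rule rangeI)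
  ultimately obtain c where "(\<lambda>x\<in>carrier G. m x + 0) = (\<lambda>x\<in>carrier G. m' x + c)"
    unfolding cls_def by auto
  then have "\<forall>x\<in>carrier G. m x = m' x + c" by (metis (mono_tags, lifting) add.right_neutral restrict_apply')
  then show "\<exists>c. \<forall>x\<in>carrier G. m x = m' x + c" ..
next
  assume "\<exists>c. \<forall>x\<in>carrier G. m x = m' x + c"
  then obtain c where c: "\<forall>x\<in>carrier G. m x = m' x + c" ..
  have 1: "(\<lambda>x\<in>carrier G. m x + d) = (\<lambda>x\<in>carrier G. m' x + (c + d))" for d
    by (intro restrict_ext) (use c in simp)
  have 2: "(\<lambda>x\<in>carrier G. m' x + d) = (\<lambda>x\<in>carrier G. m x + (d - c))" for d
    by (intro restrict_ext) (use c in simp)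
  show "cls m = cls m'"
  proof
    show "cls m \<subseteq> cls m'" unfolding cls_def using 1 by blast
    show "cls m' \<subseteq> cls m" unfolding cls_def using 2 by blast
  qed
qed

lemma cls_mult: "cls m \<otimes>\<^bsub>J\<^esub> cls m' = cls (\<lambda>x. m x + m' x)"
proof -
  have eq: "(\<lambda>x\<in>carrier G. (\<lambda>x\<in>carrier G. m x + c) x + (\<lambda>x\<in>carrier G. m' x + d) x) =
      (\<lambda>x\<in>carrier G. m x + m' x + (c + d))" for c d
    by (intro restrict_ext) simp
  have "cls m \<otimes>\<^bsub>J\<^esub> cls m' = (\<Union>a\<in>cls m. \<Union>b\<in>cls m'. {\<lambda>x\<in>carrier G. a x + b x})"
    by (simp add: J_module_def Ind_def set_mult_def)
  also have "\<dots> = {\<lambda>x\<in>carrier G. m x + m' x + (c + d) |c d. True}"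
    unfolding cls_def UN_simps(10) eq by auto
  also have "\<dots> = cls (\<lambda>x. m x + m' x)"
  proof
    show "{\<lambda>x\<in>carrier G. m x + m' x + (c + d) |c d. True} \<subseteq> cls (\<lambda>x. m x + m' x)"
      unfolding cls_def by blast
    show "cls (\<lambda>x. m x + m' x) \<subseteq> {\<lambda>x\<in>carrier G. m x + m' x + (c + d) |c d. True}"
    proof
      fix z assume "z \<in> cls (\<lambda>x. m x + m' x)"
      then obtain c where "z = (\<lambda>x\<in>carrier G. m x + m' x + (c + 0))" unfolding cls_def by auto
      then show "z \<in> {\<lambda>x\<in>carrier G. m x + m' x + (c + d) |c d. True}" by blast
    qed
  qed
  finally show ?thesis .
qed

lemma cls_one: "\<one>\<^bsub>J\<^esub> = cls (\<lambda>x. 0)"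
  unfolding J_module_def cls_def by (simp add: FactGroup_def)

lemma inv_fun_add: "inv_fun m \<Longrightarrow> inv_fun m' \<Longrightarrow> inv_fun (\<lambda>x. m x + m' x)"
  by (simp add: inv_fun_def)

lemma inv_fun_minus: "inv_fun m \<Longrightarrow> inv_fun (\<lambda>x. - m x)"
  by (simp add: inv_fun_def)

lemma inv_fun_const: "inv_fun (\<lambda>x. c)"
  by (simp add: inv_fun_def)

lemma comm_group_J: "comm_group J"
proof (rule comm_groupI)
  fix x y assume "x \<in> carrier J" "y \<in> carrier J"
  then show "x \<otimes>\<^bsub>J\<^esub> y \<in> carrier J"
    unfolding carrier_J by (auto simp: cls_mult intro: inv_fun_add)
next
  show "\<one>\<^bsub>J\<^esub> \<in> carrier J" unfolding cls_one by (rule cls_closed[OF inv_fun_const])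
next
  fix x y z assume "x \<in> carrier J" "y \<in> carrier J" "z \<in> carrier J"
  then show "x \<otimes>\<^bsub>J\<^esub> y \<otimes>\<^bsub>J\<^esub> z = x \<otimes>\<^bsub>J\<^esub> (y \<otimes>\<^bsub>J\<^esub> z)"
    unfolding carrier_J by (auto simp: cls_mult add.assoc)
next
  fix x y assume "x \<in> carrier J" "y \<in> carrier J"
  then show "x \<otimes>\<^bsub>J\<^esub> y = y \<otimes>\<^bsub>J\<^esub> x"
    unfolding carrier_J by (auto simp: cls_mult add.commute)
next
  fix x assume "x \<in> carrier J"
  then show "\<one>\<^bsub>J\<^esub> \<otimes>\<^bsub>J\<^esub> x = x" unfolding carrier_J by (auto simp: cls_mult cls_one)
next
  fix x assume "x \<in> carrier J"
  then obtain m where m: "x = cls m" "inv_fun m" unfolding carrier_J by blast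
  show "\<exists>y\<in>carrier J. y \<otimes>\<^bsub>J\<^esub> x = \<one>\<^bsub>J\<^esub>"
    by (rule bexI[OF _ cls_closed[OF inv_fun_minus[OF m(2)]]]) (simp add: m(1) cls_mult cls_one)
qed

sublocale J: comm_group J by (rule comm_group_J)

lemma cls_inv: "inv_fun m \<Longrightarrow> inv\<^bsub>J\<^esub> cls m = cls (\<lambda>x. - m x)"
  by (rule J.inv_equality) (simp_all add: cls_mult cls_one cls_closed inv_fun_minus)

lemma cls_act:
  assumes g: "g \<in> carrier G"
  shows "J_act G g (cls m) = cls (\<lambda>x. m (x \<otimes> g))"
proof -
  have "Ind_act G g (\<lambda>x\<in>carrier G. m x + c) = (\<lambda>x\<in>carrier G. m (x \<otimes> g) + c)" for c
    unfolding Ind_act_def by (intro restrict_ext) (use g in simp)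
  then show ?thesis unfolding J_act_def cls_def by (simp add: image_image)
qed

section \<open>Integer-valued lifts of 2-cochains with values in \<open>J\<close>\<close>

abbreviation Z2 where "Z2 D \<equiv> cocycles2 (G\<lparr>carrier := D\<rparr>) J (J_act G)"
abbreviation B2 where "B2 D \<equiv> coboundaries2 (G\<lparr>carrier := D\<rparr>) J (J_act G)"
abbreviation ZG where "ZG \<equiv> Z2 (carrier G)"
abbreviation BG where "BG \<equiv> B2 (carrier G)"

text \<open>Cochains are handled through integer-valued lifts \<open>m\<close>, so that identities
  in \<open>J\<close> become integer identities up to a constant independent of the point.\<close>

definition cochain2 :: "'a set \<Rightarrow> ('a \<Rightarrow> 'a \<Rightarrow> 'a \<Rightarrow> int) \<Rightarrow> 'a \<times> 'a \<Rightarrow> ('a \<Rightarrow> int) set" where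
  "cochain2 D m = (\<lambda>(g, h)\<in>D \<times> D. cls (m g h))"

lemma cochain2_apply [simp]: "g \<in> D \<Longrightarrow> h \<in> D \<Longrightarrow> cochain2 D m (g, h) = cls (m g h)"
  by (simp add: cochain2_def)

lemma cochain2_eq_iff:
  "cochain2 D m = cochain2 D m' \<longleftrightarrow> (\<forall>g\<in>D. \<forall>h\<in>D. cls (m g h) = cls (m' g h))"
proof
  assume "cochain2 D m = cochain2 D m'"
  then show "\<forall>g\<in>D. \<forall>h\<in>D. cls (m g h) = cls (m' g h)" by (metis cochain2_apply)
next
  assume "\<forall>g\<in>D. \<forall>h\<in>D. cls (m g h) = cls (m' g h)"
  then show "cochain2 D m = cochain2 D m'"
    unfolding cochain2_def by (intro restrict_ext) auto
qed

lemma restrict_cochain2: "D \<subseteq> D' \<Longrightarrow> restrict (cochain2 D' m) (D \<times> D) = cochain2 D m"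
  unfolding cochain2_def by (auto simp: fun_eq_iff)

lemma carrier_cochains2:
  "carrier (cochains2 (G\<lparr>carrier := D\<rparr>) J) = {cochain2 D m |m. \<forall>g\<in>D. \<forall>h\<in>D. inv_fun (m g h)}"
proof
  show "carrier (cochains2 (G\<lparr>carrier := D\<rparr>) J) \<subseteq> {cochain2 D m |m. \<forall>g\<in>D. \<forall>h\<in>D. inv_fun (m g h)}"
  proof
    fix c assume "c \<in> carrier (cochains2 (G\<lparr>carrier := D\<rparr>) J)"
    then have c: "c \<in> D \<times> D \<rightarrow>\<^sub>E carrier J" by (simp add: cochains2_def)
    have "\<forall>g h. \<exists>m. g \<in> D \<and> h \<in> D \<longrightarrow> inv_fun m \<and> c (g, h) = cls m"
      using PiE_mem[OF c] unfolding carrier_J by blast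
    then obtain m where m: "\<And>g h. g \<in> D \<Longrightarrow> h \<in> D \<Longrightarrow> inv_fun (m g h) \<and> c (g, h) = cls (m g h)"
      by metis
    have "c = cochain2 D m"
      by (rule extensionalityI[of _ "D \<times> D"]) (use c in \<open>auto simp: cochain2_def m PiE_def\<close>)
    then show "c \<in> {cochain2 D m |m. \<forall>g\<in>D. \<forall>h\<in>D. inv_fun (m g h)}" using m by blast
  qed
  show "{cochain2 D m |m. \<forall>g\<in>D. \<forall>h\<in>D. inv_fun (m g h)} \<subseteq> carrier (cochains2 (G\<lparr>carrier := D\<rparr>) J)"
  proof
    fix c assume "c \<in> {cochain2 D m |m. \<forall>g\<in>D. \<forall>h\<in>D. inv_fun (m g h)}"
    then obtain m where "c = cochain2 D m" "\<forall>g\<in>D. \<forall>h\<in>D. inv_fun (m g h)"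
      by (elim CollectE exE conjE)
    then show "c \<in> carrier (cochains2 (G\<lparr>carrier := D\<rparr>) J)"
      by (simp add: cochains2_def cochain2_def Pi_def cls_closed split_beta)
  qed
qed

lemma cochain2_mult:
  "cochain2 D m \<otimes>\<^bsub>cochains2 (G\<lparr>carrier := D\<rparr>) J\<^esub> cochain2 D m' =
    cochain2 D (\<lambda>g h x. m g h x + m' g h x)"
  unfolding cochains2_def cochain2_def by (auto simp: fun_eq_iff cls_mult)

lemma coboundary2_cochain2:
  assumes D: "subgroup D G" and m: "\<forall>g\<in>D. \<forall>h\<in>D. inv_fun (m g h)"
  shows "coboundary2 (G\<lparr>carrier := D\<rparr>) J (J_act G) (cochain2 D m) =
    (\<lambda>(g, h, k)\<in>D \<times> D \<times> D.
      cls (\<lambda>x. m h k (x \<otimes> g) - m (g \<otimes> h) k x + m g (h \<otimes> k) x - m g h x))"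
proof -
  interpret D: subgroup D G by (rule D)
  have "J_act G g (cochain2 D m (h, k)) \<otimes>\<^bsub>J\<^esub> inv\<^bsub>J\<^esub> cochain2 D m (g \<otimes> h, k)
        \<otimes>\<^bsub>J\<^esub> cochain2 D m (g, h \<otimes> k) \<otimes>\<^bsub>J\<^esub> inv\<^bsub>J\<^esub> cochain2 D m (g, h) =
      cls (\<lambda>x. m h k (x \<otimes> g) - m (g \<otimes> h) k x + m g (h \<otimes> k) x - m g h x)"
    if "g \<in> D" "h \<in> D" "k \<in> D" for g h k
    using that by (simp add: cls_act cls_inv m cls_mult)
  then show ?thesis
    unfolding coboundary2_def by (auto simp: fun_eq_iff)
qed

abbreviation cocycle_cond :: "'a set \<Rightarrow> ('a \<Rightarrow> 'a \<Rightarrow> 'a \<Rightarrow> int) \<Rightarrow> bool" where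
  "cocycle_cond D m \<equiv> \<forall>g\<in>D. \<forall>h\<in>D. \<forall>k\<in>D. \<exists>c. \<forall>x\<in>carrier G.
      m h k (x \<otimes> g) - m (g \<otimes> h) k x + m g (h \<otimes> k) x - m g h x = c"

lemma mem_Z2_iff:
  assumes D: "subgroup D G" and m: "\<forall>g\<in>D. \<forall>h\<in>D. inv_fun (m g h)"
  shows "cochain2 D m \<in> carrier (Z2 D) \<longleftrightarrow> cocycle_cond D m"
proof -
  have "cochain2 D m \<in> carrier (cochains2 (G\<lparr>carrier := D\<rparr>) J)"
    unfolding carrier_cochains2 using m by blast
  then have "cochain2 D m \<in> carrier (Z2 D) \<longleftrightarrow>
      coboundary2 (G\<lparr>carrier := D\<rparr>) J (J_act G) (cochain2 D m) = \<one>\<^bsub>cochains3 (G\<lparr>carrier := D\<rparr>) J\<^esub>"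
    by (simp add: cocycles2_def kernel_def)
  also have "\<dots> \<longleftrightarrow> (\<forall>g\<in>D. \<forall>h\<in>D. \<forall>k\<in>D.
      cls (\<lambda>x. m h k (x \<otimes> g) - m (g \<otimes> h) k x + m g (h \<otimes> k) x - m g h x) = cls (\<lambda>x. 0))"
    (is "_ \<longleftrightarrow> ?R")
  proof -
    have e: "coboundary2 (G\<lparr>carrier := D\<rparr>) J (J_act G) (cochain2 D m) =
      (\<lambda>(g, h, k)\<in>D \<times> D \<times> D.
        cls (\<lambda>x. m h k (x \<otimes> g) - m (g \<otimes> h) k x + m g (h \<otimes> k) x - m g h x))"
      by (rule coboundary2_cochain2[OF D m])
    have one: "\<one>\<^bsub>cochains3 (G\<lparr>carrier := D\<rparr>) J\<^esub> = (\<lambda>_\<in>D \<times> D \<times> D. cls (\<lambda>x. 0))"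
      by (simp add: cochains3_def cls_one)
    show ?thesis
      unfolding e one
    proof
      assume L: "(\<lambda>(g, h, k)\<in>D \<times> D \<times> D.
        cls (\<lambda>x. m h k (x \<otimes> g) - m (g \<otimes> h) k x + m g (h \<otimes> k) x - m g h x)) =
        (\<lambda>_\<in>D \<times> D \<times> D. cls (\<lambda>x. 0))"
      show ?R
      proof (intro ballI)
        fix g h k assume "g \<in> D" "h \<in> D" "k \<in> D"
        with fun_cong[OF L, of "(g, h, k)"]
        show "cls (\<lambda>x. m h k (x \<otimes> g) - m (g \<otimes> h) k x + m g (h \<otimes> k) x - m g h x) = cls (\<lambda>x. 0)"
          by simp
      qed
    next
      assume ?R
      then show "(\<lambda>(g, h, k)\<in>D \<times> D \<times> D.
        cls (\<lambda>x. m h k (x \<otimes> g) - m (g \<otimes> h) k x + m g (h \<otimes> k) x - m g h x)) =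
        (\<lambda>_\<in>D \<times> D \<times> D. cls (\<lambda>x. 0))"
        by (intro restrict_ext) (clarsimp simp only: mem_Sigma_iff split_conv)
    qed
  qed
  also have "\<dots> \<longleftrightarrow> cocycle_cond D m"
    unfolding cls_eq_iff by simp
  finally show ?thesis .
qed

lemma B2_eq:
  assumes D: "subgroup D G"
  shows "B2 D = {cochain2 D (\<lambda>g h x. i h (x \<otimes> g) - i (g \<otimes> h) x + i g x) |i. \<forall>g\<in>D. inv_fun (i g)}"
proof -
  interpret D: subgroup D G by (rule D)
  define c1 where "c1 i = (\<lambda>g\<in>D. cls (i g))" for i
  have car: "carrier (cochains1 (G\<lparr>carrier := D\<rparr>) J) = {c1 i |i. \<forall>g\<in>D. inv_fun (i g)}"
  proof
    show "carrier (cochains1 (G\<lparr>carrier := D\<rparr>) J) \<subseteq> {c1 i |i. \<forall>g\<in>D. inv_fun (i g)}"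
    proof
      fix c assume "c \<in> carrier (cochains1 (G\<lparr>carrier := D\<rparr>) J)"
      then have c: "c \<in> D \<rightarrow>\<^sub>E carrier J" by (simp add: cochains1_def)
      have "\<forall>g. \<exists>m. g \<in> D \<longrightarrow> inv_fun m \<and> c g = cls m"
        using PiE_mem[OF c] unfolding carrier_J by blast
      then obtain i where i: "\<And>g. g \<in> D \<Longrightarrow> inv_fun (i g) \<and> c g = cls (i g)"
        by metis
      have "c = c1 i"
        by (rule extensionalityI[of _ D]) (use c in \<open>auto simp: c1_def i PiE_def\<close>)
      then show "c \<in> {c1 i |i. \<forall>g\<in>D. inv_fun (i g)}" using i by blast
    qed
    show "{c1 i |i. \<forall>g\<in>D. inv_fun (i g)} \<subseteq> carrier (cochains1 (G\<lparr>carrier := D\<rparr>) J)"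
      by (auto simp: cochains1_def c1_def cls_closed)
  qed
  have "coboundary1 (G\<lparr>carrier := D\<rparr>) J (J_act G) (c1 i) =
      cochain2 D (\<lambda>g h x. i h (x \<otimes> g) - i (g \<otimes> h) x + i g x)" if i: "\<forall>g\<in>D. inv_fun (i g)" for i
  proof -
    have "J_act G g (c1 i h) \<otimes>\<^bsub>J\<^esub> inv\<^bsub>J\<^esub> c1 i (g \<otimes> h) \<otimes>\<^bsub>J\<^esub> c1 i g =
        cls (\<lambda>x. i h (x \<otimes> g) - i (g \<otimes> h) x + i g x)" if "g \<in> D" "h \<in> D" for g h
      using that i by (simp add: c1_def cls_act cls_inv cls_mult)
    then show ?thesis unfolding coboundary1_def cochain2_def by (auto simp: fun_eq_iff)
  qed
  note cob = this
  show ?thesis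
  proof (intro equalityI subsetI)
    fix c assume "c \<in> B2 D"
    then obtain i where i: "\<forall>g\<in>D. inv_fun (i g)"
        "c = coboundary1 (G\<lparr>carrier := D\<rparr>) J (J_act G) (c1 i)"
      unfolding coboundaries2_def car by (elim imageE CollectE exE conjE) simp
    from i(2) show "c \<in> {cochain2 D (\<lambda>g h x. i h (x \<otimes> g) - i (g \<otimes> h) x + i g x) |i. \<forall>g\<in>D. inv_fun (i g)}"
      unfolding cob[OF i(1)] by (intro CollectI exI[of _ i] conjI i(1))
  next
    fix c assume "c \<in> {cochain2 D (\<lambda>g h x. i h (x \<otimes> g) - i (g \<otimes> h) x + i g x) |i. \<forall>g\<in>D. inv_fun (i g)}"
    then obtain i where c: "c = cochain2 D (\<lambda>g h x. i h (x \<otimes> g) - i (g \<otimes> h) x + i g x)"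
        and i: "\<forall>g\<in>D. inv_fun (i g)"
      by (elim CollectE exE conjE)
    show "c \<in> B2 D"
      unfolding coboundaries2_def car c cob[OF i, symmetric]
      by (intro imageI CollectI exI[of _ i] conjI refl i)
  qed
qed

lemma cochain2_mem_B2_iff:
  assumes D: "subgroup D G"
  shows "cochain2 D m \<in> B2 D \<longleftrightarrow> (\<exists>i. (\<forall>g\<in>D. inv_fun (i g)) \<and>
    (\<forall>g\<in>D. \<forall>h\<in>D. \<exists>c. \<forall>x\<in>carrier G. m g h x = i h (x \<otimes> g) - i (g \<otimes> h) x + i g x + c))"
  unfolding B2_eq[OF D] mem_Collect_eq cochain2_eq_iff cls_eq_iff by (simp only: conj_commute)

section \<open>Comparison of 2-cocycles in \<open>J\<close> with circle-valued functions\<close>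

text \<open>
  The cocycle \<open>c\<close> with values in \<open>J\<close> is the image of the circle-valued cocycle \<open>f\<close> under the
  connecting homomorphism of \<open>0 \<rightarrow> \<int> \<rightarrow> \<real> \<rightarrow> \<real>/\<int> \<rightarrow> 0\<close>, computed modulo constants.
\<close>

definition rep_lift ::
    "('a \<Rightarrow> 'a \<Rightarrow> circle) \<Rightarrow> ('a \<Rightarrow> 'a \<Rightarrow> real) \<Rightarrow> ('a \<Rightarrow> 'a \<Rightarrow> 'a \<Rightarrow> int) \<Rightarrow> ('a \<Rightarrow> 'a \<Rightarrow> real) \<Rightarrow> bool"
  where "rep_lift f b m \<kappa> \<longleftrightarrow>
     (\<forall>g\<in>carrier G. inv_fun (b g)) \<and>
     (\<forall>g\<in>carrier G. \<forall>h\<in>carrier G. inv_fun (m g h)) \<and>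
     (\<forall>g\<in>carrier G. \<forall>x\<in>carrier G. f g x = to_circle (b g x)) \<and>
     (\<forall>g\<in>carrier G. \<forall>h\<in>carrier G. \<forall>x\<in>carrier G.
        b g x + b h (x \<otimes> g) - b (g \<otimes> h) x = of_int (m g h x) + \<kappa> g h)"

definition rep :: "('a \<Rightarrow> 'a \<Rightarrow> circle) \<Rightarrow> ('a \<times> 'a \<Rightarrow> ('a \<Rightarrow> int) set) \<Rightarrow> bool" where
  "rep f c \<longleftrightarrow> (\<exists>b m \<kappa>. rep_lift f b m \<kappa> \<and> c = cochain2 (carrier G) m)"

lemma rep_liftD:
  assumes "rep_lift f b m \<kappa>"
  shows "\<And>g. g \<in> carrier G \<Longrightarrow> inv_fun (b g)"
    "\<And>g h. g \<in> carrier G \<Longrightarrow> h \<in> carrier G \<Longrightarrow> inv_fun (m g h)"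
    "\<And>g x. g \<in> carrier G \<Longrightarrow> x \<in> carrier G \<Longrightarrow> f g x = to_circle (b g x)"
    "\<And>g h x. g \<in> carrier G \<Longrightarrow> h \<in> carrier G \<Longrightarrow> x \<in> carrier G \<Longrightarrow>
        b g x + b h (x \<otimes> g) - b (g \<otimes> h) x = of_int (m g h x) + \<kappa> g h"
  using assms unfolding rep_lift_def by simp_all

text \<open>Reduction to the circle kills the integers \<open>m g h x\<close>, leaving the constants
  \<open>\<kappa> g h\<close>.\<close>

lemma rep_jcoc:
  assumes "rep f c"
  shows "gcoc f"
proof -
  obtain b m \<kappa> where b0: "rep_lift f b m \<kappa>" "c = cochain2 (carrier G) m"
    using assms unfolding rep_def by (elim exE conjE)
  note b = rep_liftD[OF b0(1)] b0(2)
  have eq: "f g x + f h (x \<otimes> g) - f (g \<otimes> h) x = to_circle (\<kappa> g h)"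
    if "g \<in> carrier G" "h \<in> carrier G" "x \<in> carrier G" for g h x
  proof -
    have "f g x + f h (x \<otimes> g) - f (g \<otimes> h) x = to_circle (b g x + b h (x \<otimes> g) - b (g \<otimes> h) x)"
      using that by (simp add: b(3) to_circle_add to_circle_diff)
    also have "\<dots> = to_circle (of_int (m g h x)) + to_circle (\<kappa> g h)"
      unfolding b(4)[OF that] to_circle_add ..
    also have "to_circle (of_int (m g h x)) = 0" by (simp add: to_circle_eq_0_iff)
    finally show ?thesis by simp
  qed
  show ?thesis
  proof (rule jcocI)
    fix g assume "g \<in> carrier G"
    then show "inv_fun (f g)" using inv_funD[OF b(1)] b(3) H_carrier by (simp add: inv_fun_def)
  next
    fix g h x assume "g \<in> carrier G" "h \<in> carrier G" "x \<in> carrier G"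
    then show "f g x + f h (x \<otimes> g) - f (g \<otimes> h) x = f g \<one> + f h (\<one> \<otimes> g) - f (g \<otimes> h) \<one>"
      using eq[of g h x] eq[of g h \<one>] by (simp del: l_one)
  qed
qed

text \<open>Over the reals a cocycle is a coboundary: summing the cocycle identity over its last
  argument and dividing by the group order exhibits \<open>b\<close>.\<close>

lemma ex_rep_of_cocycle:
  assumes "c \<in> carrier ZG"
  shows "\<exists>f. rep f c"
proof -
  have "c \<in> carrier (cochains2 (G\<lparr>carrier := carrier G\<rparr>) J)"
    using assms by (simp add: cocycles2_def kernel_def)
  then obtain m where c: "c = cochain2 (carrier G) m"
      and m0: "\<forall>g\<in>carrier G. \<forall>h\<in>carrier G. inv_fun (m g h)"
    unfolding carrier_cochains2 by (elim CollectE exE conjE)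
  have m: "inv_fun (m g h)" if "g \<in> carrier G" "h \<in> carrier G" for g h using m0 that by simp
  have "cocycle_cond (carrier G) m"
    using assms unfolding c mem_Z2_iff[OF subgroup_self m0] .
  then obtain d where d: "\<And>g h k x. g \<in> carrier G \<Longrightarrow> h \<in> carrier G \<Longrightarrow> k \<in> carrier G \<Longrightarrow> x \<in> carrier G \<Longrightarrow>
      m h k (x \<otimes> g) - m (g \<otimes> h) k x + m g (h \<otimes> k) x - m g h x = d g h k"
    by metis
  define N where "N = real (card (carrier G))"
  have N: "N > 0" unfolding N_def using finite_carrier one_closed by (auto simp: card_gt_0_iff)
  \<comment> \<open>Averaging over the second argument of \<open>m\<close>; the integers
    \<open>d\<close>, by which \<open>m\<close> misses the cocycle identity, average to
    \<open>\<kappa>\<close>.\<close>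
  define b where "b g x = (\<Sum>t\<in>carrier G. real_of_int (m g t x)) / N" for g x
  define \<kappa> where "\<kappa> g h = (\<Sum>k\<in>carrier G. real_of_int (d g h k)) / N" for g h
  have "b g x + b h (x \<otimes> g) - b (g \<otimes> h) x = of_int (m g h x) + \<kappa> g h"
    if g: "g \<in> carrier G" and h: "h \<in> carrier G" and x: "x \<in> carrier G" for g h x
  proof -
    have bij: "bij_betw (\<lambda>k. h \<otimes> k) (carrier G) (carrier G)"
      by (rule bij_betw_byWitness[where f' = "\<lambda>k. inv h \<otimes> k"])
         (use h in \<open>auto simp: inv_mult_cancel mult_inv_cancel\<close>)
    have "(\<Sum>k\<in>carrier G. real_of_int (m g k x)) = (\<Sum>k\<in>carrier G. real_of_int (m g (h \<otimes> k) x))"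
      using sum.reindex_bij_betw[OF bij, of "\<lambda>k. real_of_int (m g k x)"] by simp
    then have "(\<Sum>k\<in>carrier G. real_of_int (m g k x)) + (\<Sum>k\<in>carrier G. real_of_int (m h k (x \<otimes> g)))
        - (\<Sum>k\<in>carrier G. real_of_int (m (g \<otimes> h) k x)) =
        (\<Sum>k\<in>carrier G. real_of_int (m g (h \<otimes> k) x) + real_of_int (m h k (x \<otimes> g)) - real_of_int (m (g \<otimes> h) k x))"
      by (simp add: sum.distrib sum_subtractf)
    also have "\<dots> = (\<Sum>k\<in>carrier G. real_of_int (m g h x) + real_of_int (d g h k))"
    proof (rule sum.cong[OF refl])
      fix k assume k: "k \<in> carrier G"
      have "m g (h \<otimes> k) x + m h k (x \<otimes> g) - m (g \<otimes> h) k x = m g h x + d g h k"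
        using d[OF g h k x] by linarith
      then show "real_of_int (m g (h \<otimes> k) x) + real_of_int (m h k (x \<otimes> g)) - real_of_int (m (g \<otimes> h) k x) =
          real_of_int (m g h x) + real_of_int (d g h k)"
        by (metis of_int_add of_int_diff)
    qed
    also have "\<dots> = N * real_of_int (m g h x) + (\<Sum>k\<in>carrier G. real_of_int (d g h k))"
      by (simp add: sum.distrib N_def)
    finally show ?thesis unfolding b_def \<kappa>_def
      using N by (simp flip: add_divide_distrib diff_divide_distrib) (simp add: add_divide_distrib)
  qed
  note b = this
  have binv: "inv_fun (b g)" if g: "g \<in> carrier G" for g
    unfolding inv_fun_def b_def using inv_funD[OF m[OF g]] by simp
  have "rep (\<lambda>g x. to_circle (b g x)) c"
    unfolding rep_def rep_lift_def
    by (intro exI[of _ b] exI[of _ m] exI[of _ \<kappa>] conjI ballI refl binv m b c)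
  then show ?thesis by (intro exI[of _ "\<lambda>g x. to_circle (b g x)"])
qed

text \<open>The real lift \<open>b\<close> violates the crossed identity by \<open>e\<close>, which
  is constant in the point modulo integers. After subtracting its value at \<open>\<one>\<close> it
  is an integer-valued cochain, and a cocycle up to constants because the coboundary of
  \<open>e\<close> is zero.\<close>

lemma ex_rep_of_jcoc:
  assumes f: "gcoc f"
  shows "\<exists>c\<in>carrier ZG. rep f c"
proof -
  define b where "b g x = rep_circle (f g x)" for g x
  define e where "e g h x = b g x + b h (x \<otimes> g) - b (g \<otimes> h) x" for g h x
  \<comment> \<open>The floor only serves to turn a real number that is an integer, by
    \<open>em\<close>, into one of type \<open>int\<close>.\<close>
  define m where "m g h x = \<lfloor>e g h x - e g h \<one>\<rfloor>" for g h x
  have fb: "f g x = to_circle (b g x)" for g x by (simp add: b_def)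
  have em: "e g h x = of_int (m g h x) + e g h \<one>"
    if g: "g \<in> carrier G" and h: "h \<in> carrier G" and x: "x \<in> carrier G" for g h x
  proof -
    have "to_circle (e g h z) = f g z + f h (z \<otimes> g) - f (g \<otimes> h) z" for z
      by (simp add: e_def to_circle_add to_circle_diff b_def)
    then have "to_circle (e g h x - e g h \<one>) = 0"
      using jcocD[OF f g h x one_closed] by (simp add: to_circle_diff)
    then have "e g h x - e g h \<one> \<in> \<int>" by (simp add: to_circle_eq_0_iff)
    then obtain n where n: "e g h x - e g h \<one> = of_int n" by (elim Ints_cases)
    then have "m g h x = n" by (simp add: m_def)
    with n show ?thesis by simp
  qed
  have binv: "inv_fun (b g)" if "g \<in> carrier G" for g
    using jcoc_inv[OF f that] by (simp add: inv_fun_def b_def)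
  have einv: "e g h (k \<otimes> x) = e g h x" if "g \<in> carrier G" "h \<in> carrier G" "k \<in> H" "x \<in> carrier G" for g h k x
    using that inv_funD[OF binv] by (simp add: e_def m_assoc H_carrier)
  have m: "inv_fun (m g h)" if "g \<in> carrier G" "h \<in> carrier G" for g h
    using einv that by (simp add: inv_fun_def m_def)
  then have m0: "\<forall>g\<in>carrier G. \<forall>h\<in>carrier G. inv_fun (m g h)" by (intro ballI)
  have "cochain2 (carrier G) m \<in> carrier ZG"
    unfolding mem_Z2_iff[OF subgroup_self m0]
  proof (intro ballI)
    fix g h k assume g: "g \<in> carrier G" and h: "h \<in> carrier G" and k: "k \<in> carrier G"
    define C where "C = - e h k \<one> + e (g \<otimes> h) k \<one> - e g (h \<otimes> k) \<one> + e g h \<one>"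
    have *: "real_of_int (m h k (x \<otimes> g) - m (g \<otimes> h) k x + m g (h \<otimes> k) x - m g h x) = C"
      if x: "x \<in> carrier G" for x
    proof -
      have "e h k (x \<otimes> g) - e (g \<otimes> h) k x + e g (h \<otimes> k) x - e g h x = 0"
        using g h k x by (simp add: e_def m_assoc)
      then show ?thesis
        using em[of h k "x \<otimes> g"] em[of "g \<otimes> h" k x] em[of g "h \<otimes> k" x] em[of g h x] g h k x
        by (simp add: C_def)
    qed
    show "\<exists>c. \<forall>x\<in>carrier G. m h k (x \<otimes> g) - m (g \<otimes> h) k x + m g (h \<otimes> k) x - m g h x = c"
    proof (intro exI ballI)
      fix x assume x: "x \<in> carrier G"
      have "real_of_int (m h k (x \<otimes> g) - m (g \<otimes> h) k x + m g (h \<otimes> k) x - m g h x) = real_of_int \<lfloor>C\<rfloor>"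
        using *[OF x] by (metis floor_of_int)
      then show "m h k (x \<otimes> g) - m (g \<otimes> h) k x + m g (h \<otimes> k) x - m g h x = \<lfloor>C\<rfloor>"
        unfolding of_int_eq_iff .
    qed
  qed
  moreover have "b g x + b h (x \<otimes> g) - b (g \<otimes> h) x = of_int (m g h x) + e g h \<one>"
    if "g \<in> carrier G" "h \<in> carrier G" "x \<in> carrier G" for g h x
    using em[OF that] by (simp add: e_def)
  then have "rep f (cochain2 (carrier G) m)"
    unfolding rep_def rep_lift_def
    by (intro exI[of _ b] exI[of _ m] exI[of _ "\<lambda>g h. e g h \<one>"] conjI ballI refl binv m fb)
  ultimately show ?thesis by (intro bexI)
qed

lemma rep_mult:
  assumes "rep f c" "rep f' c'"
  shows "rep (\<lambda>g x. f g x + f' g x) (c \<otimes>\<^bsub>ZG\<^esub> c')"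
proof -
  obtain b m \<kappa> where b0: "rep_lift f b m \<kappa>" "c = cochain2 (carrier G) m"
    using assms(1) unfolding rep_def by (elim exE conjE)
  note b = rep_liftD[OF b0(1)] b0(2)
  obtain b' m' \<kappa>' where b'0: "rep_lift f' b' m' \<kappa>'" "c' = cochain2 (carrier G) m'"
    using assms(2) unfolding rep_def by (elim exE conjE)
  note b' = rep_liftD[OF b'0(1)] b'0(2)
  have c: "c \<otimes>\<^bsub>ZG\<^esub> c' = cochain2 (carrier G) (\<lambda>g h x. m g h x + m' g h x)"
    using cochain2_mult[of "carrier G"] by (simp add: b(5) b'(5) cocycles2_def)
  have 1: "inv_fun (\<lambda>x. b g x + b' g x)" if "g \<in> carrier G" for g
    using b(1)[OF that] b'(1)[OF that] by (simp add: inv_fun_def)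
  have 2: "inv_fun (\<lambda>x. m g h x + m' g h x)" if "g \<in> carrier G" "h \<in> carrier G" for g h
    by (rule inv_fun_add[OF b(2)[OF that] b'(2)[OF that]])
  have 3: "f g x + f' g x = to_circle (b g x + b' g x)" if "g \<in> carrier G" "x \<in> carrier G" for g x
    using b(3)[OF that] b'(3)[OF that] by (simp add: to_circle_add)
  have 4: "b g x + b' g x + (b h (x \<otimes> g) + b' h (x \<otimes> g)) - (b (g \<otimes> h) x + b' (g \<otimes> h) x) =
      of_int (m g h x + m' g h x) + (\<kappa> g h + \<kappa>' g h)"
    if "g \<in> carrier G" "h \<in> carrier G" "x \<in> carrier G" for g h x
    using b(4)[OF that] b'(4)[OF that] by simp
  show ?thesis
    unfolding rep_def rep_lift_def c
    by (intro exI[of _ "\<lambda>g x. b g x + b' g x"] exI[of _ "\<lambda>g h x. m g h x + m' g h x"]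
        exI[of _ "\<lambda>g h. \<kappa> g h + \<kappa>' g h"] conjI ballI refl 1 2 3 4)
qed

text \<open>This is injectivity and well-definedness of the connecting map over \<open>D\<close>. If
  \<open>m\<close> is the coboundary of integers \<open>i\<close>, then \<open>b - i\<close> is a
  real cocycle modulo constants and is trivialized by averaging over \<open>D\<close>; conversely, a
  trivialization of \<open>f\<close> lifts to the reals and differs from \<open>b\<close> by
  integers, whose coboundary is \<open>m\<close> up to constants.\<close>

lemma rep_restrict_mem_B2_iff:
  assumes "rep f c" and D: "subgroup D G"
  shows "restrict c (D \<times> D) \<in> B2 D \<longleftrightarrow> jtriv D f"
proof -
  interpret D: subgroup D G by (rule D)
  obtain b m \<kappa> where b0: "rep_lift f b m \<kappa>" "c = cochain2 (carrier G) m"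
    using assms(1) unfolding rep_def by (elim exE conjE)
  note b = rep_liftD[OF b0(1)] b0(2)
  have Dc: "g \<in> carrier G" if "g \<in> D" for g using that by simp
  have "restrict c (D \<times> D) = cochain2 D m" unfolding b(5) by (rule restrict_cochain2[OF D.subset])
  then have "restrict c (D \<times> D) \<in> B2 D \<longleftrightarrow> (\<exists>i. (\<forall>g\<in>D. inv_fun (i g)) \<and>
    (\<forall>g\<in>D. \<forall>h\<in>D. \<exists>c. \<forall>x\<in>carrier G. m g h x = i h (x \<otimes> g) - i (g \<otimes> h) x + i g x + c))"
    by (simp add: cochain2_mem_B2_iff[OF D])
  also have "\<dots> \<longleftrightarrow> jtriv D f"
  proof
    assume "\<exists>i. (\<forall>g\<in>D. inv_fun (i g)) \<and>
      (\<forall>g\<in>D. \<forall>h\<in>D. \<exists>c. \<forall>x\<in>carrier G. m g h x = i h (x \<otimes> g) - i (g \<otimes> h) x + i g x + c)"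
    then obtain i where i: "\<forall>g\<in>D. inv_fun (i g)"
      "\<forall>g\<in>D. \<forall>h\<in>D. \<exists>c. \<forall>x\<in>carrier G. m g h x = i h (x \<otimes> g) - i (g \<otimes> h) x + i g x + c"
      by (elim exE conjE)
    from i(2) obtain c where c: "\<And>g h x. g \<in> D \<Longrightarrow> h \<in> D \<Longrightarrow> x \<in> carrier G \<Longrightarrow>
        m g h x = i h (x \<otimes> g) - i (g \<otimes> h) x + i g x + c g h" by metis
    define e where "e g x = b g x - real_of_int (i g x)" for g x
    define k where "k g h = \<kappa> g h + real_of_int (c g h)" for g h
    have e: "e g x + e h (x \<otimes> g) - e (g \<otimes> h) x = k g h"
      if "g \<in> D" "h \<in> D" "x \<in> carrier G" for g h x
      using b(4)[OF Dc[OF that(1)] Dc[OF that(2)] that(3)] c[OF that] by (simp add: e_def k_def)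
    have finD: "finite D" using finite_subset[OF D.subset finite_carrier] .
    define N where "N = real (card D)"
    have N: "N > 0" unfolding N_def using finD D.one_closed by (metis card_gt_0_iff empty_iff of_nat_0_less_iff)
    \<comment> \<open>The negative mean of \<open>e\<close> over \<open>D\<close> is the usual
      trivialization of a real-valued cocycle of a finite group.\<close>
    define U where "U x = - (\<Sum>h\<in>D. e h x) / N" for x
    define y where "y g = (\<Sum>h\<in>D. k g h) / N" for g
    have eU: "e g x = U (x \<otimes> g) - U x + y g" if g: "g \<in> D" and x: "x \<in> carrier G" for g x
    proof -
      have bij: "bij_betw (\<lambda>h. g \<otimes> h) D D"
        by (rule bij_betw_byWitness[where f' = "\<lambda>h. inv g \<otimes> h"])
           (use g Dc in \<open>auto simp: inv_mult_cancel mult_inv_cancel\<close>)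
      have "(\<Sum>h\<in>D. k g h) = (\<Sum>h\<in>D. e g x + e h (x \<otimes> g) - e (g \<otimes> h) x)"
        by (rule sum.cong[OF refl]) (use e[OF g _ x] in simp)
      also have "\<dots> = N * e g x + (\<Sum>h\<in>D. e h (x \<otimes> g)) - (\<Sum>h\<in>D. e (g \<otimes> h) x)"
        by (simp add: sum.distrib sum_subtractf N_def)
      also have "(\<Sum>h\<in>D. e (g \<otimes> h) x) = (\<Sum>h\<in>D. e h x)"
        using sum.reindex_bij_betw[OF bij, of "\<lambda>h. e h x"] .
      finally show ?thesis using N by (simp add: U_def y_def field_simps)
    qed
    have fU: "f g x = to_circle (U (x \<otimes> g)) - to_circle (U x) + to_circle (y g)"
      if g: "g \<in> D" and x: "x \<in> carrier G" for g x
    proof -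
      have "to_circle (b g x) = to_circle (e g x + real_of_int (i g x))" by (simp add: e_def)
      also have "\<dots> = to_circle (e g x)"
        by (simp add: to_circle_add to_circle_eq_0_iff)
      also have "\<dots> = to_circle (U (x \<otimes> g)) - to_circle (U x) + to_circle (y g)"
        unfolding eU[OF g x] to_circle_add to_circle_diff ..
      finally show ?thesis using b(3)[OF Dc[OF g] x] by simp
    qed
    have einv: "e g (h \<otimes> x) = e g x" if "g \<in> D" "h \<in> H" "x \<in> carrier G" for g h x
      using that inv_funD[OF b(1)[OF Dc[OF that(1)]]] i(1) by (simp add: e_def inv_fun_def)
    have "inv_fun (\<lambda>x. to_circle (U x))"
      unfolding inv_fun_def U_def using einv by simp
    then show "jtriv D f"
      unfolding jtriv_def
      by (intro exI[of _ "\<lambda>x. to_circle (U x)"] exI[of _ "\<lambda>g. to_circle (y g)"] conjI ballI fU)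
  next
    assume "jtriv D f"
    then obtain u y where u: "inv_fun u"
        "\<forall>g\<in>D. \<forall>x\<in>carrier G. f g x = u (x \<otimes> g) - u x + y g"
      unfolding jtriv_def by (elim exE conjE)
    define U where "U x = rep_circle (u x)" for x
    \<comment> \<open>The lift \<open>b\<close> minus the lifted trivialization reduces to zero in
      the circle, so it is integral.\<close>
    define w where "w g x = b g x - (U (x \<otimes> g) - U x + rep_circle (y g))" for g x
    define i where "i g x = \<lfloor>w g x\<rfloor>" for g x
    have wi: "w g x = of_int (i g x)" if g: "g \<in> D" and x: "x \<in> carrier G" for g x
    proof -
      have "to_circle (w g x) = f g x - (u (x \<otimes> g) - u x + y g)"
        using b(3)[OF Dc[OF g] x] by (simp add: w_def U_def to_circle_add to_circle_diff)
      then have "w g x \<in> \<int>" using u(2) g x by (simp add: to_circle_eq_0_iff[symmetric])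
      then obtain n where n: "w g x = of_int n" by (elim Ints_cases)
      then show ?thesis by (simp add: i_def)
    qed
    have iinv: "inv_fun (i g)" if g: "g \<in> D" for g
      unfolding inv_fun_def
    proof (intro ballI)
      fix h x assume "h \<in> H" "x \<in> carrier G"
      then have "w g (h \<otimes> x) = w g x"
        using inv_funD[OF b(1)[OF Dc[OF g]]] inv_funD[OF u(1)] Dc[OF g]
        by (simp add: w_def U_def m_assoc H_carrier)
      then show "i g (h \<otimes> x) = i g x" by (simp add: i_def)
    qed
    have "\<exists>c. \<forall>x\<in>carrier G. m g h x = i h (x \<otimes> g) - i (g \<otimes> h) x + i g x + c"
      if g: "g \<in> D" and h: "h \<in> D" for g h
    proof -
      define C where "C = rep_circle (y g) + rep_circle (y h) - rep_circle (y (g \<otimes> h)) - \<kappa> g h"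
      have *: "real_of_int (m g h x - (i h (x \<otimes> g) - i (g \<otimes> h) x + i g x)) = C"
        if x: "x \<in> carrier G" for x
      proof -
        have "real_of_int (m g h x) = b g x + b h (x \<otimes> g) - b (g \<otimes> h) x - \<kappa> g h"
          using b(4)[OF Dc[OF g] Dc[OF h] x] by simp
        moreover have "b g' z = of_int (i g' z) + (U (z \<otimes> g') - U z + rep_circle (y g'))"
          if "g' \<in> D" "z \<in> carrier G" for g' z
          using wi[OF that] by (simp add: w_def)
        ultimately show ?thesis
          using g h x Dc by (simp add: C_def m_assoc)
      qed
      have "m g h x = i h (x \<otimes> g) - i (g \<otimes> h) x + i g x + \<lfloor>C\<rfloor>" if x: "x \<in> carrier G" for x
      proof -
        have "m g h x - (i h (x \<otimes> g) - i (g \<otimes> h) x + i g x) = \<lfloor>C\<rfloor>"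
          using *[OF x] by (metis floor_of_int)
        then show ?thesis by linarith
      qed
      then show ?thesis by (intro exI[of _ "\<lfloor>C\<rfloor>"] ballI)
    qed
    then show "\<exists>i. (\<forall>g\<in>D. inv_fun (i g)) \<and>
      (\<forall>g\<in>D. \<forall>h\<in>D. \<exists>c. \<forall>x\<in>carrier G. m g h x = i h (x \<otimes> g) - i (g \<otimes> h) x + i g x + c)"
      by (intro exI[of _ i] conjI ballI iinv)
  qed
  finally show ?thesis .
qed

section \<open>Second cohomology and restriction to subgroups\<close>

lemma Z2_elim:
  assumes D: "subgroup D G" and "c \<in> carrier (Z2 D)"
  obtains m where "c = cochain2 D m" "\<forall>g\<in>D. \<forall>h\<in>D. inv_fun (m g h)"
    "cocycle_cond D m"
proof -
  have "c \<in> carrier (cochains2 (G\<lparr>carrier := D\<rparr>) J)"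
    using assms(2) by (simp add: cocycles2_def kernel_def)
  then obtain m where c: "c = cochain2 D m"
      and m: "\<forall>g\<in>D. \<forall>h\<in>D. inv_fun (m g h)"
    unfolding carrier_cochains2 by (elim CollectE exE conjE)
  show thesis
    by (rule that[OF c m]) (use assms(2) in \<open>simp only: c mem_Z2_iff[OF D m]\<close>)
qed

lemma Z2_mult: "cochain2 D m \<otimes>\<^bsub>Z2 D\<^esub> cochain2 D m' = cochain2 D (\<lambda>g h x. m g h x + m' g h x)"
  using cochain2_mult by (simp add: cocycles2_def)

lemma Z2_one: "\<one>\<^bsub>Z2 D\<^esub> = cochain2 D (\<lambda>g h x. 0)"
  by (simp add: cocycles2_def cochains2_def cochain2_def cls_one split_def)

lemma Z2_add_closed:
  assumes D: "subgroup D G" and "c \<in> carrier (Z2 D)" "c' \<in> carrier (Z2 D)"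
  shows "c \<otimes>\<^bsub>Z2 D\<^esub> c' \<in> carrier (Z2 D)"
proof -
  obtain m where m: "c = cochain2 D m" "\<forall>g\<in>D. \<forall>h\<in>D. inv_fun (m g h)"
    "cocycle_cond D m"
    by (rule Z2_elim[OF D assms(2)])
  obtain m' where m': "c' = cochain2 D m'" "\<forall>g\<in>D. \<forall>h\<in>D. inv_fun (m' g h)"
    "cocycle_cond D m'"
    by (rule Z2_elim[OF D assms(3)])
  have mm: "\<forall>g\<in>D. \<forall>h\<in>D. inv_fun (\<lambda>x. m g h x + m' g h x)"
    using m(2) m'(2) by (simp add: inv_fun_def)
  show ?thesis
    unfolding m(1) m'(1) Z2_mult mem_Z2_iff[OF D mm]
  proof (intro ballI)
    fix g h k assume *: "g \<in> D" "h \<in> D" "k \<in> D"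
    obtain c where c: "\<forall>x\<in>carrier G. m h k (x \<otimes> g) - m (g \<otimes> h) k x + m g (h \<otimes> k) x - m g h x = c"
      using m(3) * by blast
    obtain c' where c': "\<forall>x\<in>carrier G. m' h k (x \<otimes> g) - m' (g \<otimes> h) k x + m' g (h \<otimes> k) x - m' g h x = c'"
      using m'(3) * by blast
    show "\<exists>c. \<forall>x\<in>carrier G. m h k (x \<otimes> g) + m' h k (x \<otimes> g) - (m (g \<otimes> h) k x + m' (g \<otimes> h) k x) +
        (m g (h \<otimes> k) x + m' g (h \<otimes> k) x) - (m g h x + m' g h x) = c"
    proof (intro exI ballI)
      fix x assume x: "x \<in> carrier G"
      show "m h k (x \<otimes> g) + m' h k (x \<otimes> g) - (m (g \<otimes> h) k x + m' (g \<otimes> h) k x) +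
        (m g (h \<otimes> k) x + m' g (h \<otimes> k) x) - (m g h x + m' g h x) = c + c'"
        using bspec[OF c x] bspec[OF c' x] by linarith
    qed
  qed
qed

lemma comm_group_Z2:
  assumes D: "subgroup D G"
  shows "comm_group (Z2 D)"
proof (rule comm_groupI)
  show "\<And>x y. x \<in> carrier (Z2 D) \<Longrightarrow> y \<in> carrier (Z2 D) \<Longrightarrow> x \<otimes>\<^bsub>Z2 D\<^esub> y \<in> carrier (Z2 D)"
    by (rule Z2_add_closed[OF D])
next
  have z: "\<forall>g\<in>D. \<forall>h\<in>D. inv_fun (\<lambda>x. 0 :: int)" by (simp add: inv_fun_const)
  show "\<one>\<^bsub>Z2 D\<^esub> \<in> carrier (Z2 D)"
    unfolding Z2_one mem_Z2_iff[OF D z] by simp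
next
  fix x y z assume "x \<in> carrier (Z2 D)" "y \<in> carrier (Z2 D)" "z \<in> carrier (Z2 D)"
  then show "x \<otimes>\<^bsub>Z2 D\<^esub> y \<otimes>\<^bsub>Z2 D\<^esub> z = x \<otimes>\<^bsub>Z2 D\<^esub> (y \<otimes>\<^bsub>Z2 D\<^esub> z)"
    by (elim Z2_elim[OF D]) (simp add: Z2_mult add.assoc)
next
  fix x y assume "x \<in> carrier (Z2 D)" "y \<in> carrier (Z2 D)"
  then show "x \<otimes>\<^bsub>Z2 D\<^esub> y = y \<otimes>\<^bsub>Z2 D\<^esub> x"
    by (elim Z2_elim[OF D]) (simp add: Z2_mult add.commute)
next
  fix x assume "x \<in> carrier (Z2 D)"
  then show "\<one>\<^bsub>Z2 D\<^esub> \<otimes>\<^bsub>Z2 D\<^esub> x = x"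
    by (elim Z2_elim[OF D]) (simp add: Z2_mult Z2_one)
next
  fix x assume "x \<in> carrier (Z2 D)"
  then obtain m where m: "x = cochain2 D m" "\<forall>g\<in>D. \<forall>h\<in>D. inv_fun (m g h)"
    "cocycle_cond D m"
    by (rule Z2_elim[OF D])
  have mm: "\<forall>g\<in>D. \<forall>h\<in>D. inv_fun (\<lambda>x. - m g h x)"
    using m(2) by (simp add: inv_fun_def)
  have "cochain2 D (\<lambda>g h x. - m g h x) \<in> carrier (Z2 D)"
    unfolding mem_Z2_iff[OF D mm]
  proof (intro ballI)
    fix g h k assume *: "g \<in> D" "h \<in> D" "k \<in> D"
    obtain c where c: "\<forall>x\<in>carrier G. m h k (x \<otimes> g) - m (g \<otimes> h) k x + m g (h \<otimes> k) x - m g h x = c"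
      using m(3) * by blast
    show "\<exists>c. \<forall>x\<in>carrier G. - m h k (x \<otimes> g) - - m (g \<otimes> h) k x + - m g (h \<otimes> k) x - - m g h x = c"
    proof (intro exI ballI)
      fix x assume x: "x \<in> carrier G"
      show "- m h k (x \<otimes> g) - - m (g \<otimes> h) k x + - m g (h \<otimes> k) x - - m g h x = - c"
        using bspec[OF c x] by linarith
    qed
  qed
  moreover have "cochain2 D (\<lambda>g h x. - m g h x) \<otimes>\<^bsub>Z2 D\<^esub> x = \<one>\<^bsub>Z2 D\<^esub>"
    by (simp add: m(1) Z2_mult Z2_one)
  ultimately show "\<exists>y\<in>carrier (Z2 D). y \<otimes>\<^bsub>Z2 D\<^esub> x = \<one>\<^bsub>Z2 D\<^esub>" by (intro bexI)
qed

lemma subgroup_B2: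
  assumes D: "subgroup D G"
  shows "subgroup (B2 D) (Z2 D)"
proof -
  interpret D: subgroup D G by (rule D)
  interpret Z: comm_group "Z2 D" by (rule comm_group_Z2[OF D])
  define cb where "cb i = (\<lambda>g h x. i h (x \<otimes> g) - i (g \<otimes> h) x + i g x)" for i :: "'a \<Rightarrow> 'a \<Rightarrow> int"
  have B: "B2 D = {cochain2 D (cb i) |i. \<forall>g\<in>D. inv_fun (i g)}"
    unfolding B2_eq[OF D] cb_def ..
  have cbZ: "cochain2 D (cb i) \<in> carrier (Z2 D)" if i: "\<forall>g\<in>D. inv_fun (i g)" for i
  proof -
    have m: "\<forall>g\<in>D. \<forall>h\<in>D. inv_fun (cb i g h)"
      using i by (simp add: inv_fun_def cb_def m_assoc H_carrier)
    show ?thesis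
      unfolding mem_Z2_iff[OF D m] by (auto simp: cb_def m_assoc)
  qed
  have cbB: "cochain2 D (cb i) \<in> B2 D" if "\<forall>g\<in>D. inv_fun (i g)" for i
    unfolding B by (intro CollectI exI[of _ i] conjI refl that)
  have elim: "\<exists>i. c = cochain2 D (cb i) \<and> (\<forall>g\<in>D. inv_fun (i g))" if "c \<in> B2 D" for c
    using that unfolding B by (elim CollectE)
  have cb_add: "cochain2 D (cb i) \<otimes>\<^bsub>Z2 D\<^esub> cochain2 D (cb i') = cochain2 D (cb (\<lambda>g x. i g x + i' g x))" for i i'
    unfolding Z2_mult cochain2_eq_iff by (intro ballI cls_cong) (simp add: cb_def)
  show ?thesis
  proof (rule Z.subgroupI)
    show "B2 D \<subseteq> carrier (Z2 D)"
    proof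
      fix c assume "c \<in> B2 D"
      then obtain i where "c = cochain2 D (cb i)" "\<forall>g\<in>D. inv_fun (i g)" using elim by metis
      then show "c \<in> carrier (Z2 D)" using cbZ by simp
    qed
    have "cochain2 D (cb (\<lambda>g x. 0)) \<in> B2 D" by (rule cbB) (simp add: inv_fun_const)
    then show "B2 D \<noteq> {}" by blast
  next
    fix c assume "c \<in> B2 D"
    then obtain i where i: "c = cochain2 D (cb i)" "\<forall>g\<in>D. inv_fun (i g)" using elim by metis
    have i': "\<forall>g\<in>D. inv_fun (\<lambda>x. - i g x)" using i(2) by (simp add: inv_fun_def)
    have "cochain2 D (cb (\<lambda>g x. - i g x)) \<otimes>\<^bsub>Z2 D\<^esub> c = \<one>\<^bsub>Z2 D\<^esub>"
      unfolding i(1) cb_add Z2_one by (simp add: cb_def)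
    then have "inv\<^bsub>Z2 D\<^esub> c = cochain2 D (cb (\<lambda>g x. - i g x))"
      using cbZ[OF i(2)] cbZ[OF i'] i(1) by (intro Z.inv_equality) simp_all
    then show "inv\<^bsub>Z2 D\<^esub> c \<in> B2 D" using cbB[OF i'] by simp
  next
    fix c c' assume "c \<in> B2 D" "c' \<in> B2 D"
    then obtain i i' where i: "c = cochain2 D (cb i)" "\<forall>g\<in>D. inv_fun (i g)"
      and i': "c' = cochain2 D (cb i')" "\<forall>g\<in>D. inv_fun (i' g)" using elim by metis
    show "c \<otimes>\<^bsub>Z2 D\<^esub> c' \<in> B2 D"
      unfolding i(1) i'(1) cb_add by (rule cbB) (use i(2) i'(2) in \<open>simp add: inv_fun_def\<close>)
  qed
qed

lemma normal_B2: "subgroup D G \<Longrightarrow> B2 D \<lhd> Z2 D"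
  using comm_group.subgroup_imp_normal[OF comm_group_Z2 subgroup_B2] .

lemma group_H2: "group (H2 G J (J_act G))"
  using normal.factorgroup_is_group[OF normal_B2[OF subgroup_self]] by (simp add: H2_def)

lemma restrict_Z2:
  assumes D: "subgroup D G" and "c \<in> carrier ZG"
  shows "restrict c (D \<times> D) \<in> carrier (Z2 D)"
proof -
  interpret D: subgroup D G by (rule D)
  obtain m where m: "c = cochain2 (carrier G) m" "\<forall>g\<in>carrier G. \<forall>h\<in>carrier G. inv_fun (m g h)"
    "cocycle_cond (carrier G) m"
    by (rule Z2_elim[OF subgroup_self assms(2)])
  have mm: "\<forall>g\<in>D. \<forall>h\<in>D. inv_fun (m g h)" using m(2) by simp
  show ?thesis
    unfolding m(1) restrict_cochain2[OF D.subset] mem_Z2_iff[OF D mm] using m(3) by simp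
qed

lemma restrict_mult:
  assumes D: "subgroup D G" and "c \<in> carrier ZG" "c' \<in> carrier ZG"
  shows "restrict (c \<otimes>\<^bsub>ZG\<^esub> c') (D \<times> D) =
    restrict c (D \<times> D) \<otimes>\<^bsub>Z2 D\<^esub> restrict c' (D \<times> D)"
proof -
  interpret D: subgroup D G by (rule D)
  show ?thesis
    using assms(2,3)
    by (elim Z2_elim[OF subgroup_self]) (simp only: Z2_mult restrict_cochain2[OF D.subset])
qed

lemma restrict_B2:
  assumes D: "subgroup D G" and "c \<in> BG"
  shows "restrict c (D \<times> D) \<in> B2 D"
proof -
  interpret D: subgroup D G by (rule D)
  obtain i where i: "c = cochain2 (carrier G) (\<lambda>g h x. i h (x \<otimes> g) - i (g \<otimes> h) x + i g x)"
      "\<forall>g\<in>carrier G. inv_fun (i g)"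
    using assms(2) unfolding B2_eq[OF subgroup_self] by (elim CollectE exE conjE)
  have i': "\<forall>g\<in>D. inv_fun (i g)" using i(2) by simp
  show ?thesis
    unfolding i(1) restrict_cochain2[OF D.subset] B2_eq[OF D]
    by (intro CollectI exI[of _ i] conjI refl i')
qed

abbreviation HD where "HD D \<equiv> H2 (G\<lparr>carrier := D\<rparr>) J (J_act G)"
abbreviation resD where "resD \<equiv> res2 G J (J_act G)"

text \<open>Restriction is defined through \<open>the_elem\<close> of an image, which has to be a
  singleton: members of a class differ by coboundaries, and these restrict to coboundaries.\<close>

lemma res2_coset:
  assumes D: "subgroup D G" and c: "c \<in> carrier ZG"
  shows "resD D (BG #>\<^bsub>ZG\<^esub> c) =
    B2 D #>\<^bsub>Z2 D\<^esub> restrict c (D \<times> D)"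
proof -
  interpret Z: comm_group "Z2 D" by (rule comm_group_Z2[OF D])
  interpret ZG: comm_group ZG by (rule comm_group_Z2[OF subgroup_self])
  interpret B: subgroup "B2 D" "Z2 D" by (rule subgroup_B2[OF D])
  interpret BG: subgroup BG ZG by (rule subgroup_B2[OF subgroup_self])
  have "B2 D #>\<^bsub>Z2 D\<^esub> restrict c' (D \<times> D) = B2 D #>\<^bsub>Z2 D\<^esub> restrict c (D \<times> D)"
    if c': "c' \<in> BG #>\<^bsub>ZG\<^esub> c" for c'
  proof -
    obtain \<beta> where \<beta>: "\<beta> \<in> BG" "c' = \<beta> \<otimes>\<^bsub>ZG\<^esub> c"
      using c' unfolding r_coset_def by blast
    have r\<beta>: "restrict \<beta> (D \<times> D) \<in> B2 D" by (rule restrict_B2[OF D \<beta>(1)])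
    have "restrict c' (D \<times> D) = restrict \<beta> (D \<times> D) \<otimes>\<^bsub>Z2 D\<^esub> restrict c (D \<times> D)"
      unfolding \<beta>(2) by (rule restrict_mult[OF D BG.mem_carrier[OF \<beta>(1)] c])
    then show ?thesis
      using Z.coset_mult_assoc[OF B.subset B.mem_carrier[OF r\<beta>] restrict_Z2[OF D c]]
        Z.coset_join2[OF B.mem_carrier[OF r\<beta>] B.subgroup_axioms r\<beta>] by simp
  qed
  then have "(\<lambda>c. B2 D #>\<^bsub>Z2 D\<^esub> restrict c (D \<times> D)) ` (BG #>\<^bsub>ZG\<^esub> c) =
      (\<lambda>_. B2 D #>\<^bsub>Z2 D\<^esub> restrict c (D \<times> D)) ` (BG #>\<^bsub>ZG\<^esub> c)"
    by (intro image_cong refl)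
  moreover have "BG #>\<^bsub>ZG\<^esub> c \<noteq> {}"
    using ZG.rcos_self[OF c BG.subgroup_axioms] by blast
  ultimately have "(\<lambda>c. B2 D #>\<^bsub>Z2 D\<^esub> restrict c (D \<times> D)) ` (BG #>\<^bsub>ZG\<^esub> c) =
      {B2 D #>\<^bsub>Z2 D\<^esub> restrict c (D \<times> D)}"
    by (simp only: image_constant_conv if_False)
  then show ?thesis by (simp only: res2_def the_elem_eq)
qed

definition represents :: "('a \<Rightarrow> 'a \<Rightarrow> circle) \<Rightarrow> ('a \<times> 'a \<Rightarrow> ('a \<Rightarrow> int) set) set \<Rightarrow> bool" where
  "represents f \<xi> \<longleftrightarrow> (\<exists>c\<in>carrier ZG.
     \<xi> = BG #>\<^bsub>ZG\<^esub> c \<and> rep f c)"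

abbreviation HH where "HH \<equiv> H2 G J (J_act G)"

lemma HH_eq: "HH = ZG Mod BG"
  by (simp add: H2_def)

lemma represents_closed: "represents f \<xi> \<Longrightarrow> \<xi> \<in> carrier HH"
  unfolding HH_eq represents_def by (auto simp: FactGroup_def RCOSETS_def)

lemma represents_jcoc: "represents f \<xi> \<Longrightarrow> gcoc f"
  unfolding represents_def using rep_jcoc by blast

lemma ex_represents:
  assumes "\<xi> \<in> carrier HH"
  obtains f where "represents f \<xi>"
proof -
  obtain c where c: "c \<in> carrier ZG" "\<xi> = BG #>\<^bsub>ZG\<^esub> c"
    using assms unfolding HH_eq by (auto simp: FactGroup_def RCOSETS_def)
  obtain f where f: "rep f c" using ex_rep_of_cocycle[OF c(1)] by (elim exE)
  show thesis
    by (rule that[of f]) (unfold represents_def, intro bexI[of _ c] conjI c f)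
qed

lemma ex_represented:
  assumes "gcoc f"
  obtains \<xi> where "represents f \<xi>"
proof -
  obtain c where c: "c \<in> carrier ZG" "rep f c"
    using ex_rep_of_jcoc[OF assms] by (elim bexE)
  show thesis
    by (rule that[of "BG #>\<^bsub>ZG\<^esub> c"])
       (unfold represents_def, intro bexI[of _ c] conjI c refl)
qed

lemma represents_mult:
  assumes "represents f \<xi>" "represents f' \<xi>'"
  shows "represents (\<lambda>g x. f g x + f' g x) (\<xi> \<otimes>\<^bsub>HH\<^esub> \<xi>')"
proof -
  interpret ZG: comm_group ZG by (rule comm_group_Z2[OF subgroup_self])
  interpret BG: normal BG ZG by (rule normal_B2[OF subgroup_self])
  obtain c where c: "c \<in> carrier ZG"
      "\<xi> = BG #>\<^bsub>ZG\<^esub> c" "rep f c"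
    using assms(1) unfolding represents_def by (elim bexE conjE)
  obtain c' where c': "c' \<in> carrier ZG"
      "\<xi>' = BG #>\<^bsub>ZG\<^esub> c'" "rep f' c'"
    using assms(2) unfolding represents_def by (elim bexE conjE)
  have "\<xi> \<otimes>\<^bsub>HH\<^esub> \<xi>' = BG #>\<^bsub>ZG\<^esub> (c \<otimes>\<^bsub>ZG\<^esub> c')"
    unfolding HH_eq mult_FactGroup c(2) c'(2) by (rule BG.rcos_sum[OF c(1) c'(1)])
  then show ?thesis
    unfolding represents_def
    by (intro bexI[of _ "c \<otimes>\<^bsub>ZG\<^esub> c'"] conjI rep_mult c(3) c'(3)
        ZG.m_closed[OF c(1) c'(1)])
qed

lemma represents_one: "represents (\<lambda>g x. 0) \<one>\<^bsub>HH\<^esub>"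
proof -
  interpret ZG: comm_group ZG by (rule comm_group_Z2[OF subgroup_self])
  have "\<one>\<^bsub>HH\<^esub> = BG #>\<^bsub>ZG\<^esub> \<one>\<^bsub>ZG\<^esub>"
    unfolding HH_eq using ZG.coset_mult_one[OF subgroup.subset[OF subgroup_B2[OF subgroup_self]]]
    by (simp add: FactGroup_def)
  moreover have "rep (\<lambda>g x. 0) \<one>\<^bsub>ZG\<^esub>"
    unfolding rep_def rep_lift_def Z2_one
    by (intro exI[of _ "\<lambda>g x. 0"] exI[of _ "\<lambda>g h x. 0"] exI[of _ "\<lambda>g h. 0"])
       (simp add: inv_fun_const to_circle_eq_0_iff[THEN iffD2])
  ultimately show ?thesis
    unfolding represents_def by (intro bexI[OF _ ZG.one_closed] conjI)
qed

lemma represents_pow: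
  assumes "represents f \<xi>"
  shows "represents (\<lambda>g x. nmul n (f g x)) (\<xi> [^]\<^bsub>HH\<^esub> n)"
proof (induction n)
  case 0
  then show ?case using represents_one by simp
next
  case (Suc n)
  interpret HH: group HH by (rule group_H2)
  from represents_mult[OF Suc assms] show ?case by (simp add: add.commute)
qed

lemma represents_res2:
  assumes "represents f \<xi>" and D: "subgroup D G"
  shows "resD D \<xi> = \<one>\<^bsub>HD D\<^esub> \<longleftrightarrow> jtriv D f"
proof -
  interpret Z: comm_group "Z2 D" by (rule comm_group_Z2[OF D])
  obtain c where c: "c \<in> carrier ZG"
      "\<xi> = BG #>\<^bsub>ZG\<^esub> c" "rep f c"
    using assms(1) unfolding represents_def by (elim bexE conjE)
  have "resD D \<xi> = \<one>\<^bsub>HD D\<^esub> \<longleftrightarrow>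
      B2 D #>\<^bsub>Z2 D\<^esub> restrict c (D \<times> D) = B2 D"
    unfolding c(2) res2_coset[OF D c(1)] by (simp add: H2_def FactGroup_def)
  also have "\<dots> \<longleftrightarrow> restrict c (D \<times> D) \<in> B2 D"
    using Z.coset_join1[OF _ restrict_Z2[OF D c(1)] subgroup_B2[OF D]]
      Z.coset_join2[OF restrict_Z2[OF D c(1)] subgroup_B2[OF D]] by blast
  also have "\<dots> \<longleftrightarrow> jtriv D f" by (rule rep_restrict_mem_B2_iff[OF c(3) D])
  finally show ?thesis .
qed

lemma represents_eq_one_iff:
  assumes "represents f \<xi>"
  shows "\<xi> = \<one>\<^bsub>HH\<^esub> \<longleftrightarrow> gtriv f"
proof -
  interpret Z: comm_group ZG by (rule comm_group_Z2[OF subgroup_self])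
  obtain c where c: "c \<in> carrier ZG"
      "\<xi> = BG #>\<^bsub>ZG\<^esub> c" "rep f c"
    using assms(1) unfolding represents_def by (elim bexE conjE)
  have "restrict c (carrier G \<times> carrier G) = c"
    using c(1) by (elim Z2_elim[OF subgroup_self]) (simp only: restrict_cochain2[OF subset_refl])
  then have "c \<in> BG \<longleftrightarrow> gtriv f"
    using rep_restrict_mem_B2_iff[OF c(3) subgroup_self] by simp
  moreover have "\<xi> = \<one>\<^bsub>HH\<^esub> \<longleftrightarrow> BG #>\<^bsub>ZG\<^esub> c = BG"
    unfolding c(2) HH_eq by (simp add: FactGroup_def)
  moreover have "\<dots> \<longleftrightarrow> c \<in> BG"
    using Z.coset_join1[OF _ c(1) subgroup_B2[OF subgroup_self]]
      Z.coset_join2[OF c(1) subgroup_B2[OF subgroup_self]] by blast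
  ultimately show ?thesis by simp
qed

abbreviation ShaD where "ShaD \<D> \<equiv> Sha2 \<D> G J (J_act G)"

lemma represents_mem_Sha2:
  assumes "represents f \<xi>" and D: "\<forall>D\<in>\<D>. subgroup D G"
  shows "\<xi> \<in> carrier (ShaD \<D>) \<longleftrightarrow> (\<forall>D\<in>\<D>. jtriv D f)"
proof -
  have "\<xi> \<in> carrier (ShaD \<D>) \<longleftrightarrow>
      (\<lambda>D\<in>\<D>. resD D \<xi>) = (\<lambda>D\<in>\<D>. \<one>\<^bsub>HD D\<^esub>)"
    using represents_closed[OF assms(1)] by (simp add: Sha2_def kernel_def)
  also have "\<dots> \<longleftrightarrow> (\<forall>D\<in>\<D>. resD D \<xi> = \<one>\<^bsub>HD D\<^esub>)"
  proof
    assume L: "(\<lambda>D\<in>\<D>. resD D \<xi>) = (\<lambda>D\<in>\<D>. \<one>\<^bsub>HD D\<^esub>)"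
    show "\<forall>D\<in>\<D>. resD D \<xi> = \<one>\<^bsub>HD D\<^esub>"
    proof
      fix D assume "D \<in> \<D>"
      with fun_cong[OF L, of D]
      show "resD D \<xi> = \<one>\<^bsub>HD D\<^esub>" by simp
    qed
  qed (intro restrict_ext, simp)
  also have "\<dots> \<longleftrightarrow> (\<forall>D\<in>\<D>. jtriv D f)"
    using represents_res2[OF assms(1)] D by simp
  finally show ?thesis .
qed

end

lemma (in group) iso_integer_mod_group:
  assumes p: "prime p" and x: "x \<in> carrier G" "x \<noteq> \<one>" "x [^] p = \<one>"
    and gen: "carrier G \<subseteq> range (\<lambda>k::int. x [^] k)"
  shows "G \<cong> integer_mod_group p"
proof -
  have p0: "p > 0" using p prime_gt_0_nat by blast
  have "ord x dvd p" using x(3) pow_eq_id[OF x(1)] by simp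
  moreover have "ord x \<noteq> 1" using x(2) ord_eq_1[OF x(1)] by simp
  ultimately have ord: "ord x = p" using p by (metis prime_nat_iff)
  have eq: "x [^] i = x [^] j \<longleftrightarrow> int p dvd j - i" for i j :: int
    using int_pow_eq[OF x(1)] ord by simp
  define h where "h i = x [^] i" for i :: int
  have "h \<in> iso (integer_mod_group p) G"
  proof (rule isoI)
    show "h \<in> hom (integer_mod_group p) G"
    proof (rule homI)
      fix i j :: int
      have "h ((i + j) mod int p) = x [^] (i + j)"
        unfolding h_def eq by (simp add: mod_eq_dvd_iff[symmetric])
      then show "h (i \<otimes>\<^bsub>integer_mod_group p\<^esub> j) = h i \<otimes> h j"
        by (simp add: h_def int_pow_mult x(1))
    qed (simp add: h_def x(1))
    show "bij_betw h (carrier (integer_mod_group p)) (carrier G)"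
      unfolding bij_betw_def
    proof
      show "inj_on h (carrier (integer_mod_group p))"
      proof (rule inj_onI)
        fix i j assume "i \<in> carrier (integer_mod_group p)" "j \<in> carrier (integer_mod_group p)" "h i = h j"
        then have "0 \<le> i" "i < int p" "0 \<le> j" "j < int p" "int p dvd j - i"
          using p0 by (auto simp: carrier_integer_mod_group h_def eq)
        then have "j mod int p = i mod int p" by (intro mod_eq_dvd_iff[THEN iffD2])
        then show "i = j" using \<open>0 \<le> i\<close> \<open>i < int p\<close> \<open>0 \<le> j\<close> \<open>j < int p\<close> by simp
      qed
      show "h ` carrier (integer_mod_group p) = carrier G"
      proof
        show "h ` carrier (integer_mod_group p) \<subseteq> carrier G" by (auto simp: h_def x(1))
        show "carrier G \<subseteq> h ` carrier (integer_mod_group p)"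
        proof
          fix y assume "y \<in> carrier G"
          then obtain k :: int where "y = x [^] k" using gen by blast
          also have "\<dots> = h (k mod int p)" unfolding h_def eq by (simp add: mod_eq_dvd_iff[symmetric])
          finally show "y \<in> h ` carrier (integer_mod_group p)"
            using p0 by (intro image_eqI[of _ _ "k mod int p"]) (auto simp: carrier_integer_mod_group)
        qed
      qed
    qed
  qed
  then have "integer_mod_group p \<cong> G" by (auto simp: is_iso_def)
  then show ?thesis by (rule group.iso_sym[OF group_integer_mod_group])
qed

section \<open>The \<open>p\<close>-primary part of Sha as a subgroup of the second
  cohomology\<close>

context coset_module
begin

abbreviation Sha_p where "Sha_p p \<D> \<equiv> p_primary p (ShaD \<D>)"

lemma Sha_p_eq: "Sha_p p \<D> = HH\<lparr>carrier := carrier (Sha_p p \<D>)\<rparr>"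
  by (simp add: p_primary_def Sha2_def)

lemma represents_mem_Sha_p:
  assumes "represents f \<xi>" and "\<forall>D\<in>\<D>. subgroup D G"
  shows "\<xi> \<in> carrier (Sha_p p \<D>) \<longleftrightarrow>
    (\<forall>D\<in>\<D>. jtriv D f) \<and> (\<exists>k. gtriv (\<lambda>g x. nmul (p ^ k) (f g x)))"
proof -
  interpret HH: group HH by (rule group_H2)
  have pow: "\<xi> [^]\<^bsub>ShaD \<D>\<^esub> n = \<xi> [^]\<^bsub>HH\<^esub> n" for n :: nat
    unfolding Sha2_def by (rule HH.nat_pow_consistent[symmetric])
  have one: "\<one>\<^bsub>ShaD \<D>\<^esub> = \<one>\<^bsub>HH\<^esub>" by (simp add: Sha2_def)
  have "\<xi> \<in> carrier (Sha_p p \<D>) \<longleftrightarrow>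
      \<xi> \<in> carrier (ShaD \<D>) \<and> (\<exists>k. \<xi> [^]\<^bsub>HH\<^esub> (p ^ k) = \<one>\<^bsub>HH\<^esub>)"
    unfolding p_primary_def by (simp add: pow one)
  also have "\<dots> \<longleftrightarrow> (\<forall>D\<in>\<D>. jtriv D f) \<and> (\<exists>k. gtriv (\<lambda>g x. nmul (p ^ k) (f g x)))"
    using represents_mem_Sha2[OF assms] represents_eq_one_iff[OF represents_pow[OF assms(1)]] by simp
  finally show ?thesis .
qed

lemma Sha_p_subset: "carrier (Sha_p p \<D>) \<subseteq> carrier HH"
  by (auto simp: p_primary_def Sha2_def kernel_def)

lemma subgroup_Sha_p:
  assumes D: "\<forall>D\<in>\<D>. subgroup D G"
  shows "subgroup (carrier (Sha_p p \<D>)) HH"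
proof -
  interpret HH: group HH by (rule group_H2)
  note mem = represents_mem_Sha_p[OF _ D]
  show ?thesis
  proof (rule HH.subgroupI)
    show "carrier (Sha_p p \<D>) \<subseteq> carrier HH" by (rule Sha_p_subset)
    have "\<one>\<^bsub>HH\<^esub> \<in> carrier (Sha_p p \<D>)"
      by (simp add: mem[OF represents_one] jtriv_zero)
    then show "carrier (Sha_p p \<D>) \<noteq> {}" by blast
  next
    fix \<xi> assume \<xi>: "\<xi> \<in> carrier (Sha_p p \<D>)"
    then have \<xi>H: "\<xi> \<in> carrier HH" using Sha_p_subset by blast
    obtain f where f: "represents f \<xi>" by (rule ex_represents[OF \<xi>H])
    obtain f' where f': "represents f' (inv\<^bsub>HH\<^esub> \<xi>)" by (rule ex_represents[OF HH.inv_closed[OF \<xi>H]])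
    \<comment> \<open>The sum represents the identity, so every triviality property of
      \<open>f\<close> passes to \<open>f'\<close>.\<close>
    have s: "gtriv (\<lambda>g x. f g x + f' g x)"
      using represents_eq_one_iff[OF represents_mult[OF f f']] \<xi>H by simp
    have "jtriv D f'" if "D \<in> \<D>" for D
    proof -
      have 1: "jtriv D f" using \<xi> mem[OF f] that by simp
      have 2: "jtriv D (\<lambda>g x. f g x + f' g x)"
        using jtriv_subset[OF s subgroup.subset[OF bspec[OF D that]]] .
      from jtriv_add[OF 2 jtriv_minus[OF 1]] show ?thesis by simp
    qed
    moreover obtain k where k: "gtriv (\<lambda>g x. nmul (p ^ k) (f g x))"
      using \<xi> mem[OF f] by blast
    from jtriv_add[OF jtriv_nmul[OF s, of "p ^ k"] jtriv_minus[OF k]]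
    have "gtriv (\<lambda>g x. nmul (p ^ k) (f' g x))" by (simp add: nmul_add)
    ultimately show "inv\<^bsub>HH\<^esub> \<xi> \<in> carrier (Sha_p p \<D>)" using mem[OF f'] by blast
  next
    fix \<xi> \<xi>' assume \<xi>: "\<xi> \<in> carrier (Sha_p p \<D>)" and \<xi>': "\<xi>' \<in> carrier (Sha_p p \<D>)"
    obtain f where f: "represents f \<xi>" using ex_represents \<xi> Sha_p_subset by blast
    obtain f' where f': "represents f' \<xi>'" using ex_represents \<xi>' Sha_p_subset by blast
    have "jtriv D (\<lambda>g x. f g x + f' g x)" if "D \<in> \<D>" for D
      by (rule jtriv_add) (use \<xi> \<xi>' mem[OF f] mem[OF f'] that in auto)
    moreover obtain k where k: "gtriv (\<lambda>g x. nmul (p ^ k) (f g x))"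
      using \<xi> mem[OF f] by blast
    obtain k' where k': "gtriv (\<lambda>g x. nmul (p ^ k') (f' g x))"
      using \<xi>' mem[OF f'] by blast
    have "nmul (p ^ (k + k')) (a + a') = nmul (p ^ k') (nmul (p ^ k) a) + nmul (p ^ k) (nmul (p ^ k') a')"
      for a a' :: circle
      by (simp add: nmul_add power_add mult.commute flip: nmul_mult)
    moreover have "gtriv (\<lambda>g x. nmul (p ^ k') (nmul (p ^ k) (f g x)) +
        nmul (p ^ k) (nmul (p ^ k') (f' g x)))"
      by (intro jtriv_add jtriv_nmul k k')
    ultimately have "\<exists>k. gtriv (\<lambda>g x. nmul (p ^ k) (f g x + f' g x))"
      by (intro exI[of _ "k + k'"]) simp
    with \<open>\<And>D. D \<in> \<D> \<Longrightarrow> jtriv D (\<lambda>g x. f g x + f' g x)\<close>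
    show "\<xi> \<otimes>\<^bsub>HH\<^esub> \<xi>' \<in> carrier (Sha_p p \<D>)" using mem[OF represents_mult[OF f f']] by simp
  qed
qed

lemma group_Sha_p: "\<forall>D\<in>\<D>. subgroup D G \<Longrightarrow> group (Sha_p p \<D>)"
  using group.subgroup_imp_group[OF group_H2 subgroup_Sha_p] Sha_p_eq by metis

end

section \<open>Structure of the \<open>p\<close>-primary part of Sha\<close>

context sylow_module
begin

text \<open>A cyclic group has at most one subgroup of order \<open>p\<close>, whereas
  \<open>S\<close> contains \<open>P\<close> and a conjugate of \<open>P\<close> that is not
  contained in \<open>H\<close>.\<close>

lemma not_S_subset_cyclic:
  assumes x: "x \<in> carrier G"
  shows "\<not> S \<subseteq> generate G {x}"
proof
  assume sub: "S \<subseteq> generate G {x}"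
  obtain g a0 where g: "g \<in> carrier G" "a0 \<in> P" "g \<otimes> a0 \<otimes> inv g \<notin> H"
    using not_normal_P by blast
  define a1 where "a1 = g \<otimes> a0 \<otimes> inv g"
  have a0c: "a0 \<in> carrier G" using g(2) by simp
  have a1S: "a1 \<in> S" using conj_S[OF g(1)] g(2) by (simp add: a1_def)
  have ne: "a0 \<noteq> \<one>" using g by (auto simp: subgroup.one_closed[OF subgroup_H])
  interpret GP: group "G\<lparr>carrier := P\<rparr>" by (rule subgroup_imp_group[OF subgroup_P])
  have "a0 [^]\<^bsub>G\<lparr>carrier := P\<rparr>\<^esub> order (G\<lparr>carrier := P\<rparr>) = \<one>"
    using GP.pow_order_eq_1[of a0] g(2) by simp
  then have p0: "a0 [^] p = \<one>" by (simp add: order_def card_P nat_pow_consistent[symmetric])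
  have "a1 [^] k = g \<otimes> a0 [^] k \<otimes> inv g" for k :: nat
  proof (induction k)
    case (Suc k)
    then show ?case using g(1) a0c by (simp add: a1_def m_assoc inv_mult_cancel)
  qed (use g(1) in simp)
  then have p1: "a1 [^] p = \<one>" using p0 g(1) by simp
  obtain k0 :: nat where k0: "a0 = x [^] k0"
    using sub g(2) generate_pow_on_finite_carrier[OF finite_carrier x] by blast
  obtain k1 :: nat where k1: "a1 = x [^] k1"
    using sub a1S generate_pow_on_finite_carrier[OF finite_carrier x] by blast
  define N where "N = ord x"
  have N0: "N dvd k0 * p" using p0 pow_eq_id[OF x] x by (simp add: k0 nat_pow_pow N_def)
  have N1: "N dvd k1 * p" using p1 pow_eq_id[OF x] x by (simp add: k1 nat_pow_pow N_def)
  have Nk0: "\<not> N dvd k0" using ne pow_eq_id[OF x] by (simp add: k0 N_def)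
  have "p dvd N"
  proof (rule ccontr)
    assume "\<not> p dvd N"
    then have "coprime N p" using prime_p by (metis coprime_commute prime_imp_coprime)
    then show False using N0 Nk0 by (simp add: coprime_dvd_mult_left_iff)
  qed
  then obtain M where M: "N = p * M" ..
  have pp: "p > 0" using prime_gt_0_nat[OF prime_p] .
  have "M dvd k0" "M dvd k1" using N0 N1 pp by (simp_all add: M mult.commute)
  then obtain l0 l1 where l0: "k0 = M * l0" and l1: "k1 = M * l1" by (auto simp: dvd_def)
  have "\<not> p dvd l0" using Nk0 by (auto simp: M l0 mult.commute)
  then have "coprime (int l0) (int p)"
    using prime_p by (metis coprime_commute coprime_int_iff prime_imp_coprime)
  \<comment> \<open>The exponents of both elements are multiples of \<open>M\<close>, the order of
    \<open>x\<close> divided by \<open>p\<close>. Inverting \<open>l0\<close> modulo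
    \<open>p\<close> makes \<open>a1\<close> a power of \<open>a0\<close>, which forces it into
    \<open>H\<close>.\<close>
  then obtain u v where uv: "u * int l0 + v * int p = 1"
    using bezout_int[of "int l0" "int p"] by auto
  have "u * int l1 * int k0 = int k1 - int N * (v * int l1)"
  proof -
    have "u * int l1 * int k0 = int M * int l1 * (u * int l0)" by (simp add: l0 algebra_simps)
    also have "u * int l0 = 1 - v * int p" using uv by simp
    finally show ?thesis by (simp add: l1 M algebra_simps)
  qed
  then have "int (ord x) dvd u * int l1 * int k0 - int k1" by (simp add: N_def[symmetric])
  then have "x [^] int k1 = x [^] (u * int l1 * int k0)"
    using int_pow_eq[OF x] by simp
  also have "\<dots> = a0 [^] (u * int l1)"
    by (simp add: k0 int_pow_pow[OF x] mult.commute flip: int_pow_int)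
  finally have "a1 = a0 [^] (u * int l1)" by (simp add: k1 int_pow_int)
  moreover have "a0 [^] (u * int l1) \<in> H"
    using group.int_pow_closed[OF subgroup_imp_group[OF subgroup_H]] g(2) int_pow_consistent[OF subgroup_H]
    by fastforce
  ultimately show False using g(3) by (simp add: a1_def)
qed

text \<open>A class in the \<open>p\<close>-primary part is killed by a power of \<open>p\<close>;
  if it is also killed by some \<open>N\<close> prime to \<open>p\<close>, it is zero.\<close>

lemma trivial_Sha_p:
  assumes D: "\<forall>D\<in>\<D>. subgroup D G"
    and triv: "\<And>f :: 'a \<Rightarrow> 'a \<Rightarrow> circle. gcoc f \<Longrightarrow> (\<forall>D\<in>\<D>. jtriv D f) \<Longrightarrow>
      \<exists>N. coprime N p \<and> gtriv (\<lambda>g x. nmul N (f g x))"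
  shows "trivial_group (Sha_p p \<D>)"
proof -
  have "\<xi> = \<one>\<^bsub>HH\<^esub>" if \<xi>: "\<xi> \<in> carrier (Sha_p p \<D>)" for \<xi>
  proof -
    obtain f where f: "represents f \<xi>" using ex_represents \<xi> Sha_p_subset by blast
    have l: "\<forall>D\<in>\<D>. jtriv D f" using \<xi> represents_mem_Sha_p[OF f D] by simp
    obtain k where k: "gtriv (\<lambda>g x. nmul (p ^ k) (f g x))"
      using \<xi> represents_mem_Sha_p[OF f D] by blast
    obtain N where N: "coprime N p" "gtriv (\<lambda>g x. nmul N (f g x))"
      using triv[OF represents_jcoc[OF f] l] by blast
    have "gtriv f" by (rule jtriv_coprime[OF N(2) k]) (use N(1) in simp)
    then show ?thesis using represents_eq_one_iff[OF f] by simp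
  qed
  moreover have "\<one>\<^bsub>HH\<^esub> \<in> carrier (Sha_p p \<D>)"
    by (rule subgroup.one_closed[OF subgroup_Sha_p[OF D]])
  ultimately have "carrier (Sha_p p \<D>) = {\<one>\<^bsub>HH\<^esub>}" by blast
  then show ?thesis
    using group_Sha_p[OF D] group.trivial_group by blast
qed

lemma coprime_index_S: "coprime index_S p"
  using coprime_index by (simp add: index_S_def coprime_commute)

lemma sha_of_local:
  assumes "cyclic_subgroups G \<subseteq> \<D>" "\<forall>D\<in>\<D>. jtriv D f"
  shows "sha f"
  unfolding sha_def
proof
  fix s assume "s \<in> S"
  then have "generate G {s} \<in> cyclic_subgroups G" unfolding cyclic_subgroups_def by auto
  then show "jtriv (generate G {s}) f" using assms by blast
qed

lemma trivial_Sha_p_unless_conds: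
  assumes D: "\<forall>D\<in>\<D>. subgroup D G" and cyc: "cyclic_subgroups G \<subseteq> \<D>"
    and "\<not> (perfect_cond \<and> central_cond)"
  shows "trivial_group (Sha_p p \<D>)"
proof (rule trivial_Sha_p[OF D])
  fix f :: "'a \<Rightarrow> 'a \<Rightarrow> circle" assume f: "gcoc f" "\<forall>D\<in>\<D>. jtriv D f"
  have "gtriv (\<lambda>g x. nmul (index_S * index_S) (f g x))"
    using sha_jtriv_unless_conds[OF f(1) sha_of_local[OF cyc f(2)] assms(3)] by (simp add: nmul_mult)
  then show "\<exists>N. coprime N p \<and> gtriv (\<lambda>g x. nmul N (f g x))"
    using coprime_index_S by (intro exI[of _ "index_S * index_S"]) simp
qed

lemma trivial_Sha_p_if_S_subset:
  assumes D: "\<forall>D\<in>\<D>. subgroup D G" and "\<exists>D\<in>\<D>. S \<subseteq> D"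
  shows "trivial_group (Sha_p p \<D>)"
proof (rule trivial_Sha_p[OF D])
  fix f :: "'a \<Rightarrow> 'a \<Rightarrow> circle" assume f: "gcoc f" "\<forall>D\<in>\<D>. jtriv D f"
  obtain D where "D \<in> \<D>" "S \<subseteq> D" using assms(2) by blast
  then have "gtriv (\<lambda>g x. nmul index_S (f g x))"
    using jtriv_of_jtriv_S[OF f(1)] f(2) by blast
  then show "\<exists>N. coprime N p \<and> gtriv (\<lambda>g x. nmul N (f g x))"
    using coprime_index_S by blast
qed

text \<open>The class \<open>\<xi>0\<close> constructed from the two conditions has order
  \<open>p\<close> and generates: any \<open>\<xi>\<close> times a suitable power of
  \<open>\<xi>0\<close> is killed both by the square of \<open>index_S\<close> and by a power of
  \<open>p\<close>.\<close>

lemma Sha_p_iso: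
  assumes D: "\<forall>D\<in>\<D>. subgroup D G" and cyc: "cyclic_subgroups G \<subseteq> \<D>"
    and conds: perfect_cond central_cond and nS: "\<And>D. D \<in> \<D> \<Longrightarrow> \<not> S \<subseteq> D"
  shows "Sha_p p \<D> \<cong> integer_mod_group p"
proof -
  interpret HH: group HH by (rule group_H2)
  interpret X: group "Sha_p p \<D>" by (rule group_Sha_p[OF D])
  have X: "subgroup (carrier (Sha_p p \<D>)) HH" by (rule subgroup_Sha_p[OF D])
  note mem = represents_mem_Sha_p[OF _ D]
  obtain f0 :: "'a \<Rightarrow> 'a \<Rightarrow> circle" where f0: "gcoc f0" "\<not> gtriv f0"
      "\<And>g x. g \<in> carrier G \<Longrightarrow> x \<in> carrier G \<Longrightarrow> nmul p (f0 g x) = 0"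
      "\<And>D. subgroup D G \<Longrightarrow> \<not> S \<subseteq> D \<Longrightarrow> jtriv D f0"
    using ex_locally_trivial[OF conds] by metis
  obtain \<xi>0 where \<xi>0: "represents f0 \<xi>0" by (rule ex_represented[OF f0(1)])
  have pf0: "gtriv (\<lambda>g x. nmul p (f0 g x))"
    using jtriv_cong[of "carrier G" "\<lambda>g x. nmul p (f0 g x)" "\<lambda>g x. 0"] f0(3) by (simp add: jtriv_zero)
  have loc0: "\<forall>D\<in>\<D>. jtriv D f0" using f0(4) D nS by blast
  have "\<exists>k. gtriv (\<lambda>g x. nmul (p ^ k) (f0 g x))"
    using pf0 by (intro exI[of _ 1]) simp
  then have \<xi>0X: "\<xi>0 \<in> carrier (Sha_p p \<D>)" using mem[OF \<xi>0] loc0 by blast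
  have \<xi>0H: "\<xi>0 \<in> carrier HH" using \<xi>0X Sha_p_subset by blast
  have one: "\<one>\<^bsub>Sha_p p \<D>\<^esub> = \<one>\<^bsub>HH\<^esub>" by (simp add: p_primary_def Sha2_def)
  have pow: "x [^]\<^bsub>Sha_p p \<D>\<^esub> n = x [^]\<^bsub>HH\<^esub> n" for x and n :: nat
    by (subst Sha_p_eq) (rule HH.nat_pow_consistent[symmetric])
  have sha0: "sha f0" by (rule sha_of_local[OF cyc loc0])
  have nontriv: "\<not> gtriv (\<lambda>g x. nmul index_S (nmul index_S (f0 g x)))"
  proof
    assume "gtriv (\<lambda>g x. nmul index_S (nmul index_S (f0 g x)))"
    then have "gtriv (\<lambda>g x. nmul (index_S * index_S) (f0 g x))" by (simp add: nmul_mult)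
    from jtriv_coprime[OF this pf0] coprime_index_S f0(2) show False by simp
  qed
  show ?thesis
  proof (rule X.iso_integer_mod_group[OF prime_p \<xi>0X])
    show "\<xi>0 \<noteq> \<one>\<^bsub>Sha_p p \<D>\<^esub>" using represents_eq_one_iff[OF \<xi>0] f0(2) one by simp
    show "\<xi>0 [^]\<^bsub>Sha_p p \<D>\<^esub> p = \<one>\<^bsub>Sha_p p \<D>\<^esub>"
      using represents_eq_one_iff[OF represents_pow[OF \<xi>0]] pf0 by (simp add: pow one)
    show "carrier (Sha_p p \<D>) \<subseteq> range (\<lambda>k::int. \<xi>0 [^]\<^bsub>Sha_p p \<D>\<^esub> k)"
    proof
      fix \<xi> assume \<xi>: "\<xi> \<in> carrier (Sha_p p \<D>)"
      obtain f where f: "represents f \<xi>" using ex_represents \<xi> Sha_p_subset by blast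
      have loc: "\<forall>D\<in>\<D>. jtriv D f" using \<xi> mem[OF f] by simp
      obtain k where k: "gtriv (\<lambda>g x. nmul (p ^ k) (f g x))" using \<xi> mem[OF f] by blast
      obtain m where m: "gtriv (\<lambda>g x. nmul index_S (nmul index_S (f g x + nmul m (f0 g x))))"
        using sha_jtriv_combination[OF f0(1) sha0 represents_jcoc[OF f] sha_of_local[OF cyc loc] nontriv]
        by (elim exE)
      define F where "F g x = f g x + nmul m (f0 g x)" for g x
      have F: "represents F (\<xi> \<otimes>\<^bsub>HH\<^esub> \<xi>0 [^]\<^bsub>HH\<^esub> m)"
        unfolding F_def[abs_def] by (rule represents_mult[OF f represents_pow[OF \<xi>0]])
      have 1: "gtriv (\<lambda>g x. nmul (index_S * index_S) (F g x))"
        using m by (simp add: F_def nmul_mult)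
      have "gtriv (\<lambda>g x. nmul p (nmul (p ^ k) (f g x)) + nmul (p ^ k * m) (nmul p (f0 g x)))"
        by (intro jtriv_add jtriv_nmul k pf0)
      moreover have "nmul p (nmul (p ^ k) a) + nmul (p ^ k * m) (nmul p b) = nmul (p ^ Suc k) (a + nmul m b)"
        for a b :: circle
        by (simp add: nmul_add mult.commute mult.left_commute flip: nmul_mult)
      ultimately have 2: "gtriv (\<lambda>g x. nmul (p ^ Suc k) (F g x))"
        by (simp only: F_def)
      have "gtriv F"
        by (rule jtriv_coprime[OF 1 2]) (use coprime_index_S in simp)
      then have "\<xi> \<otimes>\<^bsub>HH\<^esub> \<xi>0 [^]\<^bsub>HH\<^esub> m = \<one>\<^bsub>HH\<^esub>"
        using represents_eq_one_iff[OF F] by simp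
      then have e: "\<xi> \<otimes>\<^bsub>Sha_p p \<D>\<^esub> \<xi>0 [^]\<^bsub>Sha_p p \<D>\<^esub> m = \<one>\<^bsub>Sha_p p \<D>\<^esub>"
        unfolding pow one by (simp add: p_primary_def Sha2_def)
      have "\<xi> = inv\<^bsub>Sha_p p \<D>\<^esub> (\<xi>0 [^]\<^bsub>Sha_p p \<D>\<^esub> m)"
        using X.inv_equality[OF e X.nat_pow_closed[OF \<xi>0X] \<xi>] by simp
      also have "\<dots> = \<xi>0 [^]\<^bsub>Sha_p p \<D>\<^esub> (- int m)"
        using X.int_pow_neg[OF \<xi>0X, of "int m"] by (simp add: int_pow_int)
      finally show "\<xi> \<in> range (\<lambda>k::int. \<xi>0 [^]\<^bsub>Sha_p p \<D>\<^esub> k)" by blast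
    qed
  qed
qed

lemma cyclic_subgroups_subgroup: "\<forall>D\<in>cyclic_subgroups G. subgroup D G"
  unfolding cyclic_subgroups_def using generate_is_subgroup by auto

theorem Sha_structure:
  "(trivial_group (p_primary p (Sha2_omega G J (J_act G))) \<or>
      p_primary p (Sha2_omega G J (J_act G)) \<cong> integer_mod_group p) \<and>
   (\<not> trivial_group (p_primary p (Sha2_omega G J (J_act G))) \<longleftrightarrow> perfect_cond \<and> central_cond) \<and>
   (perfect_cond \<and> central_cond \<longrightarrow>
      (\<forall>\<D>. admissible_set G \<D> \<longrightarrow>
        (if \<exists>D\<in>\<D>. S \<subseteq> D then trivial_group (Sha_p p \<D>) else Sha_p p \<D> \<cong> integer_mod_group p)))"
proof -
  have iso: "Sha_p p (cyclic_subgroups G) \<cong> integer_mod_group p" if perfect_cond central_cond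
    by (rule Sha_p_iso[OF cyclic_subgroups_subgroup subset_refl that])
       (auto simp: cyclic_subgroups_def not_S_subset_cyclic)
  have triv: "trivial_group (Sha_p p (cyclic_subgroups G))" if "\<not> (perfect_cond \<and> central_cond)"
    by (rule trivial_Sha_p_unless_conds[OF cyclic_subgroups_subgroup subset_refl that])
  have nontriv: "\<not> trivial_group (Sha_p p (cyclic_subgroups G))" if perfect_cond central_cond
  proof -
    have "p \<noteq> 1" using prime_gt_1_nat[OF prime_p] by simp
    then show ?thesis
      using isomorphic_group_triviality[OF iso[OF that] group_Sha_p[OF cyclic_subgroups_subgroup]
          group_integer_mod_group] trivial_integer_mod_group by blast
  qed
  have adm: "if \<exists>D\<in>\<D>. S \<subseteq> D then trivial_group (Sha_p p \<D>) else Sha_p p \<D> \<cong> integer_mod_group p"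
    if conds: perfect_cond central_cond and \<D>: "admissible_set G \<D>" for \<D>
  proof -
    have D: "\<forall>D\<in>\<D>. subgroup D G" and cyc: "cyclic_subgroups G \<subseteq> \<D>"
      using \<D> by (auto simp: admissible_set_def)
    show ?thesis
      using trivial_Sha_p_if_S_subset[OF D] Sha_p_iso[OF D cyc conds] by auto
  qed
  show ?thesis
    unfolding Sha2_omega_def using iso triv nontriv adm by blast
qed

end

section \<open>Transitive groups\<close>

lemma transitive_group_facts:
  assumes "transitive_group n G"
  shows "group G" "finite (carrier G)" "\<And>g. g \<in> carrier G \<Longrightarrow> g permutes {1..n}"
    "mult G = (\<circ>)" "\<one>\<^bsub>G\<^esub> = id"
proof -
  obtain K where K: "subgroup K (sym_group n)" "G = (sym_group n)\<lparr>carrier := K\<rparr>"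
    using assms by (auto simp: transitive_group_def)
  show "group G" using group.subgroup_imp_group[OF sym_group_is_group K(1)] K(2) by simp
  have "K \<subseteq> {p. p permutes {1..n}}"
    using subgroup.subset[OF K(1)] by (simp add: sym_group_def)
  then show "finite (carrier G)" "\<And>g. g \<in> carrier G \<Longrightarrow> g permutes {1..n}"
    using finite_permutations[of "{1..n}"] finite_subset K(2) by auto
  show "mult G = (\<circ>)" "\<one>\<^bsub>G\<^esub> = id" using K(2) by (simp_all add: sym_group_def)
qed

lemma subgroup_stabilizer:
  fixes G (structure)
  assumes "transitive_group n G"
  shows "subgroup (stabilizer G (\<lambda>g. g) i) G"
proof -
  note G = transitive_group_facts[OF assms]
  interpret group G by (rule G(1))
  have app: "(g \<otimes> h) x = g (h x)" for g h x by (simp add: G(4))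
  show ?thesis
  proof (rule subgroupI)
    show "stabilizer G (\<lambda>g. g) i \<noteq> {}" using one_closed G(5) by (auto simp: stabilizer_def)
  next
    fix g assume g: "g \<in> stabilizer G (\<lambda>g. g) i"
    then have "inv g \<otimes> g = \<one>" by (simp add: stabilizer_def)
    from fun_cong[OF this, of i] g show "inv g \<in> stabilizer G (\<lambda>g. g) i"
      by (simp add: stabilizer_def app G(5))
  qed (auto simp: stabilizer_def app)
qed

text \<open>The map sending \<open>g\<close> to \<open>g i\<close> has the cosets of the stabilizer
  as fibres, one for each of the \<open>n\<close> points by transitivity.\<close>

lemma card_stabilizer:
  fixes G (structure)
  assumes trans: "transitive_group n G" and i: "i \<in> {1..n}"
  shows "card (carrier G) = n * card (stabilizer G (\<lambda>g. g) i)"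
proof -
  note G = transitive_group_facts[OF trans]
  interpret group G by (rule G(1))
  have app: "(g \<otimes> h) x = g (h x)" for g h x by (simp add: G(4))
  define H where "H = stabilizer G (\<lambda>g. g) i"
  have fiber: "card {g \<in> carrier G. g i = j} = card H" if j: "j \<in> {1..n}" for j
  proof -
    obtain k where k: "k \<in> carrier G" "k i = j" using trans i j unfolding transitive_group_def by blast
    have ik: "(inv k) j = i"
      using fun_cong[OF l_inv[OF k(1)], of i] k(2) by (simp add: app G(5))
    have "bij_betw (\<lambda>g. k \<otimes> g) H {g \<in> carrier G. g i = j}"
    proof (rule bij_betw_byWitness[where f' = "\<lambda>g. inv k \<otimes> g"])
      show "\<forall>g\<in>H. inv k \<otimes> (k \<otimes> g) = g"
        using k(1) by (simp add: H_def stabilizer_def inv_mult_cancel)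
      show "\<forall>g\<in>{g \<in> carrier G. g i = j}. k \<otimes> (inv k \<otimes> g) = g"
        using k(1) by (simp add: mult_inv_cancel)
      show "(\<lambda>g. k \<otimes> g) ` H \<subseteq> {g \<in> carrier G. g i = j}"
      proof
        fix z assume "z \<in> (\<lambda>g. k \<otimes> g) ` H"
        then obtain g where g: "g \<in> carrier G" "g i = i" "z = k \<otimes> g" by (auto simp: H_def stabilizer_def)
        then show "z \<in> {g \<in> carrier G. g i = j}" using k by (simp add: app)
      qed
      show "(\<lambda>g. inv k \<otimes> g) ` {g \<in> carrier G. g i = j} \<subseteq> H"
      proof
        fix z assume "z \<in> (\<lambda>g. inv k \<otimes> g) ` {g \<in> carrier G. g i = j}"
        then obtain g where g: "g \<in> carrier G" "g i = j" "z = inv k \<otimes> g" by auto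
        then have "z \<in> carrier G" "z i = i" using k ik by (simp_all add: app)
        then show "z \<in> H" by (simp add: H_def stabilizer_def)
      qed
    qed
    then show ?thesis by (simp add: bij_betw_same_card)
  qed
  have "carrier G = (\<Union>j\<in>{1..n}. {g \<in> carrier G. g i = j})"
    using permutes_in_image[OF G(3)] i by auto
  then have "card (carrier G) = card (\<Union>j\<in>{1..n}. {g \<in> carrier G. g i = j})" by simp
  also have "\<dots> = (\<Sum>j\<in>{1..n}. card {g \<in> carrier G. g i = j})"
    by (rule card_UN_disjoint) (use G(2) in auto)
  also have "\<dots> = n * card H" using fiber by simp
  finally show ?thesis by (simp add: H_def)
qed

lemma sylow_module_of_transitive:
  fixes p n :: nat and G (structure) and H S :: "(nat \<Rightarrow> nat) set"
  assumes prime_p: "prime p"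
    and trans: "transitive_group n G"
    and pn: "p dvd n" "\<not> p\<^sup>2 dvd n"
    and "corresponding_subgroup n G H"
    and syl: "sylow_subgroup p G S"
    and normal_S: "S \<lhd> G"
    and iso_S: "G\<lparr>carrier := S\<rparr> \<cong> integer_mod_group p \<times>\<times> integer_mod_group p"
  shows "sylow_module G H S p"
proof -
  note G = transitive_group_facts[OF trans]
  interpret group G by (rule G(1))
  interpret S: normal S G by (rule normal_S)
  obtain i where i: "i \<in> {1..n}" "H = stabilizer G (\<lambda>g. g) i"
    using assms(5) by (auto simp: corresponding_subgroup_def)
  have H: "subgroup H G" unfolding i(2) by (rule subgroup_stabilizer[OF trans])
  have finS: "finite S" using finite_subset[OF S.subset G(2)] .
  have finH: "finite H" using finite_subset[OF subgroup.subset[OF H] G(2)] .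
  have p0: "p > 0" and p1: "p > 1" using prime_p prime_gt_0_nat prime_gt_1_nat by auto
  obtain \<theta> where \<theta>: "\<theta> \<in> iso (G\<lparr>carrier := S\<rparr>) (integer_mod_group p \<times>\<times> integer_mod_group p)"
    using iso_S by (auto simp: is_iso_def)
  have comm_S: "s \<otimes> t = t \<otimes> s" if "s \<in> S" "t \<in> S" for s t
  proof -
    have hom: "\<theta> (s \<otimes> t) = \<theta> s \<otimes>\<^bsub>integer_mod_group p \<times>\<times> integer_mod_group p\<^esub> \<theta> t" if "s \<in> S" "t \<in> S" for s t
      using \<theta> that by (auto simp: iso_def hom_def)
    have "\<theta> (s \<otimes> t) = \<theta> (t \<otimes> s)"
      using hom[OF that] hom[OF that(2,1)] by (simp add: DirProd_def split_beta add.commute)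
    moreover have "inj_on \<theta> S" using \<theta> by (simp add: iso_def bij_betw_def)
    ultimately show ?thesis using that by (auto dest: inj_onD)
  qed
  have card_S: "card S = p\<^sup>2"
  proof -
    have "card S = card (carrier (integer_mod_group p \<times>\<times> integer_mod_group p))"
      using \<theta> by (auto simp: iso_def intro: bij_betw_same_card)
    also have "\<dots> = p * p" using p0 by (simp add: card_cartesian_product carrier_integer_mod_group)
    finally show ?thesis by (simp add: power2_eq_square)
  qed
  have mult2: "multiplicity p (card (carrier G)) = 2"
    using syl card_S p1 by (simp add: sylow_subgroup_def order_def)
  have cG: "card (carrier G) > 0" using G(2) one_closed by (auto simp: card_gt_0_iff)
  obtain m where m: "card (carrier G) = p ^ 2 * m" "\<not> p dvd m"
    using multiplicity_decompose'[of "card (carrier G)" p] cG prime_p mult2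
    by (metis not_gr0 not_prime_unit)
  have cop: "coprime p (card (carrier G) div card S)"
    using m p0 prime_p by (simp add: card_S prime_imp_coprime)
  obtain n' where n': "n = p * n'" using pn(1) ..
  have pn': "\<not> p dvd n'" using pn(2) by (auto simp: n' power2_eq_square)
  have "card (carrier G) = n * card H" unfolding i(2) by (rule card_stabilizer[OF trans i(1)])
  then have eq: "p * m = n' * card H" using m(1) p0 by (simp add: n' power2_eq_square)
  \<comment> \<open>Comparing \<open>n * card H\<close> with the order of \<open>G\<close> shows
    that \<open>p\<close> divides \<open>card H\<close>, and divides it only once: the order of
    \<open>G\<close> has \<open>p\<close>-part of exponent 2 and the degree takes one
    factor.\<close>
  have pH: "p dvd card H"
    using prime_p pn' eq by (metis dvd_triv_left prime_dvd_multD)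
  have p2H: "\<not> p\<^sup>2 dvd card H"
  proof
    assume "p\<^sup>2 dvd card H"
    then obtain k where "card H = p * p * k" by (auto simp: power2_eq_square)
    then have "p * m = p * (p * (n' * k))" using eq by (simp add: algebra_simps)
    then have "m = p * (n' * k)" using p0 by simp
    then show False using m(2) by simp
  qed
  have SH: "subgroup (S \<inter> H) G" using subgroups_Inter_pair[OF S.subgroup_axioms H] .
  have "card (S \<inter> H) dvd card H"
  proof -
    interpret GH: group "G\<lparr>carrier := H\<rparr>" by (rule subgroup_imp_group[OF H])
    from GH.lagrange[OF subgroup_incl[OF SH H]] show ?thesis
      by (simp add: order_def) (metis dvd_triv_right)
  qed
  then obtain k where k: "card H = card (S \<inter> H) * k" ..
  have SHpos: "card (S \<inter> H) > 0"
    using subgroup.one_closed[OF SH] finS by (metis card_gt_0_iff empty_iff finite_Int)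
  \<comment> \<open>The index of \<open>S \<inter> H\<close> in \<open>H\<close> divides that of
    \<open>S\<close> in \<open>G\<close>, which is prime to \<open>p\<close>, so
    \<open>S \<inter> H\<close> carries the whole \<open>p\<close>-part of \<open>H\<close>.\<close>
  have "card H div card (H \<inter> S) dvd card (carrier G) div card S"
    by (rule index_inter_dvd[OF G(2) normal_S H])
  then have "k dvd m" using k SHpos m(1) p0 by (simp add: Int_commute card_S)
  then have "\<not> p dvd k" using m(2) by (meson dvd_trans)
  then have pSH: "p dvd card (S \<inter> H)" using pH k prime_p by (metis prime_dvd_multD)
  have card_P: "card (S \<inter> H) = p"
  proof -
    interpret GS: group "G\<lparr>carrier := S\<rparr>" by (rule subgroup_imp_group[OF S.subgroup_axioms])
    from GS.lagrange[OF subgroup_incl[OF SH S.subgroup_axioms]] have "card (S \<inter> H) dvd p ^ 2"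
      using card_S by (simp add: order_def) (metis dvd_triv_right)
    then obtain j where j: "j \<le> 2" "card (S \<inter> H) = p ^ j"
      using divides_primepow_nat[OF prime_p] by blast
    have "j \<noteq> 0" using pSH j(2) p1 by (auto intro: ccontr)
    moreover have "j \<noteq> 2" using p2H \<open>card (S \<inter> H) dvd card H\<close> j(2) by auto
    ultimately have "j = 1" using j(1) by linarith
    then show ?thesis using j(2) by simp
  qed
  \<comment> \<open>If all conjugates of elements of \<open>S \<inter> H\<close> stayed in the
    stabilizer of \<open>i\<close>, transitivity would make each of these elements fix every point,
    so \<open>S \<inter> H\<close> would be trivial.\<close>
  have not_normal: "\<exists>g\<in>carrier G. \<exists>a\<in>S \<inter> H. g \<otimes> a \<otimes> inv g \<notin> H"
  proof (rule ccontr)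
    assume "\<not> ?thesis"
    then have all: "g \<otimes> a \<otimes> inv g \<in> H" if "g \<in> carrier G" "a \<in> S \<inter> H" for g a using that by blast
    have "a = \<one>" if a: "a \<in> S \<inter> H" for a
    proof -
      have ac: "a \<in> carrier G" using a by simp
      have "a j = j" for j
      proof (cases "j \<in> {1..n}")
        case True
        then obtain g where g: "g \<in> carrier G" "g i = j"
          using trans i(1) unfolding transitive_group_def by blast
        have "inv g \<otimes> a \<otimes> g \<in> H" using all[of "inv g" a] g(1) a by simp
        then have e: "(inv g \<otimes> a \<otimes> g) i = i" by (simp add: i(2) stabilizer_def)
        have "a \<otimes> g = g \<otimes> (inv g \<otimes> a \<otimes> g)"
          using g(1) ac by (simp add: m_assoc mult_inv_cancel)
        then have "(a \<otimes> g) i = g ((inv g \<otimes> a \<otimes> g) i)" by (simp add: G(4))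
        then have "(a \<otimes> g) i = j" using e g(2) by simp
        then show ?thesis using g(2) by (simp add: G(4))
      next
        case False
        then show ?thesis using permutes_not_in[OF G(3)[OF ac]] by simp
      qed
      then show ?thesis by (auto simp: G(5))
    qed
    then have "S \<inter> H \<subseteq> {\<one>}" by blast
    then have "card (S \<inter> H) \<le> 1" by (metis card.empty card_insert_disjoint card_mono empty_iff finite.emptyI finite_insert One_nat_def)
    then show False using card_P p1 by simp
  qed
  show ?thesis
    by (intro sylow_module.intro coset_module.intro coset_module_axioms.intro
        sylow_module_axioms.intro is_group G(2) H prime_p normal_S comm_S card_S cop card_P not_normal)
qed

theorem theorem6p16:
  fixes p n :: nat and G :: "(nat \<Rightarrow> nat) monoid" and H S :: "(nat \<Rightarrow> nat) set"
  assumes "prime p"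
    and "transitive_group n G"
    and "p dvd n" and "\<not> p\<^sup>2 dvd n"
    and "corresponding_subgroup n G H"
    and "sylow_subgroup p G S"
    and "S \<lhd> G"
    and "G\<lparr>carrier := S\<rparr> \<cong> integer_mod_group p \<times>\<times> integer_mod_group p"
  shows
    "(trivial_group (p_primary p (Sha2_omega G (J_module G H) (J_act G))) \<or>
      p_primary p (Sha2_omega G (J_module G H) (J_act G)) \<cong> integer_mod_group p) \<and>
     (\<not> trivial_group (p_primary p (Sha2_omega G (J_module G H) (J_act G))) \<longleftrightarrow>
      commutator_subgroup G S (carrier G) = S \<and>
      normalizer G (S \<inter> H) = centralizer G (S \<inter> H)) \<and>
     (commutator_subgroup G S (carrier G) = S \<and>
      normalizer G (S \<inter> H) = centralizer G (S \<inter> H) \<longrightarrow>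
      (\<forall>\<D>. admissible_set G \<D> \<longrightarrow>
        (if \<exists>D\<in>\<D>. S \<subseteq> D
         then trivial_group (p_primary p (Sha2 \<D> G (J_module G H) (J_act G)))
         else p_primary p (Sha2 \<D> G (J_module G H) (J_act G)) \<cong> integer_mod_group p)))"
  by (rule sylow_module.Sha_structure[OF sylow_module_of_transitive[OF assms]])

end
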